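(* Suppose that there exist $C>0$ and $\varrho\in(0,1)$ such that $|\rho_n|\leq C\varrho^n$ for all $n\geq 1$. Then for all $\beta>0$, in each of the following cases there exist a constant $c_\beta>0$ and (in cases 1 and 2) a slowly varying function $\tilde L$ such that, with $\sim$ meaning that the ratio of the two sides tends to $1$: 1. if $K(n)=L(n)n^{-(1+\alpha)}$ with $0<\alpha<1$, then $$F^a(\beta,h_c^a(\beta)+\delta)\ \sim\ c_\beta\,\tilde L(1/\delta)\,\delta^{1/\alpha}\quad\text{as }\delta\searrow 0;$$ 2. if $K(n)=L(n)/n^2$ with $\sum_{n\geq 1}L(n)/n=+\infty$, then $$F^a(\beta,h_c^a(\beta)+\delta)\ \sim\ c_\beta\,\tilde L(1/\delta)\,\delta\quad\text{as }\delta\searrow 0,$$ where $\tilde L(1/\delta)\to 0$ as $\delta\searrow 0$; 3. if $\sum_{n\geq 1}nK(n)<+\infty$, then $$F^a(\beta,h_c^a(\beta)+\delta)\ \sim\ c_\beta\,\delta\quad\text{as }\delta\searrow 0.$$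
   Context: Let $(T_n)_{n\geq 1}$ be i.i.d. random variables with values in $\mathbb{N}^*=\{1,2,\dots\}$ under a law $P$ (expectation $E$), with $K(n):=P(T_1=n)=L(n)n^{-(1+\alpha)}>0$ for all $n\ge1$, where $\alpha\geq 0$, $L$ is a slowly varying function (at infinity), and $\sum_{n\geq 1}K(n)=1$. Let $\tau_0=0$, $\tau_n=T_1+\cdots+T_n$, let $\tau=\{\tau_k: k\ge 0\}$ be the renewal process, and $\delta_n:=\mathbf{1}_{\{n\in\tau\}}$ (the symbol $\delta$ without index denotes a real number). Let $\omega=(\omega_n)_{n\geq 0}$ be a stationary Gaussian sequence (law $\mathbb{P}$, expectation $\mathbb{E}$), independent of $\tau$, with $\mathbb{E}(\omega_0)=0$, $\mathbb{E}(\omega_0^2)=1$, and let $\rho_n:=\operatorname{Cov}(\omega_0,\omega_n)$ for $n\ge1$. For $\beta\geq 0$, $h\in\mathbb{R}$, $n\ge1$, the annealed partition function is $$Z^a_{n,\beta,h}:=\mathbb{E}\,E\Big[\exp\Big(\sum_{k=1}^n(\beta\omega_k+h)\delta_k\Big)\delta_n\Big]=E\Big[\exp\Big(\big(h+\tfrac{\beta^2}{2}\big)\sum_{k=1}^n\delta_k+\beta^2\sum_{1\leq k<l\leq n}\rho_{l-k}\delta_k\delta_l\Big)\delta_n\Big].$$ The annealed free energy is $F^a(\beta,h):=\lim_{n\to+\infty}\frac1n\log Z^a_{n,\beta,h}$, which exists and is finite whenever $\sum_{n}|\rho_n|<\infty$, and the annealed critical point is $h_c^a(\beta):=\sup\{h\in\mathbb{R}: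 F^a(\beta,h)=0\}$. *)

theory Defs
  imports "HOL-Probability.Probability" "HOL-Library.Landau_Symbols"
begin

definition slowly_varying :: "(real \<Rightarrow> real) \<Rightarrow> bool" where
  "slowly_varying L \<longleftrightarrow>
     set_borel_measurable borel {0<..} L \<and> (\<forall>x>0. L x > 0) \<and>
     (\<forall>c>0. ((\<lambda>x. L (c * x) / L x) \<longlongrightarrow> 1) at_top)"

text \<open>Inter-arrival times are indexed from 1; the value \<open>T 0\<close> is never used.\<close>

definition iid_interarrivals :: "'a measure \<Rightarrow> (nat \<Rightarrow> 'a \<Rightarrow> nat) \<Rightarrow> bool" where
  "iid_interarrivals P T \<longleftrightarrow>
     prob_space P \<and>
     prob_space.indep_vars P (\<lambda>_. count_space UNIV) T {1..} \<and>
     (\<forall>i\<ge>1. distr P (count_space UNIV) (T i) = distr P (count_space UNIV) (T 1)) \<and>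
     (\<forall>i\<ge>1. \<forall>x\<in>space P. T i x \<ge> 1)"

definition interarrival_mass :: "'a measure \<Rightarrow> (nat \<Rightarrow> 'a \<Rightarrow> nat) \<Rightarrow> nat \<Rightarrow> real" where
  "interarrival_mass P T n = measure P {x \<in> space P. T 1 x = n}"

definition renewal_time :: "(nat \<Rightarrow> 'a \<Rightarrow> nat) \<Rightarrow> nat \<Rightarrow> 'a \<Rightarrow> nat" where
  "renewal_time T k x = (\<Sum>i=1..k. T i x)"

definition renewal_set :: "(nat \<Rightarrow> 'a \<Rightarrow> nat) \<Rightarrow> 'a \<Rightarrow> nat set" where
  "renewal_set T x = {renewal_time T k x |k. True}"

definition renewal_ind :: "(nat \<Rightarrow> 'a \<Rightarrow> nat) \<Rightarrow> nat \<Rightarrow> 'a \<Rightarrow> real" where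
  "renewal_ind T n x = (if n \<in> renewal_set T x then 1 else 0)"

text \<open>Point masses count as Gaussian laws, so degenerate Gaussian vectors are allowed.\<close>

definition gaussian_law :: "real measure \<Rightarrow> bool" where
  "gaussian_law \<nu> \<longleftrightarrow>
     (\<exists>\<mu> \<sigma>. \<sigma> > 0 \<and> \<nu> = density lborel (\<lambda>x. ennreal (normal_density \<mu> \<sigma> x))) \<or>
     (\<exists>\<mu>. \<nu> = return borel \<mu>)"

definition gaussian_sequence :: "'b measure \<Rightarrow> (nat \<Rightarrow> 'b \<Rightarrow> real) \<Rightarrow> bool" where
  "gaussian_sequence Q \<omega> \<longleftrightarrow>
     (\<forall>n. \<omega> n \<in> borel_measurable Q) \<and>
     (\<forall>m (a :: nat \<Rightarrow> real). gaussian_law (distr Q borel (\<lambda>w. \<Sum>i<m. a i * \<omega> i w)))"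

definition stationary_sequence :: "'b measure \<Rightarrow> (nat \<Rightarrow> 'b \<Rightarrow> real) \<Rightarrow> bool" where
  "stationary_sequence Q \<omega> \<longleftrightarrow>
     (\<forall>m. distr Q (\<Pi>\<^sub>M n\<in>UNIV. borel) (\<lambda>w n. \<omega> (n + m) w) =
          distr Q (\<Pi>\<^sub>M n\<in>UNIV. borel) (\<lambda>w n. \<omega> n w))"

definition covariance :: "'b measure \<Rightarrow> ('b \<Rightarrow> real) \<Rightarrow> ('b \<Rightarrow> real) \<Rightarrow> real" where
  "covariance Q X Y =
     (\<integral>w. (X w - (\<integral>v. X v \<partial>Q)) * (Y w - (\<integral>v. Y v \<partial>Q)) \<partial>Q)"

text \<open>
  The disorder \<open>\<omega>\<close> lives on \<open>Q\<close> and the renewal process on \<open>P\<close>; their independence is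
  expressed by integrating against the product of the two laws.
\<close>

definition annealed_partition ::
    "'a measure \<Rightarrow> (nat \<Rightarrow> 'a \<Rightarrow> nat) \<Rightarrow> 'b measure \<Rightarrow> (nat \<Rightarrow> 'b \<Rightarrow> real) \<Rightarrow>
     nat \<Rightarrow> real \<Rightarrow> real \<Rightarrow> real" where
  "annealed_partition P T Q \<omega> n \<beta> h =
     (\<integral>w. (\<integral>x. exp (\<Sum>k=1..n. (\<beta> * \<omega> k w + h) * renewal_ind T k x) * renewal_ind T n x \<partial>P) \<partial>Q)"

definition annealed_free_energy ::
    "'a measure \<Rightarrow> (nat \<Rightarrow> 'a \<Rightarrow> nat) \<Rightarrow> 'b measure \<Rightarrow> (nat \<Rightarrow> 'b \<Rightarrow> real) \<Rightarrow>
     real \<Rightarrow> real \<Rightarrow> real" where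
  "annealed_free_energy P T Q \<omega> \<beta> h =
     lim (\<lambda>n. 1 / real n * ln (annealed_partition P T Q \<omega> n \<beta> h))"

definition annealed_critical_point ::
    "'a measure \<Rightarrow> (nat \<Rightarrow> 'a \<Rightarrow> nat) \<Rightarrow> 'b measure \<Rightarrow> (nat \<Rightarrow> 'b \<Rightarrow> real) \<Rightarrow> real \<Rightarrow> real" where
  "annealed_critical_point P T Q \<omega> \<beta> = Sup {h. annealed_free_energy P T Q \<omega> \<beta> h = 0}"

end

theory Submission
  imports Defs
begin

text \<open>
  Read the renewal points from left to right. The past acts on the next inter-arrival time \<open>t\<close> only
  through the field \<open>v s = \<beta>\<^sup>2 \<Sum> \<rho> (s + d)\<close>, where \<open>d\<close> runs over the distances from the current point to
  the previous points (itself included). A jump \<open>t\<close> has weight \<open>K t * exp (v t)\<close> and replaces \<open>v\<close> by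
  \<open>v (t + s) + \<beta>\<^sup>2 * \<rho> s\<close>, which contracts the norm \<open>sup \<bar>v s\<bar> / r ^ s\<close> by \<open>r ^ t\<close>. Hence the transfer operator
  with the additional factor \<open>exp (- l * t)\<close> has a Perron eigenvalue \<open>Lam l\<close> with a log-Lipschitz
  eigenfunction, and the free energy at distance \<open>\<delta>\<close> above the critical point is the solution \<open>l\<close> of
  \<open>gap l = \<delta>\<close>, where \<open>gap l = ln (Lam 0) - ln (Lam l)\<close>.

  Let \<open>U l = l\<close> if \<open>K\<close> has finite mean and \<open>U l = \<Sum> K n * (1 - exp (- l * n))\<close> otherwise. Normalised
  by the eigenfunction at \<open>0\<close>, the operator at \<open>l\<close> loses the mass \<open>U l * H v + o(U l)\<close> in the field \<open>v\<close>, for a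
  fixed positive function \<open>H\<close>; for infinite mean this holds because the long jumps dominate and forget
  the past. A first-order test function then gives \<open>gap l \<sim> m * U l\<close>. For infinite mean \<open>U\<close> is regularly varying of index \<open>\<alpha>\<close>, and the inverse of
  \<open>gap\<close> is regularly varying of index \<open>1 / \<alpha>\<close>.
\<close>

section \<open>Interaction fields and the transfer operator\<close>

text \<open>The weight of a jump depends on all earlier contacts, so no finite-state chain describes
  the model, and every estimate has to be uniform over the fields. The uniformity comes from
  explicit contraction bounds rather than from compactness. When the mean jump is infinite, the
  operator has no derivative in \<open>l\<close> at 0. The eigenvalue is therefore not
  differentiated but enclosed between values for which an explicit function is a sub- or a
  supersolution (\<open>collatz_wielandt\<close>). The same comparison in finite volume identifies
  the free energy: it is the \<open>l\<close> at which \<open>exp h * Lam l\<close> passes 1, so the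
  critical point is \<open>- ln (Lam 0) - \<beta>\<^sup>2 / 2\<close>. Slow variation is given for
  fixed dilations only. The one place where uniformity in the dilation matters is the ratio of
  \<open>L\<close> at n + 1 and n; from there on, integer ratios of \<open>K\<close> and the
  monotonicity of \<open>U\<close> suffice.\<close>

lemma coupling_bound:
  fixes p p' F F' D :: "nat \<Rightarrow> real"
  assumes p: "p sums 1" "\<And>n. p n \<ge> 0" and p': "p' sums 1" "\<And>n. p' n \<ge> 0"
    and m: "0 \<le> m" "m \<le> 1" "\<And>n. m * p' n \<le> p n"
    and F: "\<And>n. c \<le> F n" "\<And>n. F n \<le> c + q" and F': "\<And>n. c \<le> F' n" "\<And>n. F' n \<le> c + q"
    and D: "\<And>n. F n - F' n \<le> D n" "\<And>n. \<bar>D n\<bar> \<le> q"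
  shows "(\<Sum>n. p n * F n) - (\<Sum>n. p' n * F' n) \<le> m * (\<Sum>n. p' n * D n) + (1 - m) * q"
proof -
  have sm: "summable (\<lambda>n. w n * X n)" if "w sums 1" "\<And>n. w n \<ge> 0" "\<And>n. \<bar>X n\<bar> \<le> B" for w X :: "nat \<Rightarrow> real" and B
  proof (rule summable_comparison_test')
    show "summable (\<lambda>n. w n * B)" using that(1) by (intro summable_mult2) (auto simp: sums_iff)
    show "norm (w n * X n) \<le> w n * B" if "n \<ge> 0" for n
      using \<open>w n \<ge> 0\<close> that \<open>\<bar>X n\<bar> \<le> B\<close> by (auto simp: abs_mult intro!: mult_left_mono)
  qed
  have Fb: "\<bar>F n\<bar> \<le> \<bar>c\<bar> + \<bar>c + q\<bar>" and Fb': "\<bar>F' n\<bar> \<le> \<bar>c\<bar> + \<bar>c + q\<bar>" for n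
    using F[of n] F'[of n] by linarith+
  have s1: "summable (\<lambda>n. p n * F n)" and s2: "summable (\<lambda>n. p' n * F' n)" and s3: "summable (\<lambda>n. p' n * D n)"
    using sm[OF p Fb] sm[OF p' Fb'] sm[OF p' D(2)] by auto
  have sp: "summable p" "suminf p = 1" "summable p'" "suminf p' = 1" using p p' by (auto simp: sums_iff)
  have t: "p n * F n - p' n * F' n \<le> m * (p' n * D n) + (p n - m * p' n) * q + c * (p n - p' n)" for n
  proof -
    have "p n * (F n - c) \<le> m * p' n * (F n - c) + (p n - m * p' n) * q"
    proof -
      have "(p n - m * p' n) * (F n - c) \<le> (p n - m * p' n) * q"
        using m(3)[of n] F[of n] by (intro mult_left_mono) auto
      then show ?thesis by (simp add: algebra_simps)
    qed
    moreover have "p' n * (F' n - c) \<ge> m * p' n * (F' n - c)"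
      using m p'(2)[of n] F'[of n] mult_right_mono[of m 1 "p' n * (F' n - c)"] by (simp add: mult.assoc)
    moreover have "m * p' n * (F n - F' n) \<le> m * p' n * D n"
      using m p'(2)[of n] D(1)[of n] by (intro mult_left_mono) auto
    ultimately show ?thesis by (simp add: algebra_simps)
  qed
  have "(\<lambda>n. m * (p' n * D n) + (p n - m * p' n) * q + c * (p n - p' n)) sums
        (m * (\<Sum>n. p' n * D n) + (1 - m * 1) * q + c * (1 - 1))"
    using p p' s3 by (intro sums_add sums_mult sums_mult2 sums_diff summable_sums) auto
  moreover have "(\<lambda>n. p n * F n - p' n * F' n) sums ((\<Sum>n. p n * F n) - (\<Sum>n. p' n * F' n))"
    using s1 s2 by (intro sums_diff summable_sums)
  ultimately show ?thesis using sums_le[OF t] by fastforce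
qed

locale pinning =
  fixes K \<eta> :: "nat \<Rightarrow> real" and r C :: real
  assumes K_pos: "K (Suc n) > 0" and K_sums: "(\<lambda>n. K (Suc n)) sums 1"
    and r: "0 < r" "r < 1" and C: "C > 0" and eta: "\<bar>\<eta> s\<bar> \<le> C * r ^ s"
begin

text \<open>The solution of R = R * r + C: a jump shrinks the old field by at least the factor
  \<open>r\<close> and the new point adds at most \<open>C\<close>, so the ball
  \<open>fields\<close> of this radius is invariant.\<close>

definition R :: real where "R = C / (1 - r)"
definition fields :: "(nat \<Rightarrow> real) set" where "fields = {v. \<forall>s. \<bar>v s\<bar> \<le> R * r ^ s}"
text \<open>Distance at most \<open>e\<close> in the weighted supremum norm, as a relation, so that
  no supremum has to be formed.\<close>

definition near :: "real \<Rightarrow> (nat \<Rightarrow> real) \<Rightarrow> (nat \<Rightarrow> real) \<Rightarrow> bool" where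
  "near e u v \<longleftrightarrow> (\<forall>s. \<bar>u s - v s\<bar> \<le> e * r ^ s)"
text \<open>The index \<open>n\<close> stands for a jump of length \<open>Suc n\<close>, here and in
  \<open>wt\<close>, so that series over all naturals run over the positive jump lengths.\<close>

definition next_field :: "nat \<Rightarrow> (nat \<Rightarrow> real) \<Rightarrow> nat \<Rightarrow> real" where
  "next_field n v = (\<lambda>s. v (Suc n + s) + \<eta> s)"
definition wt :: "real \<Rightarrow> (nat \<Rightarrow> real) \<Rightarrow> nat \<Rightarrow> real" where
  "wt l v n = K (Suc n) * exp (v (Suc n) - l * real (Suc n))"
definition transfer :: "real \<Rightarrow> ((nat \<Rightarrow> real) \<Rightarrow> real) \<Rightarrow> (nat \<Rightarrow> real) \<Rightarrow> real" where
  "transfer l f v = (\<Sum>n. wt l v n * f (next_field n v))"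
definition loglip :: "real \<Rightarrow> ((nat \<Rightarrow> real) \<Rightarrow> real) \<Rightarrow> bool" where
  "loglip b f \<longleftrightarrow> (\<forall>v\<in>fields. f v > 0) \<and>
     (\<forall>u\<in>fields. \<forall>v\<in>fields. \<forall>e\<ge>0. near e u v \<longrightarrow> f u \<le> exp (b * e) * f v)"
text \<open>The fixed point of \<open>a \<mapsto> r * (1 + a)\<close>: with this exponent the log-Lipschitz cone is invariant.\<close>

definition a :: real where "a = r / (1 - r)"

lemma R_pos: "R > 0" using C r by (simp add: R_def)
lemma a_pos: "a > 0" using r by (simp add: a_def)
lemma a_eq: "r * (1 + a) = a" using r by (simp add: a_def field_simps)
lemma K_nonneg: "K (Suc n) \<ge> 0" using K_pos[of n] by simp
lemma rpow_le: "r ^ n \<le> 1" "0 < r ^ n" "r ^ Suc n \<le> r"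
  using r by (auto simp: power_le_one mult_le_cancel_left1)

lemma K_le_1: "K (Suc n) \<le> 1"
proof -
  have "K (Suc n) \<le> (\<Sum>n. K (Suc n))"
    using sum_le_suminf[of "\<lambda>n. K (Suc n)" "{n}"] K_sums K_nonneg by (auto simp: sums_iff)
  then show ?thesis using K_sums by (simp add: sums_iff)
qed

lemma fields_bound: "v \<in> fields \<Longrightarrow> \<bar>v s\<bar> \<le> R * r ^ s" by (auto simp: fields_def)
lemma fields_le_R: assumes "v \<in> fields" shows "\<bar>v s\<bar> \<le> R"
proof -
  have "R * r ^ s \<le> R * 1" using R_pos rpow_le by (intro mult_left_mono) auto
  then show ?thesis using fields_bound[OF assms, of s] by simp
qed
lemma zero_fields [simp]: "(\<lambda>_. 0) \<in> fields" using R_pos r by (auto simp: fields_def)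
lemma eta_fields [simp]: "\<eta> \<in> fields"
proof -
  have "C \<le> R" using C r by (simp add: R_def field_simps)
  then have "C * r ^ s \<le> R * r ^ s" for s using r by (intro mult_right_mono) auto
  then show ?thesis using eta by (auto simp: fields_def intro: order_trans)
qed

lemma next_field_fields [simp]: assumes "v \<in> fields" shows "next_field n v \<in> fields"
proof -
  have "\<bar>v (Suc n + s) + \<eta> s\<bar> \<le> R * r ^ s" for s
  proof -
    have "\<bar>v (Suc n + s)\<bar> \<le> R * r ^ s * r ^ Suc n"
      using fields_bound[OF assms, of "Suc n + s"] by (simp add: power_add mult_ac)
    also have "\<dots> \<le> R * r ^ s * r" using R_pos r rpow_le(3) by (intro mult_left_mono) auto
    finally have "\<bar>v (Suc n + s) + \<eta> s\<bar> \<le> R * r ^ s * r + C * r ^ s" using eta[of s] by linarith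
    also have "\<dots> = R * r ^ s" using r by (simp add: R_def field_simps)
    finally show ?thesis .
  qed
  then show ?thesis by (auto simp: fields_def next_field_def)
qed

lemma near_next_field: assumes "near e u v" shows "near (e * r ^ Suc n) (next_field n u) (next_field n v)"
  unfolding near_def
proof
  fix s
  have "\<bar>u (Suc n + s) - v (Suc n + s)\<bar> \<le> e * r ^ (Suc n + s)" using assms unfolding near_def by blast
  then show "\<bar>next_field n u s - next_field n v s\<bar> \<le> e * r ^ Suc n * r ^ s" by (simp add: next_field_def power_add mult_ac)
qed

lemma near_mono: assumes "near e u v" "e \<le> e'" shows "near e' u v"
proof -
  have "e * r ^ s \<le> e' * r ^ s" for s using assms r by (intro mult_right_mono) auto
  then show ?thesis using assms unfolding near_def by (meson order_trans)
qed

lemma near_next_field': assumes "near e u v" "e \<ge> 0" shows "near (e * r) (next_field n u) (next_field n v)"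
  by (rule near_mono[OF near_next_field[OF assms(1)]]) (use assms rpow_le in \<open>intro mult_left_mono; auto\<close>)

lemma near_sym: "near e u v \<Longrightarrow> near e v u" by (simp add: near_def abs_minus_commute)
lemma near_all: assumes "u \<in> fields" "v \<in> fields" shows "near (2 * R) u v"
  unfolding near_def
proof
  fix s show "\<bar>u s - v s\<bar> \<le> 2 * R * r ^ s"
    using fields_bound[OF assms(1), of s] fields_bound[OF assms(2), of s] by linarith
qed
text \<open>A long jump forgets the past: only the newest point still acts, and its field is
  \<open>\<eta>\<close>. In the infinite-mean case this makes the leading coefficient
  explicit.\<close>

lemma near_next_field_eta: assumes "v \<in> fields" shows "near (R * r ^ Suc n) (next_field n v) \<eta>"
proof -
  have "\<bar>next_field n v s - \<eta> s\<bar> \<le> R * r ^ Suc n * r ^ s" for s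
    using fields_bound[OF assms, of "Suc n + s"] by (simp add: next_field_def power_add mult_ac)
  then show ?thesis by (simp add: near_def)
qed

lemma wt_nonneg: "wt l v n \<ge> 0" using K_nonneg by (simp add: wt_def)
lemma wt_pos: "wt l v n > 0" using K_pos by (simp add: wt_def)
lemma wt_le: assumes "v \<in> fields" "l \<ge> 0" shows "wt l v n \<le> exp R * K (Suc n)"
proof -
  have "0 \<le> l * real (Suc n)" using assms(2) by simp
  then have "v (Suc n) - l * real (Suc n) \<le> R" using fields_le_R[OF assms(1), of "Suc n"] by linarith
  then show ?thesis using K_nonneg by (auto simp: wt_def mult.commute intro!: mult_left_mono)
qed

lemma summable_K: "summable (\<lambda>n. K (Suc n))" using K_sums by (simp add: sums_iff)

lemma transfer_summable:
  assumes "v \<in> fields" "l \<ge> 0" "\<And>u. u \<in> fields \<Longrightarrow> \<bar>f u\<bar> \<le> B"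
  shows "summable (\<lambda>n. wt l v n * f (next_field n v))"
proof (rule summable_comparison_test')
  show "summable (\<lambda>n. exp R * K (Suc n) * B)" using summable_K by (intro summable_mult2 summable_mult)
  show "norm (wt l v n * f (next_field n v)) \<le> exp R * K (Suc n) * B" if "n \<ge> 0" for n
    using wt_le[OF assms(1,2), of n] wt_nonneg[of l v n] assms(3)[OF next_field_fields[OF assms(1)], of n]
    by (auto simp: abs_mult intro!: mult_mono)
qed

lemma transfer_cong: "v \<in> fields \<Longrightarrow> (\<And>u. u \<in> fields \<Longrightarrow> f u = f' u) \<Longrightarrow> transfer l f v = transfer l f' v"
  by (simp add: transfer_def)

lemma transfer_mono:
  assumes "v \<in> fields" "l \<ge> 0" "\<And>u. u \<in> fields \<Longrightarrow> \<bar>f u\<bar> \<le> B" "\<And>u. u \<in> fields \<Longrightarrow> \<bar>f' u\<bar> \<le> B'"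
    "\<And>u. u \<in> fields \<Longrightarrow> f u \<le> f' u"
  shows "transfer l f v \<le> transfer l f' v"
  unfolding transfer_def
  by (intro suminf_le transfer_summable[OF assms(1,2)] mult_left_mono wt_nonneg)
     (use assms in auto)

lemma transfer_cmult:
  assumes "v \<in> fields" "l \<ge> 0" "\<And>u. u \<in> fields \<Longrightarrow> \<bar>f u\<bar> \<le> B"
  shows "transfer l (\<lambda>u. c * f u) v = c * transfer l f v"
  using suminf_mult[OF transfer_summable[of v l f B], of c] assms
  by (simp add: transfer_def mult.left_commute)

lemma transfer_diff:
  assumes "v \<in> fields" "l \<ge> 0" "\<And>u. u \<in> fields \<Longrightarrow> \<bar>f u\<bar> \<le> B" "\<And>u. u \<in> fields \<Longrightarrow> \<bar>f' u\<bar> \<le> B'"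
  shows "transfer l (\<lambda>u. f u - f' u) v = transfer l f v - transfer l f' v"
  using suminf_diff[OF transfer_summable[of v l f B] transfer_summable[of v l f' B']] assms
  by (simp add: transfer_def right_diff_distrib)

lemma transfer_const_le:
  assumes "v \<in> fields" "l \<ge> 0" "\<And>u. u \<in> fields \<Longrightarrow> \<bar>f u\<bar> \<le> B"
  shows "\<bar>transfer l f v\<bar> \<le> exp R * B"
proof -
  have B: "B \<ge> 0" using assms(3)[OF assms(1)] by linarith
  have *: "norm (wt l v n * f (next_field n v)) \<le> K (Suc n) * (exp R * B)" for n
    using wt_le[OF assms(1,2), of n] wt_nonneg[of l v n] assms(3)[OF next_field_fields[OF assms(1)], of n]
      mult_mono[of "wt l v n" "exp R * K (Suc n)" "\<bar>f (next_field n v)\<bar>" B]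
    by (auto simp: abs_mult mult_ac K_nonneg)
  have "summable (\<lambda>n. K (Suc n) * (exp R * B))" using summable_K by (rule summable_mult2)
  then have "norm (transfer l f v) \<le> (\<Sum>n. K (Suc n) * (exp R * B))"
    unfolding transfer_def using * by (rule norm_suminf_le[rotated])
  also have "\<dots> = exp R * B" using K_sums suminf_mult2[OF summable_K, of "exp R * B"] by (simp add: sums_iff)
  finally show ?thesis by simp
qed

lemma loglip_pos: "loglip b f \<Longrightarrow> v \<in> fields \<Longrightarrow> f v > 0" by (auto simp: loglip_def)
lemma loglipD: "loglip b f \<Longrightarrow> u \<in> fields \<Longrightarrow> v \<in> fields \<Longrightarrow> e \<ge> 0 \<Longrightarrow> near e u v \<Longrightarrow> f u \<le> exp (b * e) * f v"
  by (auto simp: loglip_def)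
lemma loglip_all: "loglip b f \<Longrightarrow> u \<in> fields \<Longrightarrow> v \<in> fields \<Longrightarrow> f u \<le> exp (b * (2 * R)) * f v"
  using loglipD[of b f u v "2 * R"] near_all R_pos by auto
lemma loglip_bdd: "loglip b f \<Longrightarrow> u \<in> fields \<Longrightarrow> \<bar>f u\<bar> \<le> exp (b * (2 * R)) * f (\<lambda>_. 0)"
  using loglip_all[of b f u "\<lambda>_. 0"] loglip_pos[of b f u] by simp
lemma transfer_summable_loglip:
  assumes "l \<ge> 0" "loglip b f" "v \<in> fields"
  shows "summable (\<lambda>n. wt l v n * f (next_field n v))"
  using transfer_summable[OF assms(3,1), of f] loglip_bdd[OF assms(2)] by blast
lemma loglip_const: "c > 0 \<Longrightarrow> b \<ge> 0 \<Longrightarrow> loglip b (\<lambda>_. c)" by (auto simp: loglip_def mult_le_cancel_right1)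

lemma wt_near:
  assumes "near e u v" "e \<ge> 0"
  shows "wt l u n \<le> exp (r * e) * wt l v n"
proof -
  have "e * r ^ Suc n \<le> e * r" using assms rpow_le(3) by (intro mult_left_mono) auto
  then have "u (Suc n) \<le> v (Suc n) + r * e"
    using assms(1)[unfolded near_def, rule_format, of "Suc n"] by (simp add: mult.commute)
  then have "exp (u (Suc n) - l * real (Suc n)) \<le> exp (r * e) * exp (v (Suc n) - l * real (Suc n))"
    by (simp flip: exp_add)
  then show ?thesis using K_nonneg[of n] by (simp add: wt_def mult.left_commute mult_left_mono)
qed

text \<open>The jump weight costs \<open>r * e\<close>, because it reads the field at distance at
  least 1, and \<open>f\<close> costs \<open>a * (e * r)\<close> at the contracted fields; by
  \<open>a_eq\<close> the total is exactly \<open>a * e\<close>.\<close>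

lemma wt_loglip:
  assumes "near e u v" "e \<ge> 0" "loglip a f" "u \<in> fields" "v \<in> fields"
  shows "wt l u n * f (next_field n u) \<le> exp (a * e) * (wt l v n * f (next_field n v))"
proof -
  have "f (next_field n u) \<le> exp (a * (e * r)) * f (next_field n v)"
    using loglipD[OF assms(3) _ _ _ near_next_field'[OF assms(1,2)]] assms r by simp
  then have "wt l u n * f (next_field n u) \<le> (exp (r * e) * wt l v n) * (exp (a * (e * r)) * f (next_field n v))"
    using loglip_pos[OF assms(3)] assms wt_nonneg
    by (intro mult_mono wt_near) (auto intro: less_imp_le)
  also have "\<dots> = exp (r * (1 + a) * e) * (wt l v n * f (next_field n v))"
    by (simp add: mult_exp_exp[symmetric] algebra_simps)
  finally show ?thesis by (simp add: a_eq)
qed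

lemma transfer_pos:
  assumes "l \<ge> 0" "loglip b f" "v \<in> fields"
  shows "transfer l f v > 0"
  unfolding transfer_def
  using transfer_summable_loglip[OF assms] loglip_pos[OF assms(2)] wt_pos assms(3)
  by (intro suminf_pos) auto

lemma transfer_loglip:
  assumes "l \<ge> 0" "loglip a f"
  shows "loglip a (transfer l f)"
  unfolding loglip_def
proof (intro conjI ballI allI impI)
  fix v assume v: "v \<in> fields"
  show "transfer l f v > 0" using transfer_pos assms v by blast
next
  fix u v e assume *: "u \<in> fields" "v \<in> fields" "0 \<le> (e::real)" "near e u v"
  have s: "summable (\<lambda>n. wt l w n * f (next_field n w))" if "w \<in> fields" for w
    using transfer_summable_loglip[OF assms that] .
  have "transfer l f u \<le> (\<Sum>n. exp (a * e) * (wt l v n * f (next_field n v)))"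
    unfolding transfer_def using wt_loglip[OF *(4,3) assms(2) *(1,2)] s *
    by (intro suminf_le summable_mult) auto
  also have "\<dots> = exp (a * e) * transfer l f v" unfolding transfer_def using s * by (intro suminf_mult) auto
  finally show "transfer l f u \<le> exp (a * e) * transfer l f v" .
qed

section \<open>Contraction of the normalised operator in a truncated Lipschitz seminorm\<close>

definition avg :: "real \<Rightarrow> ((nat \<Rightarrow> real) \<Rightarrow> real) \<Rightarrow> ((nat \<Rightarrow> real) \<Rightarrow> real) \<Rightarrow> (nat \<Rightarrow> real) \<Rightarrow> real" where
  "avg l g f v = transfer l (\<lambda>u. g u * f u) v / transfer l g v"

text \<open>Large enough that the total variation distance of the jump laws at two fields at distance \<open>e\<close>,
  at most \<open>2 * a * e\<close>, is absorbed by the slack \<open>(1 - r) / 2\<close> in the contraction of \<open>N * e\<close>.\<close>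

definition N :: real where "N = 4 * a / (1 - r)"
lemma N_pos: "N > 0" using a_pos r by (simp add: N_def)

text \<open>Lipschitz constant for the metric \<open>min 1 (N * e)\<close>. Since this metric is at
  most 1, the single number \<open>q\<close> bounds the oscillation as well as the local
  variation.\<close>

definition lip :: "real \<Rightarrow> ((nat \<Rightarrow> real) \<Rightarrow> real) \<Rightarrow> bool" where
  "lip q f \<longleftrightarrow> (\<forall>u\<in>fields. \<forall>v\<in>fields. \<forall>e\<ge>0. near e u v \<longrightarrow> f u - f v \<le> q * min 1 (N * e))"

lemma lipD: "lip q f \<Longrightarrow> u \<in> fields \<Longrightarrow> v \<in> fields \<Longrightarrow> e \<ge> 0 \<Longrightarrow> near e u v \<Longrightarrow> f u - f v \<le> q * min 1 (N * e)"
  by (auto simp: lip_def)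

lemma lip_osc: assumes "lip q f" "q \<ge> 0" "u \<in> fields" "v \<in> fields" shows "f u - f v \<le> q"
proof -
  have "f u - f v \<le> q * min 1 (N * (2 * R))" using lipD[OF assms(1,3,4)] near_all assms R_pos by auto
  also have "\<dots> \<le> q * 1" using assms by (intro mult_left_mono) auto
  finally show ?thesis by simp
qed

text \<open>The normalised weights form a probability law on jumps, so \<open>avg l g\<close> is a
  Markov operator, the Doob transform of \<open>transfer l\<close> by \<open>g\<close> when
  \<open>g\<close> is an eigenfunction.\<close>

lemma avg_sums:
  assumes "l \<ge> 0" "loglip a g" "v \<in> fields"
  shows "(\<lambda>n. wt l v n * g (next_field n v) / transfer l g v) sums 1"
proof -
  have "(\<lambda>n. wt l v n * g (next_field n v)) sums transfer l g v"
    unfolding transfer_def by (intro summable_sums transfer_summable_loglip[OF assms])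
  then show ?thesis using sums_divide[of _ _ "transfer l g v"] transfer_pos[OF assms] by fastforce
qed

lemma avg_eq:
  assumes "l \<ge> 0" "loglip a g" "v \<in> fields" "\<And>u. u \<in> fields \<Longrightarrow> \<bar>f u\<bar> \<le> B"
  shows "avg l g f v = (\<Sum>n. wt l v n * g (next_field n v) / transfer l g v * f (next_field n v))"
proof -
  have "summable (\<lambda>n. wt l v n * (g (next_field n v) * f (next_field n v)))"
  proof (rule transfer_summable[OF assms(3,1), of "\<lambda>u. g u * f u" "exp (a * (2 * R)) * g (\<lambda>_. 0) * B"])
    fix u assume "u \<in> fields"
    then show "\<bar>g u * f u\<bar> \<le> exp (a * (2 * R)) * g (\<lambda>_. 0) * B"
      using loglip_bdd[OF assms(2)] assms(4) mult_mono[of "\<bar>g u\<bar>" _ "\<bar>f u\<bar>" B] 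
      by (force simp: abs_mult)
  qed
  from suminf_divide[OF this, of "transfer l g v"] show ?thesis
    by (simp add: avg_def transfer_def mult_ac)
qed

lemma lip_bdd: assumes "lip q f" "q \<ge> 0" "u \<in> fields" shows "\<bar>f u\<bar> \<le> \<bar>f (\<lambda>_. 0)\<bar> + q"
  using lip_osc[OF assms(1,2,3) zero_fields] lip_osc[OF assms(1,2) zero_fields assms(3)] by linarith

text \<open>For close fields the weighted distance \<open>N * e\<close> contracts. For distant ones the truncation at \<open>1\<close> is
  active, and the gain comes from coupling both chains to make the same long jump \<open>n0\<close>.\<close>

lemma avg_contraction:
  assumes l: "l \<ge> 0"
  shows "\<exists>\<theta>. 0 < \<theta> \<and> \<theta> < 1 \<and> (\<forall>g q f. loglip a g \<longrightarrow> q \<ge> 0 \<longrightarrow> lip q f \<longrightarrow> lip (q * \<theta>) (avg l g f))"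
proof -
  have "(\<lambda>n. r ^ n) \<longlonglongrightarrow> 0" using r by (intro LIMSEQ_realpow_zero) auto
  then have "(\<lambda>n. 2 * R * N * r ^ n) \<longlonglongrightarrow> 0" using tendsto_mult_right_zero by blast
  then have "eventually (\<lambda>n. 2 * R * N * r ^ n < 1 / 2) sequentially" by (rule order_tendstoD) simp
  \<comment> \<open>Any two fields are at distance at most \<open>2 * R\<close>; after a common jump
    of length \<open>Suc n0\<close> their truncated distance is at most 1/2.\<close>
  then obtain n0 where n0: "2 * R * N * r ^ n0 < 1 / 2" by (auto simp: eventually_sequentially)
  have n0': "2 * R * N * r ^ Suc n0 \<le> 1 / 2"
  proof -
    have "2 * R * N * r ^ Suc n0 \<le> 2 * R * N * r ^ n0"
      using R_pos N_pos r by (intro mult_left_mono) (auto simp: mult_le_cancel_right1)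
    then show ?thesis using n0 by simp
  qed
  define m0 where "m0 = exp (- (2 * a * (2 * R)))"
  \<comment> \<open>Lower bound, uniform in the field and in \<open>g\<close>, for the normalised
    probability of the jump \<open>Suc n0\<close>: smallest jump weight, smallest ratio of two
    values of \<open>g\<close>, and the bound \<open>exp R\<close> for the mass of the
    operator.\<close>
  define \<kappa> where "\<kappa> = K (Suc n0) * exp (- R - l * real (Suc n0)) * exp (- (a * (2 * R))) / exp R"
  have m0: "0 < m0" "m0 < 1" using a_pos R_pos by (auto simp: m0_def)
  have \<kappa>: "\<kappa> > 0" using K_pos by (simp add: \<kappa>_def)
  \<comment> \<open>The first entry is the rate for close fields. The second is the rate for distant
    ones: in the coupled part of mass \<open>m0\<close>, half of the oscillation is gained with
    probability at least \<open>\<kappa>\<close>.\<close>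
  define \<theta> where "\<theta> = max ((1 + r) / 2) (1 - m0 * (\<kappa> / 2))"
  have \<theta>: "0 < \<theta>" "\<theta> < 1" using r m0 \<kappa> by (auto simp: \<theta>_def less_max_iff_disj)
  have "lip (q * \<theta>) (avg l g f)" if g: "loglip a g" and q: "q \<ge> 0" and f: "lip q f" for g q f
    unfolding lip_def
  proof (intro ballI allI impI)
    fix u v e assume u: "u \<in> fields" and v: "v \<in> fields" and e: "0 \<le> (e::real)" and ne: "near e u v"
    define p where "p = (\<lambda>v n. wt l v n * g (next_field n v) / transfer l g v)"
    have ps: "p v sums 1" if "v \<in> fields" for v unfolding p_def using avg_sums[OF l g that] .
    have p0: "p v n \<ge> 0" if "v \<in> fields" for v n
      unfolding p_def using wt_nonneg loglip_pos[OF g] transfer_pos[OF l g] that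
      by (intro divide_nonneg_nonneg mult_nonneg_nonneg) (auto intro: less_imp_le)
    have fB: "\<bar>f u\<bar> \<le> \<bar>f (\<lambda>_. 0)\<bar> + q" if "u \<in> fields" for u using lip_bdd[OF f q that] .
    \<comment> \<open>One factor \<open>exp (a * e)\<close> comes from the unnormalised weights, the
      other from the normalising constants.\<close>
    have pn: "exp (- (2 * a * e)) * p v n \<le> p u n" if "u \<in> fields" "v \<in> fields" "e \<ge> 0" "near e u v" for u v e n
    proof -
      have 1: "wt l v n * g (next_field n v) \<le> exp (a * e) * (wt l u n * g (next_field n u))"
        using wt_loglip[OF near_sym[OF that(4)] that(3) g that(2,1)] .
      have 2: "transfer l g u \<le> exp (a * e) * transfer l g v"
        using loglipD[OF transfer_loglip[OF l g] that] .
      have "wt l v n * g (next_field n v) * transfer l g u \<le> (exp (a * e) * (wt l u n * g (next_field n u))) * (exp (a * e) * transfer l g v)"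
        by (rule mult_mono[OF 1 2])
           (use transfer_pos[OF l g that(1)] loglip_pos[OF g, of "next_field n u"] that wt_nonneg[of l u n] in auto)
      also have "\<dots> = exp (2 * a * e) * (wt l u n * g (next_field n u)) * transfer l g v"
        using exp_add[of "a * e" "a * e"] by (simp add: algebra_simps)
      finally show ?thesis
        using transfer_pos[OF l g that(1)] transfer_pos[OF l g that(2)]
        by (simp add: p_def exp_minus field_simps)
    qed
    define c where "c = Inf (f ` fields)"
    have bd: "bdd_below (f ` fields)" using fB by (force intro!: bdd_belowI2[of _ "- (\<bar>f (\<lambda>_. 0)\<bar> + q)"] simp: abs_le_iff)
    have c1: "c \<le> f w" if "w \<in> fields" for w unfolding c_def using that bd by (intro cInf_lower) auto
    have c2: "f w \<le> c + q" if "w \<in> fields" for w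
    proof -
      have "f w - q \<le> c" unfolding c_def
      proof (rule cInf_greatest)
        show "f ` fields \<noteq> {}" using zero_fields by blast
        show "f w - q \<le> x" if "x \<in> f ` fields" for x
          using that lip_osc[OF f q \<open>w \<in> fields\<close>] by (auto simp: algebra_simps)
      qed
      then show ?thesis by simp
    qed
    \<comment> \<open>Stated for every admissible bound on the distance: the given \<open>e\<close>
      serves close fields, \<open>2 * R\<close> serves distant ones.\<close>
    have main: "avg l g f u - avg l g f v \<le> exp (- (2 * a * e)) * (\<Sum>n. p v n * (q * min 1 (N * (e * r ^ Suc n)))) + (1 - exp (- (2 * a * e))) * q"
      if ne: "near e u v" and e: "e \<ge> 0" for e
    proof -
      have "(\<Sum>n. p u n * f (next_field n u)) - (\<Sum>n. p v n * f (next_field n v)) \<le>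
        exp (- (2 * a * e)) * (\<Sum>n. p v n * (q * min 1 (N * (e * r ^ Suc n)))) + (1 - exp (- (2 * a * e))) * q"
      proof (rule coupling_bound[where c = c])
        show "exp (- (2 * a * e)) \<le> 1" using a_pos e by simp
        fix n
        show "f (next_field n u) - f (next_field n v) \<le> q * min 1 (N * (e * r ^ Suc n))"
          using lipD[OF f _ _ _ near_next_field[OF ne]] u v e rpow_le(2)[of "Suc n"] by (auto simp del: power_Suc)
        have "0 \<le> min 1 (N * (e * r ^ Suc n))" using e N_pos r by simp
        then show "\<bar>q * min 1 (N * (e * r ^ Suc n))\<bar> \<le> q" using q by (auto simp: abs_mult intro!: mult_left_le)
      qed (use ps p0 pn[OF u v e ne] u v c1 c2 in auto)
      then show ?thesis unfolding p_def
        using avg_eq[OF l g u fB] avg_eq[OF l g v fB] by simp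
    qed
    have smin: "summable (\<lambda>n. p v n * (q * min 1 (N * (e * r ^ Suc n))))" if "e \<ge> 0" for e
    proof (rule summable_comparison_test')
      show "summable (\<lambda>n. p v n * q)" using ps[OF v] by (intro summable_mult2) (auto simp: sums_iff)
      fix n :: nat
      have "0 \<le> min 1 (N * (e * r ^ Suc n))" using that N_pos r by simp
      then show "norm (p v n * (q * min 1 (N * (e * r ^ Suc n)))) \<le> p v n * q"
        using q p0[OF v] by (auto simp: abs_mult intro!: mult_left_mono mult_left_le)
    qed
    show "avg l g f u - avg l g f v \<le> q * \<theta> * min 1 (N * e)"
    proof (cases "N * e \<le> 1")
      case True
      have "(\<Sum>n. p v n * (q * min 1 (N * (e * r ^ Suc n)))) \<le> (\<Sum>n. p v n * (q * (N * (e * r))))"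
      proof (intro suminf_le smin e summable_mult2)
        show "summable (p v)" using ps[OF v] by (auto simp: sums_iff)
        fix n
        have "N * (e * r ^ Suc n) \<le> N * (e * r)" using e N_pos rpow_le(3) by (intro mult_left_mono) auto
        then show "p v n * (q * min 1 (N * (e * r ^ Suc n))) \<le> p v n * (q * (N * (e * r)))"
          using p0[OF v] q by (intro mult_left_mono) auto
      qed
      also have "\<dots> = q * (N * (e * r))" using ps[OF v] suminf_mult2[of "p v" "q * (N * (e * r))"] by (auto simp: sums_iff)
      finally have 1: "(\<Sum>n. p v n * (q * min 1 (N * (e * r ^ Suc n)))) \<le> q * (N * (e * r))" .
      have "exp (- (2 * a * e)) * (\<Sum>n. p v n * (q * min 1 (N * (e * r ^ Suc n)))) \<le> 1 * (q * (N * (e * r)))"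
        using 1 a_pos e q N_pos r by (intro order_trans[OF mult_left_mono[OF 1]] mult_right_mono) auto
      moreover have "(1 - exp (- (2 * a * e))) * q \<le> (2 * a * e) * q"
        using q exp_ge_add_one_self[of "- (2 * a * e)"] by (intro mult_right_mono) linarith+
      ultimately have "avg l g f u - avg l g f v \<le> q * (N * (e * r)) + 2 * a * e * q" using main[OF ne e] by linarith
      also have "2 * a * e * q = q * (N * e) * ((1 - r) / 2)" using r by (simp add: N_def)
      also have "q * (N * (e * r)) + q * (N * e) * ((1 - r) / 2) = q * (N * e) * ((1 + r) / 2)" by (simp add: field_simps)
      also have "\<dots> \<le> q * (N * e) * \<theta>" using q N_pos e by (intro mult_left_mono) (auto simp: \<theta>_def)
      finally show ?thesis using True by (simp add: mult_ac)
    next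
      case False
      have D: "q * min 1 (N * ((2 * R) * r ^ Suc n)) \<le> q - q * (if n = n0 then 1 / 2 else 0)" for n
        using n0' q mult_left_mono[of "min 1 (N * ((2 * R) * r ^ Suc n))" "1 - (if n = n0 then 1 / 2 else 0)" q]
        by (auto simp: algebra_simps split: if_splits)
      have s2: "(\<lambda>n. p v n * (q - q * (if n = n0 then 1 / 2 else 0))) sums (q - q * (p v n0 / 2))"
      proof -
        have "(\<lambda>n. p v n * q - (if n = n0 then p v n0 * q / 2 else 0)) sums (1 * q - p v n0 * q / 2)"
          using ps[OF v] sums_single[of n0 "\<lambda>n. p v n0 * q / 2"] by (intro sums_diff sums_mult2) auto
        moreover have "(\<lambda>n. p v n * (q - q * (if n = n0 then 1 / 2 else 0))) = (\<lambda>n. p v n * q - (if n = n0 then p v n0 * q / 2 else 0))"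
          by (auto simp: algebra_simps)
        ultimately show ?thesis by (simp add: mult_ac)
      qed
      have "(\<Sum>n. p v n * (q * min 1 (N * ((2 * R) * r ^ Suc n)))) \<le> (\<Sum>n. p v n * (q - q * (if n = n0 then 1 / 2 else 0)))"
        using smin[of "2 * R"] R_pos s2 D p0[OF v] by (intro suminf_le mult_left_mono) (auto simp: sums_iff)
      also have "\<dots> = q - q * (p v n0 / 2)" using s2 by (simp add: sums_iff)
      also have "\<dots> \<le> q - q * (\<kappa> / 2)"
      proof -
        have "\<kappa> \<le> p v n0"
        proof -
          define g0 where "g0 = g (next_field n0 v)"
          have g0: "g0 > 0" using loglip_pos[OF g] v by (simp add: g0_def)
          have "transfer l g v \<le> exp R * (exp (a * (2 * R)) * g0)"
            using transfer_const_le[OF v l, of g "exp (a * (2 * R)) * g0"] loglip_all[OF g] loglip_pos[OF g] v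
            unfolding g0_def by force
          moreover have "wt l v n0 \<ge> K (Suc n0) * exp (- R - l * real (Suc n0))"
            using fields_le_R[OF v, of "Suc n0"] K_nonneg by (auto simp: wt_def intro!: mult_left_mono)
          ultimately have "K (Suc n0) * exp (- R - l * real (Suc n0)) * g0 / (exp R * (exp (a * (2 * R)) * g0)) \<le> wt l v n0 * g0 / transfer l g v"
            using g0 K_nonneg[of n0] transfer_pos[OF l g v] wt_nonneg[of l v n0] by (intro frac_le mult_right_mono mult_nonneg_nonneg) auto
          moreover have "\<kappa> = K (Suc n0) * exp (- R - l * real (Suc n0)) * g0 / (exp R * (exp (a * (2 * R)) * g0))"
            using g0 by (simp add: \<kappa>_def exp_minus field_simps)
          ultimately show ?thesis unfolding p_def g0_def[symmetric] by simp
        qed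
        then show ?thesis using q by (auto intro!: mult_left_mono)
      qed
      finally have 1: "(\<Sum>n. p v n * (q * min 1 (N * ((2 * R) * r ^ Suc n)))) \<le> q - q * (\<kappa> / 2)" .
      have "avg l g f u - avg l g f v \<le> m0 * (q - q * (\<kappa> / 2)) + (1 - m0) * q"
      proof -
        have "avg l g f u - avg l g f v \<le> m0 * (\<Sum>n. p v n * (q * min 1 (N * ((2 * R) * r ^ Suc n)))) + (1 - m0) * q"
          unfolding m0_def using R_pos by (intro main[OF near_all[OF u v]]) simp
        then show ?thesis using mult_left_mono[OF 1, of m0] m0 by linarith
      qed
      also have "\<dots> = q * (1 - m0 * (\<kappa> / 2))" by (simp add: algebra_simps)
      also have "\<dots> \<le> q * \<theta>" using q by (intro mult_left_mono) (auto simp: \<theta>_def)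
      finally show ?thesis using False by simp
    qed
  qed
  then show ?thesis using \<theta> by blast
qed

end

section \<open>Perron eigenvalue\<close>

lemma geometric_limit:
  fixes x :: "nat \<Rightarrow> real"
  assumes \<theta>: "0 < \<theta>" "\<theta> < 1" and d: "\<And>k. \<bar>x (Suc k) - x k\<bar> \<le> q * \<theta> ^ k"
  shows "\<exists>m. \<forall>k. \<bar>x k - m\<bar> \<le> q * \<theta> ^ k / (1 - \<theta>)"
proof -
  define d where "d k = x (Suc k) - x k" for k
  have geo: "(\<lambda>j. q * \<theta> ^ (j + k)) sums (q * \<theta> ^ k / (1 - \<theta>))" for k
    using sums_mult[OF geometric_sums[of \<theta>], of "q * \<theta> ^ k"] \<theta> by (simp add: power_add mult_ac)
  have sd: "summable d"
    by (rule summable_comparison_test'[of "\<lambda>j. q * \<theta> ^ (j + 0)" 0]) (use geo[of 0] d in \<open>auto simp: sums_iff d_def\<close>)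
  have "\<bar>x k - (x 0 + suminf d)\<bar> \<le> q * \<theta> ^ k / (1 - \<theta>)" for k
  proof -
    have "x 0 + suminf d - x k = (\<Sum>j. d (j + k))"
      using suminf_minus_initial_segment[OF sd, of k] sum_lessThan_telescope[of x k] by (simp add: d_def[abs_def])
    moreover have "norm (\<Sum>j. d (j + k)) \<le> (\<Sum>j. q * \<theta> ^ (j + k))"
      by (rule norm_suminf_le) (use geo[of k] assms(3) in \<open>auto simp: d_def sums_iff\<close>)
    ultimately show ?thesis using geo[of k] by (simp add: sums_iff)
  qed
  then show ?thesis by blast
qed

context pinning
begin

lemma avg_between:
  assumes "l \<ge> 0" "loglip a g" "v \<in> fields" "\<And>u. u \<in> fields \<Longrightarrow> c \<le> f u" "\<And>u. u \<in> fields \<Longrightarrow> f u \<le> d"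
  shows "c \<le> avg l g f v" "avg l g f v \<le> d"
proof -
  define p where "p n = wt l v n * g (next_field n v) / transfer l g v" for n
  have p: "p sums 1" unfolding p_def using avg_sums[OF assms(1-3)] .
  have p0: "p n \<ge> 0" for n
    unfolding p_def using wt_nonneg loglip_pos[OF assms(2)] transfer_pos[OF assms(1,2)] assms(3)
      by (intro divide_nonneg_nonneg mult_nonneg_nonneg) (auto intro: less_imp_le)
  have fB: "\<bar>f u\<bar> \<le> \<bar>c\<bar> + \<bar>d\<bar>" if "u \<in> fields" for u using assms(4,5)[OF that] by linarith
  have e: "avg l g f v = (\<Sum>n. p n * f (next_field n v))" unfolding p_def by (rule avg_eq[OF assms(1-3) fB])
  have s: "summable (\<lambda>n. p n * f (next_field n v))"
  proof (rule summable_comparison_test')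
    show "summable (\<lambda>n. p n * (\<bar>c\<bar> + \<bar>d\<bar>))" using p by (intro summable_mult2) (auto simp: sums_iff)
    show "norm (p n * f (next_field n v)) \<le> p n * (\<bar>c\<bar> + \<bar>d\<bar>)" if "n \<ge> 0" for n
      using p0 fB assms(3) by (auto simp: abs_mult intro!: mult_left_mono)
  qed
  have "(\<lambda>n. p n * c) sums (1 * c)" "(\<lambda>n. p n * d) sums (1 * d)" using p by (intro sums_mult2; assumption)+
  moreover have "(\<lambda>n. p n * f (next_field n v)) sums avg l g f v" unfolding e using s by (rule summable_sums)
  moreover have "p n * c \<le> p n * f (next_field n v)" "p n * f (next_field n v) \<le> p n * d" for n
    using p0 assms(3,4,5) by (auto intro!: mult_left_mono)
  ultimately show "c \<le> avg l g f v" "avg l g f v \<le> d"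
    using sums_le[of "\<lambda>n. p n * c" "\<lambda>n. p n * f (next_field n v)"] sums_le[of "\<lambda>n. p n * f (next_field n v)" "\<lambda>n. p n * d"]
    by simp_all
qed

lemma avg_dev:
  assumes "l \<ge> 0" "loglip a g" "v \<in> fields" "lip q f" "q \<ge> 0"
  shows "\<bar>avg l g f v - f v\<bar> \<le> q"
proof -
  have "f v - q \<le> f u" "f u \<le> f v + q" if "u \<in> fields" for u
    using lip_osc[OF assms(4,5,3) that] lip_osc[OF assms(4,5) that assms(3)] by linarith+
  then show ?thesis using avg_between[OF assms(1-3), of "f v - q" f "f v + q"] by (simp add: abs_le_iff)
qed

lemma loglip_lip:
  assumes "loglip b f" "b > 0"
  shows "\<exists>q>0. lip q f"
proof -
  define B where "B = exp (b * (2 * R)) * f (\<lambda>_. 0)"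
  have B: "B > 0" using loglip_pos[OF assms(1)] by (simp add: B_def)
  \<comment> \<open>The first entry covers the oscillation, the second the Lipschitz bound at small
    distances.\<close>
  define q where "q = max B (B * b / N)"
  have q: "q > 0" "B \<le> q" "B * b \<le> q * N" using B N_pos by (auto simp: q_def field_simps less_max_iff_disj max_def)
  have "f u - f v \<le> q * min 1 (N * e)" if uv: "u \<in> fields" "v \<in> fields" "0 \<le> e" "near e u v" for u v e
  proof -
    have fu: "0 < f u" "f u \<le> B" "f v > 0" using loglip_pos[OF assms(1)] loglip_bdd[OF assms(1) uv(1)] uv by (auto simp: B_def)
    have "f u \<le> exp (b * e) * f v" using loglipD[OF assms(1) uv] .
    then have "exp (- (b * e)) * f u \<le> f v" by (simp add: exp_minus field_simps)
    moreover have "(1 - b * e) * f u \<le> exp (- (b * e)) * f u"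
      using exp_ge_add_one_self[of "- (b * e)"] fu by (intro mult_right_mono) auto
    ultimately have "f u - f v \<le> b * e * f u" by (simp add: algebra_simps)
    also have "\<dots> \<le> b * e * B" using fu assms uv by (intro mult_left_mono) auto
    also have "\<dots> \<le> q * N * e" using q(3) uv(3) mult_right_mono[OF q(3), of e] by (simp add: mult_ac)
    finally have "f u - f v \<le> q * (N * e)" by (simp add: mult_ac)
    moreover have "f u - f v \<le> q" using fu q by linarith
    ultimately show ?thesis by (simp add: min_def)
  qed
  then show ?thesis using q(1) by (auto simp: lip_def)
qed

lemma lip_cong: "(\<And>v. v \<in> fields \<Longrightarrow> f v = f' v) \<Longrightarrow> lip q f \<longleftrightarrow> lip q f'"
  by (auto simp: lip_def)

text \<open>The oscillation at stage \<open>k\<close> is at most \<open>q * \<theta> ^ k\<close>, so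
  the limit at one field, which exists because the increments are geometric, is the uniform limit at
  all fields.\<close>

lemma iterate_limit:
  assumes \<theta>: "0 < \<theta>" "\<theta> < 1" and q: "q \<ge> 0" and f: "\<And>k. lip (q * \<theta> ^ k) (f k)"
    and step: "\<And>k v. v \<in> fields \<Longrightarrow> \<bar>f (Suc k) v - f k v\<bar> \<le> q * \<theta> ^ k"
  shows "\<exists>m. \<forall>k. \<forall>v\<in>fields. \<bar>f k v - m\<bar> \<le> 2 * q / (1 - \<theta>) * \<theta> ^ k"
proof -
  obtain m where m: "\<And>k. \<bar>f k (\<lambda>_. 0) - m\<bar> \<le> q * \<theta> ^ k / (1 - \<theta>)"
    using geometric_limit[OF \<theta>, of "\<lambda>k. f k (\<lambda>_. 0)" q] step[OF zero_fields] by blast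
  have "\<bar>f k v - m\<bar> \<le> 2 * q / (1 - \<theta>) * \<theta> ^ k" if v: "v \<in> fields" for k v
  proof -
    have qk: "0 \<le> q * \<theta> ^ k" using q \<theta> by simp
    have "\<bar>f k v - f k (\<lambda>_. 0)\<bar> \<le> q * \<theta> ^ k"
      using lip_osc[OF f qk v zero_fields] lip_osc[OF f qk zero_fields v] by (simp add: abs_le_iff)
    also have "\<dots> \<le> q * \<theta> ^ k / (1 - \<theta>)" using qk \<theta> by (simp add: field_simps mult_left_le)
    finally have "\<bar>f k v - m\<bar> \<le> q * \<theta> ^ k / (1 - \<theta>) + q * \<theta> ^ k / (1 - \<theta>)" using m[of k]
      abs_triangle_ineq[of "f k v - f k (\<lambda>_. 0)" "f k (\<lambda>_. 0) - m"] by simp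
    then show ?thesis by (simp add: mult_ac)
  qed
  then show ?thesis by blast
qed

text \<open>Power iteration from the constant 1. The growth ratio \<open>\<phi> k\<close> of
  consecutive iterates is averaged by the operator normalised with \<open>G k\<close>, so its
  oscillation decays geometrically and it tends to a constant, the eigenvalue. The iterates rescaled
  to the value 1 at the zero field converge to an eigenfunction.\<close>

lemma eigen_ex:
  assumes l: "l \<ge> 0"
  shows "\<exists>\<Lambda> g. \<Lambda> > 0 \<and> loglip a g \<and> (\<forall>v\<in>fields. transfer l g v = \<Lambda> * g v)"
proof -
  obtain \<theta> where \<theta>: "0 < \<theta>" "\<theta> < 1"
    and contr: "\<And>g q f. loglip a g \<Longrightarrow> q \<ge> 0 \<Longrightarrow> lip q f \<Longrightarrow> lip (q * \<theta>) (avg l g f)"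
    using avg_contraction[OF l] by blast
  define G where "G k = (transfer l ^^ k) (\<lambda>_. 1)" for k
  have GS: "G (Suc k) = transfer l (G k)" for k by (simp add: G_def)
  have G: "loglip a (G k)" for k
  proof (induction k)
    case 0 show ?case using a_pos by (simp add: G_def loglip_const)
  next
    case (Suc k) then show ?case using transfer_loglip[OF l] GS by simp
  qed
  have Gpos: "G k v > 0" if "v \<in> fields" for k v using loglip_pos[OF G that] .
  define \<phi> where "\<phi> k v = G (Suc k) v / G k v" for k v
  \<comment> \<open>The normalising function \<open>G k\<close> changes with \<open>k\<close>; this
    is why the contraction factor had to be uniform over log-Lipschitz functions.\<close>
  have \<phi>S: "\<phi> (Suc k) v = avg l (G k) (\<phi> k) v" if "v \<in> fields" for k v
  proof -
    have "G k u * \<phi> k u = G (Suc k) u" if "u \<in> fields" for u using Gpos[OF that, of k] by (simp add: \<phi>_def)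
    then have "transfer l (\<lambda>u. G k u * \<phi> k u) v = G (Suc (Suc k)) v"
      using transfer_cong[OF \<open>v \<in> fields\<close>, of "\<lambda>u. G k u * \<phi> k u" "G (Suc k)" l] by (simp add: GS)
    then show ?thesis by (simp add: avg_def \<phi>_def[of "Suc k"] GS[of k])
  qed
  have \<phi>0: "\<phi> 0 = G 1" by (auto simp: \<phi>_def G_def)
  obtain q where q: "q > 0" "lip q (G 1)" using loglip_lip[OF G a_pos] by blast
  have \<phi>lip: "lip (q * \<theta> ^ k) (\<phi> k)" for k
  proof (induction k)
    case 0 then show ?case using q \<phi>0 by simp
  next
    case (Suc k)
    then have "lip (q * \<theta> ^ k * \<theta>) (avg l (G k) (\<phi> k))" using contr[OF G] q \<theta> by simp
    then show ?case using lip_cong[of "\<phi> (Suc k)" "avg l (G k) (\<phi> k)"] \<phi>S by (simp add: mult_ac)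
  qed
  have step: "\<bar>\<phi> (Suc k) v - \<phi> k v\<bar> \<le> q * \<theta> ^ k" if "v \<in> fields" for k v
    using avg_dev[OF l G that \<phi>lip] q \<theta> \<phi>S[OF that] by simp
  obtain \<Lambda> where \<Lambda>: "\<And>k v. v \<in> fields \<Longrightarrow> \<bar>\<phi> k v - \<Lambda>\<bar> \<le> 2 * q / (1 - \<theta>) * \<theta> ^ k"
    using iterate_limit[OF \<theta> _ \<phi>lip step] q by auto
  define E where "E = exp (a * (2 * R))"
  have E: "E > 0" by (simp add: E_def)
  \<comment> \<open>Averaging preserves lower bounds, so that of \<open>\<phi> 0\<close> survives
    all iterations. It keeps the eigenvalue positive and the divisions by \<open>\<phi> k\<close> at
    the zero field under control.\<close>
  define c0 where "c0 = G 1 (\<lambda>_. 0) / E"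
  have c0: "c0 > 0" using Gpos E by (simp add: c0_def)
  have \<phi>c: "\<phi> k v \<ge> c0" if "v \<in> fields" for k v
    using that
  proof (induction k arbitrary: v)
    case 0
    then show ?case using loglip_all[OF G zero_fields, of v 1] E by (simp add: c0_def \<phi>0 E_def field_simps)
  next
    case (Suc k)
    have "\<phi> k u \<le> \<Lambda> + 2 * q / (1 - \<theta>) * \<theta> ^ k" if "u \<in> fields" for u
      using \<Lambda>[OF that, of k] by linarith
    then have "c0 \<le> avg l (G k) (\<phi> k) v" using Suc.IH by (intro avg_between(1)[OF l G Suc.prems]) 
    then show ?case using \<phi>S[OF Suc.prems] by simp
  qed
  have \<theta>0: "(\<lambda>k. c * \<theta> ^ k) \<longlonglongrightarrow> 0" for c
    using \<theta> by (intro tendsto_mult_right_zero LIMSEQ_realpow_zero) auto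
  have \<phi>lim: "(\<lambda>k. \<phi> k (\<lambda>_. 0)) \<longlonglongrightarrow> \<Lambda>"
  proof (rule LIM_zero_cancel, rule Lim_null_comparison[OF _ \<theta>0])
    show "\<forall>\<^sub>F k in sequentially. norm (\<phi> k (\<lambda>_. 0) - \<Lambda>) \<le> 2 * q / (1 - \<theta>) * \<theta> ^ k"
      using \<Lambda>[OF zero_fields] by simp
  qed
  have \<Lambda>pos: "\<Lambda> > 0"
    using LIMSEQ_le_const[OF \<phi>lim, of c0] \<phi>c[OF zero_fields] c0 by force
  define x where "x k v = G k v / G k (\<lambda>_. 0)" for k v
  have xb: "0 < x k v" "x k v \<le> E" "1 / E \<le> x k v" if "v \<in> fields" for k v
    using Gpos[OF that, of k] Gpos[OF zero_fields, of k] loglip_all[OF G that zero_fields, of k] loglip_all[OF G zero_fields that, of k]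
    by (auto simp: x_def E_def field_simps)
  have xstep: "\<bar>x (Suc k) v - x k v\<bar> \<le> E * q / c0 * \<theta> ^ k" if v: "v \<in> fields" for k v
  proof -
    \<comment> \<open>One iteration multiplies the rescaled iterate by the ratio of two values of
      \<open>\<phi> k\<close>, so its increment is controlled by the oscillation of
      \<open>\<phi> k\<close>.\<close>
    have "x (Suc k) v = x k v * (\<phi> k v / \<phi> k (\<lambda>_. 0))"
      using Gpos[OF v] Gpos[OF zero_fields] by (simp add: x_def \<phi>_def less_imp_neq[symmetric])
    then have "x (Suc k) v - x k v = x k v * ((\<phi> k v - \<phi> k (\<lambda>_. 0)) / \<phi> k (\<lambda>_. 0))"
      using \<phi>c[OF zero_fields, of k] c0 by (simp add: field_simps)
    also have "\<bar>\<dots>\<bar> = x k v * (\<bar>\<phi> k v - \<phi> k (\<lambda>_. 0)\<bar> / \<phi> k (\<lambda>_. 0))"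
      using xb[OF v, of k] \<phi>c[OF zero_fields, of k] c0 by (simp add: abs_mult)
    also have "\<dots> \<le> E * ((q * \<theta> ^ k) / c0)"
    proof (intro mult_mono frac_le)
      have qk: "0 \<le> q * \<theta> ^ k" using q \<theta> by simp
      then show "\<bar>\<phi> k v - \<phi> k (\<lambda>_. 0)\<bar> \<le> q * \<theta> ^ k"
        using lip_osc[OF \<phi>lip qk v zero_fields] lip_osc[OF \<phi>lip qk zero_fields v] by (simp add: abs_le_iff)
      show "0 \<le> \<bar>\<phi> k v - \<phi> k (\<lambda>_. 0)\<bar> / \<phi> k (\<lambda>_. 0)" using \<phi>c[OF zero_fields, of k] c0 by simp
    qed (use xb[OF v] E c0 q \<theta> \<phi>c[OF zero_fields] in auto)
    finally show ?thesis by simp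
  qed
  define q' where "q' = E * q / c0 / (1 - \<theta>)"
  have "\<forall>v\<in>fields. \<exists>m. \<forall>k. \<bar>x k v - m\<bar> \<le> q' * \<theta> ^ k"
  proof
    fix v assume "v \<in> fields"
    then have "\<exists>m. \<forall>k. \<bar>x k v - m\<bar> \<le> E * q / c0 * \<theta> ^ k / (1 - \<theta>)" by (intro geometric_limit[OF \<theta>] xstep)
    then show "\<exists>m. \<forall>k. \<bar>x k v - m\<bar> \<le> q' * \<theta> ^ k" by (simp add: q'_def)
  qed
  then obtain g where g: "\<And>k v. v \<in> fields \<Longrightarrow> \<bar>x k v - g v\<bar> \<le> q' * \<theta> ^ k"
    by metis
  have glim: "(\<lambda>k. x k v) \<longlonglongrightarrow> g v" if "v \<in> fields" for v
  proof (rule LIM_zero_cancel, rule Lim_null_comparison[OF _ \<theta>0])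
    show "\<forall>\<^sub>F k in sequentially. norm (x k v - g v) \<le> q' * \<theta> ^ k" using g[OF that] by simp
  qed
  have xlog: "loglip a (x k)" for k
    using G[of k] Gpos[OF zero_fields, of k] unfolding loglip_def x_def by (auto simp: field_simps)
  have gpos: "g v > 0" if "v \<in> fields" for v
    using LIMSEQ_le_const[OF glim[OF that], of "1 / E"] xb(3)[OF that] E by (auto intro: less_le_trans[of _ "1 / E"])
  have glog: "loglip a g"
    unfolding loglip_def
  proof (intro conjI ballI allI impI gpos)
    fix u v e assume *: "u \<in> fields" "v \<in> fields" "0 \<le> (e::real)" "near e u v"
    show "g u \<le> exp (a * e) * g v"
      by (rule LIMSEQ_le[OF glim[OF *(1)] tendsto_mult_left[OF glim[OF *(2)]]]) (use loglipD[OF xlog *] in auto)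
  qed
  have "transfer l g v = \<Lambda> * g v" if v: "v \<in> fields" for v
  proof -
    have "\<phi> k (\<lambda>_. 0) * x (Suc k) v = transfer l (x k) v" for k
    proof -
      have "transfer l (\<lambda>u. 1 / G k (\<lambda>_. 0) * G k u) v = 1 / G k (\<lambda>_. 0) * transfer l (G k) v"
        using transfer_cmult[OF v l, of "G k"] loglip_bdd[OF G] by blast
      then show ?thesis using Gpos[OF zero_fields, of "Suc k"] by (simp add: x_def[abs_def] \<phi>_def GS)
    qed
    moreover have "(\<lambda>k. transfer l (x k) v) \<longlonglongrightarrow> transfer l g v"
    proof (rule LIM_zero_cancel, rule Lim_null_comparison[OF _ \<theta>0])
      have "norm (transfer l (x k) v - transfer l g v) \<le> exp R * q' * \<theta> ^ k" for k
      proof -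
        have "transfer l (\<lambda>u. x k u - g u) v = transfer l (x k) v - transfer l g v"
          using loglip_bdd[OF xlog] loglip_bdd[OF glog] by (rule transfer_diff[OF v l])
        then show ?thesis using transfer_const_le[OF v l, of "\<lambda>u. x k u - g u" "q' * \<theta> ^ k"] g by (simp add: mult_ac)
      qed
      then show "\<forall>\<^sub>F k in sequentially. norm (transfer l (x k) v - transfer l g v) \<le> exp R * q' * \<theta> ^ k" by simp
    qed
    moreover have "(\<lambda>k. \<phi> k (\<lambda>_. 0) * x (Suc k) v) \<longlonglongrightarrow> \<Lambda> * g v"
      using \<phi>lim glim[OF v] by (intro tendsto_mult) (auto intro: LIMSEQ_Suc)
    ultimately show ?thesis using LIMSEQ_unique by simp
  qed
  then show ?thesis using \<Lambda>pos glog by blast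
qed

text \<open>With \<open>M\<close> the supremum of \<open>f / g\<close>, positivity of the operator
  gives \<open>s * f \<le> M * s' * g\<close>, hence \<open>M \<le> M * s' / s\<close>. The bounds
  on \<open>f\<close> and \<open>g\<close> make \<open>M\<close> finite.\<close>

lemma collatz_wielandt:
  assumes l: "l \<ge> 0" and s: "s > 0"
    and f: "\<And>v. v \<in> fields \<Longrightarrow> s * f v \<le> transfer l f v" "\<And>v. v \<in> fields \<Longrightarrow> 0 < f v" "\<And>v. v \<in> fields \<Longrightarrow> f v \<le> B"
    and g: "\<And>v. v \<in> fields \<Longrightarrow> transfer l g v \<le> s' * g v" "\<And>v. v \<in> fields \<Longrightarrow> c \<le> g v" "\<And>v. v \<in> fields \<Longrightarrow> g v \<le> B'"
    and c: "c > 0"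
  shows "s \<le> s'"
proof -
  define M where "M = Sup ((\<lambda>v. f v / g v) ` fields)"
  have gp: "g v > 0" if "v \<in> fields" for v using g(2)[OF that] c by linarith
  have "f v / g v \<le> B / c" if "v \<in> fields" for v
    using f(2,3)[OF that] g(2)[OF that] c by (intro frac_le) auto
  then have bd: "bdd_above ((\<lambda>v. f v / g v) ` fields)" by (auto intro!: bdd_aboveI2)
  have M1: "f v / g v \<le> M" if "v \<in> fields" for v unfolding M_def using that bd by (intro cSup_upper) auto
  have Mpos: "M > 0" using M1[OF zero_fields] f(2)[OF zero_fields] gp[OF zero_fields] by (auto intro: less_le_trans[rotated])
  have fb: "\<bar>f v\<bar> \<le> B" if "v \<in> fields" for v using f(2,3)[OF that] by simp
  have gb: "\<bar>g v\<bar> \<le> B'" if "v \<in> fields" for v using gp[OF that] g(3)[OF that] by simp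
  have "f v / g v \<le> M * s' / s" if v: "v \<in> fields" for v
  proof -
    have "s * f v \<le> transfer l f v" using f(1)[OF v] .
    also have "\<dots> \<le> transfer l (\<lambda>u. M * g u) v"
    proof (rule transfer_mono[OF v l fb])
      fix u assume u: "u \<in> fields"
      show "\<bar>M * g u\<bar> \<le> M * B'" using gb[OF u] Mpos by (simp add: abs_mult)
      show "f u \<le> M * g u" using M1[OF u] gp[OF u] by (simp add: field_simps)
    qed auto
    also have "\<dots> = M * transfer l g v" by (rule transfer_cmult[OF v l gb])
    also have "\<dots> \<le> M * (s' * g v)" using g(1)[OF v] Mpos by (intro mult_left_mono) auto
    finally show ?thesis using s gp[OF v] by (simp add: field_simps)
  qed
  then have "M \<le> M * s' / s" unfolding M_def using zero_fields by (intro cSup_least) blast+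
  then show ?thesis using Mpos s by (simp add: field_simps)
qed

section \<open>The eigenvalue as a function of \<open>l\<close>\<close>

definition Lam :: "real \<Rightarrow> real" where
  "Lam l = (SOME \<Lambda>. \<exists>g. \<Lambda> > 0 \<and> loglip a g \<and> (\<forall>v\<in>fields. transfer l g v = \<Lambda> * g v))"
text \<open>Chosen after \<open>Lam\<close>, so that the two form a matching pair. By
  \<open>collatz_wielandt\<close>, applied to two eigenpairs in both orders, the eigenvalue leaves
  no real choice.\<close>

definition eig :: "real \<Rightarrow> (nat \<Rightarrow> real) \<Rightarrow> real" where
  "eig l = (SOME g. loglip a g \<and> (\<forall>v\<in>fields. transfer l g v = Lam l * g v))"

lemma eig:
  assumes "l \<ge> 0"
  shows "Lam l > 0" "loglip a (eig l)" "\<And>v. v \<in> fields \<Longrightarrow> transfer l (eig l) v = Lam l * eig l v"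
proof -
  have 1: "\<exists>g. Lam l > 0 \<and> loglip a g \<and> (\<forall>v\<in>fields. transfer l g v = Lam l * g v)"
    unfolding Lam_def using eigen_ex[OF assms] by (rule someI_ex)
  then show "Lam l > 0" by blast
  have "loglip a (eig l) \<and> (\<forall>v\<in>fields. transfer l (eig l) v = Lam l * eig l v)"
    unfolding eig_def by (rule someI_ex[where P = "\<lambda>g. loglip a g \<and> (\<forall>v\<in>fields. transfer l g v = Lam l * g v)"]) (use 1 in blast)
  then show "loglip a (eig l)" "\<And>v. v \<in> fields \<Longrightarrow> transfer l (eig l) v = Lam l * eig l v" by blast+
qed

lemma loglip_lower: assumes "loglip b f" "v \<in> fields" shows "exp (- (b * (2 * R))) * f (\<lambda>_. 0) \<le> f v"
  using loglip_all[OF assms(1) zero_fields assms(2)] by (simp add: exp_minus field_simps)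

text \<open>Every jump has length at least 1, so raising \<open>l\<close> to \<open>l'\<close>
  shrinks each weight by at least \<open>exp (- (l' - l))\<close>; hence \<open>eig l\<close> is a
  supersolution at \<open>l'\<close>.\<close>

lemma Lam_decay:
  assumes "0 \<le> l" "l \<le> l'"
  shows "Lam l' \<le> exp (- (l' - l)) * Lam l"
proof (rule collatz_wielandt[of l' _ "eig l'" "exp (a * (2 * R)) * eig l' (\<lambda>_. 0)" "eig l" _ "exp (- (a * (2 * R))) * eig l (\<lambda>_. 0)" "exp (a * (2 * R)) * eig l (\<lambda>_. 0)"])
  have l': "0 \<le> l'" using assms by simp
  show "0 \<le> l'" "Lam l' > 0" using l' eig by auto
  note e = eig[OF l'] and e' = eig[OF assms(1)]
  fix v assume v: "v \<in> fields"
  show "Lam l' * eig l' v \<le> transfer l' (eig l') v" "0 < eig l' v" "eig l' v \<le> exp (a * (2 * R)) * eig l' (\<lambda>_. 0)"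
    using e(3)[OF v] loglip_pos[OF e(2) v] loglip_bdd[OF e(2) v] by auto
  show "exp (- (a * (2 * R))) * eig l (\<lambda>_. 0) \<le> eig l v" "eig l v \<le> exp (a * (2 * R)) * eig l (\<lambda>_. 0)"
    using loglip_lower[OF e'(2) v] loglip_bdd[OF e'(2) v] by auto
  have "transfer l' (eig l) v \<le> (\<Sum>n. exp (- (l' - l)) * (wt l v n * eig l (next_field n v)))"
    unfolding transfer_def
  proof (intro suminf_le summable_mult transfer_summable_loglip[OF _ e'(2) v] assms l')
    fix n
    have "(l' - l) * 1 \<le> (l' - l) * real (Suc n)" using assms by (intro mult_left_mono) auto
    then have "v (Suc n) - l' * real (Suc n) \<le> - (l' - l) + (v (Suc n) - l * real (Suc n))" by (simp add: algebra_simps)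
    then have "exp (v (Suc n) - l' * real (Suc n)) \<le> exp (- (l' - l)) * exp (v (Suc n) - l * real (Suc n))"
      by (simp only: exp_add[symmetric] exp_le_cancel_iff)
    then have "wt l' v n \<le> exp (- (l' - l)) * wt l v n"
      using K_nonneg[of n] mult_left_mono by (fastforce simp: wt_def mult.left_commute)
    then show "wt l' v n * eig l (next_field n v) \<le> exp (- (l' - l)) * (wt l v n * eig l (next_field n v))"
      using mult_right_mono[of _ _ "eig l (next_field n v)"] loglip_pos[OF e'(2) next_field_fields[OF v, of n]]
      by (fastforce simp: mult.assoc)
  qed
  also have "\<dots> = exp (- (l' - l)) * transfer l (eig l) v"
    unfolding transfer_def by (intro suminf_mult transfer_summable_loglip[OF _ e'(2) v] assms)
  finally show "transfer l' (eig l) v \<le> exp (- (l' - l)) * Lam l * eig l v" using e'(3)[OF v] by simp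
next
  show "0 < exp (- (a * (2 * R))) * eig l (\<lambda>_. 0)" using loglip_pos[OF eig(2)[OF assms(1)]] by simp
qed

end

section \<open>Growth rate of the partition function\<close>

lemma tendsto_exp_rate:
  fixes z :: "nat \<Rightarrow> real"
  assumes pos: "\<And>n. n \<ge> 1 \<Longrightarrow> z n > 0"
    and up: "\<And>l. l > F \<Longrightarrow> \<exists>c>0. \<forall>n\<ge>1. z n \<le> c * exp (l * real n)"
    and lo: "\<And>l. l < F \<Longrightarrow> \<exists>c>0. \<forall>n\<ge>1. c * exp (l * real n) \<le> z n"
  shows "(\<lambda>n. 1 / real n * ln (z n)) \<longlonglongrightarrow> F"
proof (rule order_tendstoI)
  have c0: "(\<lambda>n. ln c / real n + l) \<longlonglongrightarrow> l" for c l :: real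
  proof -
    have "(\<lambda>n. ln c / real n + l) \<longlonglongrightarrow> 0 + l"
      by (intro tendsto_add lim_const_over_n tendsto_const)
    then show ?thesis by simp
  qed
  have e: "1 / real n * ln (c * exp (l * real n)) = ln c / real n + l" if "n \<ge> 1" "c > 0" for c l n
    using that by (simp add: ln_mult field_simps)
  fix l' :: real
  { assume l': "l' < F"
    then obtain l where l: "l' < l" "l < F" using dense by blast
    obtain c where c: "c > 0" "\<And>n. n \<ge> 1 \<Longrightarrow> c * exp (l * real n) \<le> z n" using lo[OF l(2)] by blast
    have "eventually (\<lambda>n. l' < ln c / real n + l) sequentially" using c0 l(1) by (rule order_tendstoD)
    then show "eventually (\<lambda>n. l' < 1 / real n * ln (z n)) sequentially"
      using eventually_ge_at_top[of 1]
    proof eventually_elim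
      case (elim n)
      have "1 / real n * ln (c * exp (l * real n)) \<le> 1 / real n * ln (z n)"
        using c elim pos[of n] by (intro mult_left_mono) auto
      then show ?case using e[of n c l] c elim by linarith
    qed }
  { assume l': "F < l'"
    then obtain l where l: "F < l" "l < l'" using dense by blast
    obtain c where c: "c > 0" "\<And>n. n \<ge> 1 \<Longrightarrow> z n \<le> c * exp (l * real n)" using up[OF l(1)] by blast
    have "eventually (\<lambda>n. ln c / real n + l < l') sequentially" using c0 l(2) by (rule order_tendstoD)
    then show "eventually (\<lambda>n. 1 / real n * ln (z n) < l') sequentially"
      using eventually_ge_at_top[of 1]
    proof eventually_elim
      case (elim n)
      have "1 / real n * ln (z n) \<le> 1 / real n * ln (c * exp (l * real n))"
        using c elim pos[of n] by (intro mult_left_mono) auto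
      then show ?case using e[of n c l] c elim by linarith
    qed }
qed

context pinning
begin

text \<open>Partition function for the distance \<open>n\<close> still to be covered from a contact
  point whose past exerts the field \<open>v\<close>. The field is an argument because each jump
  changes it.\<close>

function Z :: "real \<Rightarrow> nat \<Rightarrow> (nat \<Rightarrow> real) \<Rightarrow> real" where
  "Z h n v = (if n = 0 then 1 else
     (\<Sum>i<n. exp h * K (Suc i) * exp (v (Suc i)) * Z h (n - Suc i) (next_field i v)))"
  by auto
termination by (relation "Wellfounded.measure (\<lambda>(h, n, v). n)") auto

declare Z.simps [simp del]

lemma Z_0 [simp]: "Z h 0 v = 1" by (simp add: Z.simps)
lemma Z_Suc: "Z h (Suc n) v = (\<Sum>i\<le>n. exp h * K (Suc i) * exp (v (Suc i)) * Z h (n - i) (next_field i v))"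
  by (subst Z.simps) (simp add: lessThan_Suc_atMost)

lemma Z_nonneg: "Z h n v \<ge> 0"
proof (induction n arbitrary: v rule: less_induct)
  case (less n)
  show ?case
    by (cases n) (use less K_nonneg in \<open>auto simp: Z_Suc intro!: sum_nonneg mult_nonneg_nonneg\<close>)
qed

lemma Z_ge: "exp h * K (Suc n) * exp (v (Suc n)) \<le> Z h (Suc n) v"
proof -
  have "(\<Sum>i\<in>{n}. exp h * K (Suc i) * exp (v (Suc i)) * Z h (n - i) (next_field i v)) \<le> Z h (Suc n) v"
    unfolding Z_Suc by (rule sum_mono2) (auto intro!: mult_nonneg_nonneg K_nonneg Z_nonneg)
  then show ?thesis by simp
qed

text \<open>Induction on the distance: the jumps that fit into it form a partial sum of the transfer
  series of \<open>g\<close>, whose terms are positive, and \<open>g\<close> is a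
  supersolution.\<close>

lemma Z_upper:
  assumes l: "l \<ge> 0" and g: "loglip a g" "\<And>v. v \<in> fields \<Longrightarrow> exp h * transfer l g v \<le> g v"
  shows "\<exists>c>0. \<forall>n. \<forall>v\<in>fields. Z h n v \<le> c * exp (l * real n) * g v"
proof -
  define c where "c = 1 / (exp (- (a * (2 * R))) * g (\<lambda>_. 0))"
  have c: "c > 0" using loglip_pos[OF g(1) zero_fields] by (simp add: c_def)
  have cg: "1 \<le> c * g v" if "v \<in> fields" for v
    using loglip_lower[OF g(1) that] loglip_pos[OF g(1) zero_fields] by (simp add: c_def field_simps)
  have "Z h n v \<le> c * exp (l * real n) * g v" if "v \<in> fields" for n v
    using that
  proof (induction n arbitrary: v rule: less_induct)
    case (less n)
    show ?case
    proof (cases n)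
      case 0 then show ?thesis using cg less.prems by simp
    next
      case (Suc m)
      have "Z h n v \<le> (\<Sum>i\<le>m. c * exp (l * real n) * exp h * (wt l v i * g (next_field i v)))"
        unfolding Suc Z_Suc
      proof (rule sum_mono)
        fix i assume i: "i \<in> {..m}"
        have "Z h (m - i) (next_field i v) \<le> c * exp (l * real (m - i)) * g (next_field i v)"
          using less.IH[of "m - i"] Suc less.prems by simp
        then have "exp h * K (Suc i) * exp (v (Suc i)) * Z h (m - i) (next_field i v)
          \<le> exp h * K (Suc i) * exp (v (Suc i)) * (c * exp (l * real (m - i)) * g (next_field i v))"
          using K_nonneg by (intro mult_left_mono) auto
        also have "exp (l * real (m - i)) = exp (l * real (Suc m)) * exp (- (l * real (Suc i)))"
          using i by (simp flip: exp_add add: of_nat_diff algebra_simps)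
        finally show "exp h * K (Suc i) * exp (v (Suc i)) * Z h (m - i) (next_field i v)
          \<le> c * exp (l * real (Suc m)) * exp h * (wt l v i * g (next_field i v))"
          by (simp add: wt_def exp_diff exp_minus divide_inverse mult_ac)
      qed
      also have "\<dots> = c * exp (l * real n) * (exp h * (\<Sum>i\<le>m. wt l v i * g (next_field i v)))"
        by (simp add: sum_distrib_left mult_ac)
      also have "\<dots> \<le> c * exp (l * real n) * (exp h * transfer l g v)"
        unfolding transfer_def
        using transfer_summable_loglip[OF l g(1) less.prems] loglip_pos[OF g(1) next_field_fields[OF less.prems]] wt_nonneg c
        by (intro mult_left_mono sum_le_suminf mult_nonneg_nonneg) (auto intro: less_imp_le)
      also have "\<dots> \<le> c * exp (l * real n) * g v"
        using g(2)[OF less.prems] c by (intro mult_left_mono) auto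
      finally show ?thesis .
    qed
  qed
  then show ?thesis using c by blast
qed

text \<open>Since \<open>s > 1\<close>, the jumps can be truncated at some \<open>M\<close> while keeping \<open>g\<close> a subsolution; only
  finitely many values of \<open>n\<close> then remain as the base of the induction.\<close>

lemma Z_lower:
  assumes l: "l \<ge> 0" and g: "loglip a g" "\<And>v. v \<in> fields \<Longrightarrow> s * g v \<le> exp h * transfer l g v" and s: "s > 1"
  shows "\<exists>c>0. \<forall>n. \<forall>v\<in>fields. c * exp (l * real n) * g v \<le> Z h n v"
proof -
  define B where "B = exp (a * (2 * R)) * g (\<lambda>_. 0)"
  define b where "b = exp (- (a * (2 * R))) * g (\<lambda>_. 0)"
  have B: "B > 0" "b > 0" using loglip_pos[OF g(1) zero_fields] by (auto simp: B_def b_def)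
  have gB: "g v \<le> B" "b \<le> g v" "g v > 0" if "v \<in> fields" for v
    using loglip_bdd[OF g(1) that] loglip_lower[OF g(1) that] loglip_pos[OF g(1) that] by (auto simp: B_def b_def)
  \<comment> \<open>With this choice the discarded tail of the transfer series costs at most
    \<open>(s - 1) * b\<close>, which the surplus \<open>(s - 1) * g v\<close> pays for.\<close>
  define \<epsilon> where "\<epsilon> = (s - 1) * b / (exp h * exp R * B)"
  have \<epsilon>: "\<epsilon> > 0" using s B by (simp add: \<epsilon>_def)
  obtain M where M: "\<And>n. n \<ge> M \<Longrightarrow> norm (\<Sum>i. K (Suc (i + n))) < \<epsilon>"
    using suminf_exist_split[OF \<epsilon> summable_K] by blast
  have trunc: "g v \<le> exp h * (\<Sum>i<M. wt l v i * g (next_field i v))" if v: "v \<in> fields" for v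
  proof -
    have sm: "summable (\<lambda>i. wt l v i * g (next_field i v))" using transfer_summable_loglip[OF l g(1) v] .
    have "(\<Sum>i. wt l v (i + M) * g (next_field (i + M) v)) \<le> (\<Sum>i. K (Suc (i + M)) * (exp R * B))"
    proof (rule suminf_le)
      show "wt l v (i + M) * g (next_field (i + M) v) \<le> K (Suc (i + M)) * (exp R * B)" for i
        using mult_mono[OF wt_le[OF v l, of "i + M"] gB(1)[OF next_field_fields[OF v, of "i + M"]]]
          K_nonneg[of "i + M"] gB(3)[OF next_field_fields[OF v, of "i + M"]] by (simp add: mult_ac)
    qed (use sm summable_K in \<open>auto simp: summable_iff_shift[of "\<lambda>i. wt l v i * g (next_field i v)" M] summable_iff_shift[of "\<lambda>i. K (Suc i)" M] intro!: summable_mult2\<close>)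
    also have "\<dots> = (\<Sum>i. K (Suc (i + M))) * (exp R * B)"
      using summable_K by (intro suminf_mult2[symmetric]) (simp add: summable_iff_shift[of "\<lambda>i. K (Suc i)" M])
    also have "\<dots> \<le> \<epsilon> * (exp R * B)" using M[of M] B by (intro mult_right_mono) auto
    finally have "exp h * (\<Sum>i. wt l v (i + M) * g (next_field (i + M) v)) \<le> exp h * (\<epsilon> * (exp R * B))" by simp
    also have "\<dots> = (s - 1) * b" using B by (simp add: \<epsilon>_def)
    also have "\<dots> \<le> (s - 1) * g v" using gB[OF v] s by (intro mult_left_mono) auto
    finally have "exp h * (\<Sum>i. wt l v (i + M) * g (next_field (i + M) v)) \<le> (s - 1) * g v" .
    moreover have "transfer l g v = (\<Sum>i. wt l v (i + M) * g (next_field (i + M) v)) + (\<Sum>i<M. wt l v i * g (next_field i v))"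
      unfolding transfer_def using suminf_split_initial_segment[OF sm, of M] by simp
    ultimately show ?thesis using g(2)[OF v] by (simp add: algebra_simps)
  qed
  \<comment> \<open>Numerator: a lower bound for \<open>Z\<close> at distances up to
    \<open>M\<close>, by 1 at distance 0 and by one single jump otherwise. Denominator: an upper
    bound for \<open>exp (l * n) * g v\<close> there.\<close>
  define c where "c = Min (insert 1 ((\<lambda>n. exp h * K (Suc n) * exp (- R)) ` {..<M})) / (exp (l * real M) * B)"
  have c: "c > 0" using K_pos B by (auto simp: c_def)
  have base: "c * exp (l * real n) * g v \<le> Z h n v" if "v \<in> fields" "n \<le> M" for n v
  proof -
    have "Min (insert 1 ((\<lambda>n. exp h * K (Suc n) * exp (- R)) ` {..<M})) \<le> Z h n v"
    proof (cases n)
      case 0 then show ?thesis by simp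
    next
      case (Suc k)
      have "exp h * K (Suc k) * exp (- R) \<le> exp h * K (Suc k) * exp (v (Suc k))"
        using fields_le_R[OF that(1), of "Suc k"] K_nonneg by (intro mult_left_mono) auto
      then have "exp h * K (Suc k) * exp (- R) \<le> Z h n v" using Z_ge[of h k v] unfolding Suc by (rule order_trans)
      moreover have "Min (insert 1 ((\<lambda>n. exp h * K (Suc n) * exp (- R)) ` {..<M})) \<le> exp h * K (Suc k) * exp (- R)"
        using Suc that by (intro Min_le) auto
      ultimately show ?thesis by simp
    qed
    moreover have "c * exp (l * real n) * g v \<le> c * exp (l * real M) * B"
      using gB[OF that(1)] that c l by (intro mult_mono) (auto intro!: mult_left_mono)
    moreover have "c * exp (l * real M) * B = Min (insert 1 ((\<lambda>n. exp h * K (Suc n) * exp (- R)) ` {..<M}))"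
      using B by (simp add: c_def)
    ultimately show ?thesis by linarith
  qed
  have "c * exp (l * real n) * g v \<le> Z h n v" if "v \<in> fields" for n v
    using that
  proof (induction n arbitrary: v rule: less_induct)
    case (less n)
    show ?case
    proof (cases "n \<le> M")
      case True then show ?thesis using base less.prems by blast
    next
      case False
      \<comment> \<open>\<open>M \<le> m\<close> ensures that all truncated jumps fit into the
        distance \<open>n\<close>.\<close>
      then obtain m where m: "n = Suc m" "M \<le> m" by (cases n) auto
      have "c * exp (l * real n) * g v \<le> c * exp (l * real n) * (exp h * (\<Sum>i<M. wt l v i * g (next_field i v)))"
        using trunc[OF less.prems] c by (intro mult_left_mono) auto
      also have "\<dots> = (\<Sum>i<M. exp h * K (Suc i) * exp (v (Suc i)) * (c * exp (l * real (m - i)) * g (next_field i v)))"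
        unfolding sum_distrib_left
      proof (rule sum.cong[OF refl])
        fix i assume i: "i \<in> {..<M}"
        have "exp (l * real (m - i)) = exp (l * real n) * exp (- (l * real (Suc i)))"
          using i m by (simp flip: exp_add add: of_nat_diff algebra_simps)
        then show "c * exp (l * real n) * (exp h * (wt l v i * g (next_field i v)))
          = exp h * K (Suc i) * exp (v (Suc i)) * (c * exp (l * real (m - i)) * g (next_field i v))"
          by (simp add: wt_def exp_diff exp_minus divide_inverse mult_ac)
      qed
      also have "\<dots> \<le> (\<Sum>i<M. exp h * K (Suc i) * exp (v (Suc i)) * Z h (m - i) (next_field i v))"
      proof (rule sum_mono)
        fix i assume "i \<in> {..<M}"
        have "c * exp (l * real (m - i)) * g (next_field i v) \<le> Z h (m - i) (next_field i v)"
          using less.IH[of "m - i" "next_field i v"] less.prems m by simp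
        then show "exp h * K (Suc i) * exp (v (Suc i)) * (c * exp (l * real (m - i)) * g (next_field i v))
          \<le> exp h * K (Suc i) * exp (v (Suc i)) * Z h (m - i) (next_field i v)"
          using K_nonneg[of i] by (intro mult_left_mono) auto
      qed
      also have "\<dots> \<le> Z h n v"
        unfolding m Z_Suc using m K_nonneg Z_nonneg by (intro sum_mono2) auto
      finally show ?thesis .
    qed
  qed
  then show ?thesis using c by blast
qed

section \<open>The gap, its generalised inverse, and the growth rate of \<open>Z\<close>\<close>

definition gap :: "real \<Rightarrow> real" where "gap l = ln (Lam 0) - ln (Lam l)"

lemma gap_diff: "0 \<le> l \<Longrightarrow> l \<le> l' \<Longrightarrow> gap l + (l' - l) \<le> gap l'"
proof -
  assume *: "0 \<le> l" "l \<le> l'"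
  have "ln (Lam l') \<le> ln (exp (- (l' - l)) * Lam l)"
    using Lam_decay[OF *] eig(1)[of l'] * by simp
  also have "\<dots> = - (l' - l) + ln (Lam l)" using eig(1)[of l] * by (subst ln_mult) auto
  finally show ?thesis by (simp add: gap_def)
qed

lemma gap_0 [simp]: "gap 0 = 0" by (simp add: gap_def)
lemma gap_mono: "0 \<le> l \<Longrightarrow> l \<le> l' \<Longrightarrow> gap l \<le> gap l'" using gap_diff[of l l'] by linarith
lemma gap_ge: "0 \<le> l \<Longrightarrow> l \<le> gap l" using gap_diff[of 0 l] by simp

text \<open>The generalised inverse of \<open>gap\<close>; it vanishes for negative arguments because \<open>gap 0 = 0\<close>.\<close>

definition rate :: "real \<Rightarrow> real" where "rate \<delta> = Inf {l. 0 \<le> l \<and> \<delta> \<le> gap l}"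

lemma rate_le: "0 \<le> l \<Longrightarrow> \<delta> \<le> gap l \<Longrightarrow> rate \<delta> \<le> l"
  unfolding rate_def by (intro cInf_lower) (auto intro: bdd_belowI)
lemma rate_nonempty: "{l. 0 \<le> l \<and> \<delta> \<le> gap l} \<noteq> {}"
  using gap_ge[of "\<bar>\<delta>\<bar>"] by (auto intro!: exI[of _ "\<bar>\<delta>\<bar>"])
lemma rate_nonneg: "rate \<delta> \<ge> 0"
  unfolding rate_def using rate_nonempty by (intro cInf_greatest) auto
lemma gap_less: "0 \<le> l \<Longrightarrow> l < rate \<delta> \<Longrightarrow> gap l < \<delta>" using rate_le[of l \<delta>] by linarith
text \<open>Monotonicity alone gives this and \<open>gap_less\<close>. The infimum in
  \<open>rate\<close> may fail to be attained, which is why \<open>rate_ratio_upper\<close> moves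
  from \<open>rate \<delta>\<close> to a slightly larger point.\<close>

lemma gap_above: assumes "rate \<delta> < l" shows "\<delta> \<le> gap l"
proof -
  obtain l' where "0 \<le> l'" "\<delta> \<le> gap l'" "l' < l"
    using assms cInf_lessD[OF rate_nonempty, of \<delta> l] unfolding rate_def by auto
  then show ?thesis using gap_mono[of l' l] by linarith
qed
lemma rate_mono: assumes "\<delta> \<le> \<delta>'" shows "rate \<delta> \<le> rate \<delta>'"
proof (rule dense_ge)
  fix l assume "rate \<delta>' < l"
  then show "rate \<delta> \<le> l" using gap_above[of \<delta>' l] rate_nonneg[of \<delta>'] assms by (intro rate_le) auto
qed
lemma rate_nonpos: "\<delta> \<le> 0 \<Longrightarrow> rate \<delta> = 0" using rate_le[of 0 \<delta>] rate_nonneg[of \<delta>] by simp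
lemma rate_le_self: "0 \<le> \<delta> \<Longrightarrow> rate \<delta> \<le> \<delta>" using rate_le gap_ge by blast

text \<open>Above the rate, \<open>exp h * Lam l \<le> 1\<close> and the eigenfunction is a
  supersolution for \<open>Z_upper\<close>; below it, with \<open>l \<ge> 0\<close>, it is a strict
  subsolution for \<open>Z_lower\<close>. Negative \<open>l\<close>, the only ones below the rate in
  the delocalised phase, are handled by \<open>sub\<close>.\<close>

lemma Z_growth:
  assumes sub: "\<And>\<epsilon>. \<epsilon> > 0 \<Longrightarrow> \<exists>c>0. \<forall>n. c * exp (- \<epsilon> * real (Suc n)) \<le> K (Suc n)"
    and v: "v \<in> fields"
  shows "(\<lambda>n. 1 / real n * ln (Z h n v)) \<longlonglongrightarrow> rate (h + ln (Lam 0))"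
proof (rule tendsto_exp_rate)
  show "Z h n v > 0" if "n \<ge> 1" for n
  proof (cases n)
    case (Suc m)
    have "0 < exp h * K (Suc m) * exp (v (Suc m))" using K_pos by simp
    then show ?thesis using Z_ge[of h m v] Suc by simp
  qed (use that in simp)
next
  fix l assume l: "rate (h + ln (Lam 0)) < l"
  then have l0: "l \<ge> 0" using rate_nonneg[of "h + ln (Lam 0)"] by linarith
  note e = eig[OF l0]
  have "h + ln (Lam l) \<le> 0" using gap_above[OF l] by (simp add: gap_def)
  then have "exp h * Lam l \<le> 1" using e(1) by (metis exp_le_one_iff exp_add exp_ln)
  then have "exp h * transfer l (eig l) u \<le> eig l u" if "u \<in> fields" for u
    using e(3)[OF that] loglip_pos[OF e(2) that] mult_right_mono[of "exp h * Lam l" 1 "eig l u"] by (simp add: mult_ac)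
  from Z_upper[OF l0 e(2) this] obtain c where "c > 0" "\<And>n. Z h n v \<le> c * exp (l * real n) * eig l v" using v by blast
  then show "\<exists>c>0. \<forall>n\<ge>1. Z h n v \<le> c * exp (l * real n)"
    using loglip_pos[OF e(2) v] by (intro exI[of _ "c * eig l v"]) (auto simp: mult_ac)
next
  fix l assume l: "l < rate (h + ln (Lam 0))"
  show "\<exists>c>0. \<forall>n\<ge>1. c * exp (l * real n) \<le> Z h n v"
  proof (cases "l \<ge> 0")
    case True
    note e = eig[OF True]
    have "h + ln (Lam l) > 0" using gap_less[OF True l] by (simp add: gap_def)
    then have "exp h * Lam l > 1" using e(1) by (metis one_less_exp_iff exp_add exp_ln)
    moreover have "exp h * Lam l * eig l u \<le> exp h * transfer l (eig l) u" if "u \<in> fields" for u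
      using e(3)[OF that] by (simp add: mult_ac)
    ultimately obtain c where "c > 0" "\<And>n. c * exp (l * real n) * eig l v \<le> Z h n v"
      using Z_lower[OF True e(2), of "exp h * Lam l" h] v by blast
    then show ?thesis
      using loglip_pos[OF e(2) v] by (intro exI[of _ "c * eig l v"]) (auto simp: mult_ac)
  next
    case False
    \<comment> \<open>One jump over the whole distance already decays more slowly than the negative
      exponential rate \<open>l\<close>.\<close>
    then obtain c where c: "c > 0" "\<And>n. c * exp (l * real (Suc n)) \<le> K (Suc n)" using sub[of "- l"] by auto
    have "exp h * c * exp (- R) * exp (l * real n) \<le> Z h n v" if n: "n \<ge> 1" for n
    proof -
      obtain m where m: "n = Suc m" using n by (cases n) auto
      have "exp h * (c * exp (l * real n)) * exp (- R) \<le> exp h * K (Suc m) * exp (v (Suc m))"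
        using c(2)[of m] c(1) m fields_le_R[OF v, of n] K_nonneg by (intro mult_mono) auto
      then have "exp h * (c * exp (l * real n)) * exp (- R) \<le> Z h n v" using Z_ge[of h m v] unfolding m by (rule order_trans)
      then show ?thesis by (simp only: mult_ac)
    qed
    then show ?thesis using c(1) by (intro exI[of _ "exp h * c * exp (- R)"]) auto
  qed
qed

end

section \<open>First-order perturbation of the eigenvalue\<close>

lemma ln_one_minus_bounds:
  fixes y :: real
  assumes "0 \<le> y" "y < 1"
  shows "y \<le> - ln (1 - y)" "- ln (1 - y) \<le> y / (1 - y)"
proof -
  show "y \<le> - ln (1 - y)" using ln_le_minus_one[of "1 - y"] assms by simp
  have "ln (1 / (1 - y)) \<le> 1 / (1 - y) - 1" using ln_le_minus_one[of "1 / (1 - y)"] assms by simp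
  also have "\<dots> = y / (1 - y)" using assms by (simp add: field_simps)
  finally show "- ln (1 - y) \<le> y / (1 - y)" using assms by (simp add: ln_div)
qed

lemma tannery_at_right:
  fixes f :: "real \<Rightarrow> nat \<Rightarrow> real"
  assumes b: "summable b" "\<And>l n. l > 0 \<Longrightarrow> \<bar>f l n\<bar> \<le> b n"
    and lim: "\<And>n. ((\<lambda>l. f l n) \<longlongrightarrow> 0) (at_right 0)"
  shows "((\<lambda>l. \<Sum>n. f l n) \<longlongrightarrow> 0) (at_right 0)"
proof -
  have "eventually (\<lambda>(n, l). norm (f l n) \<le> b n) (at_top \<times>\<^sub>F at_right 0)"
    unfolding eventually_prod_filter
    using b(2) eventually_at_right_less[of "0::real"] by (intro exI[of _ "\<lambda>_. True"] exI[of _ "\<lambda>l. l > 0"]) auto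
  from tannerys_theorem[OF lim this b(1)] show ?thesis by simp
qed

context pinning
begin

text \<open>The Markov operator \<open>avg 0 (eig 0)\<close> has mass 1; this is the mass lost in
  the field \<open>v\<close> when \<open>l\<close> replaces 0 in the jump weights and the
  normalisation is kept.\<close>

definition defect :: "real \<Rightarrow> (nat \<Rightarrow> real) \<Rightarrow> real" where
  "defect l v = 1 - transfer l (eig 0) v / (Lam 0 * eig 0 v)"

lemma transfer_le_0:
  assumes "l \<ge> 0" "v \<in> fields" "\<And>u. u \<in> fields \<Longrightarrow> 0 \<le> f u" "\<And>u. u \<in> fields \<Longrightarrow> f u \<le> B"
  shows "transfer l f v \<le> transfer 0 f v"
proof -
  have fB: "\<bar>f u\<bar> \<le> B" if "u \<in> fields" for u using assms(3,4)[OF that] by simp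
  show ?thesis unfolding transfer_def
  proof (intro suminf_le mult_right_mono)
    show "summable (\<lambda>n. wt l v n * f (next_field n v))" "summable (\<lambda>n. wt 0 v n * f (next_field n v))"
      using transfer_summable[of v _ f B] assms fB by auto
    show "wt l v n \<le> wt 0 v n" for n using assms(1) K_nonneg by (auto simp: wt_def intro!: mult_left_mono)
  qed (use assms in auto)
qed

lemma transfer_sum:
  assumes "l \<ge> 0" "v \<in> fields" "\<And>k u. u \<in> fields \<Longrightarrow> \<bar>f k u\<bar> \<le> B"
  shows "transfer l (\<lambda>u. \<Sum>k<n. f k u) v = (\<Sum>k<n. transfer l (f k) v)"
proof -
  have "(\<Sum>k<n. transfer l (f k) v) = (\<Sum>i. \<Sum>k<n. wt l v i * f k (next_field i v))"
    unfolding transfer_def using transfer_summable[OF assms(2,1), of "f _" B] assms(3) by (intro suminf_sum[symmetric]) auto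
  then show ?thesis by (simp add: transfer_def sum_distrib_left)
qed

text \<open>Collatz--Wielandt bounds for the test function \<open>g * (1 - U l * (\<Sum>k<n. A^k H))\<close>, where \<open>g = eig 0\<close> and \<open>A\<close> is
  the Markov operator \<open>avg 0 g\<close>: the sum telescopes to replace \<open>H\<close> by \<open>A^n H\<close>, which is almost the constant \<open>m\<close>.\<close>

theorem perturbation:
  assumes H: "loglip b H" "b > 0"
    and U: "eventually (\<lambda>l. U l > 0) (at_right 0)" "(U \<longlongrightarrow> 0) (at_right 0)"
    and D: "\<And>\<epsilon>. \<epsilon> > 0 \<Longrightarrow> eventually (\<lambda>l. \<forall>v\<in>fields. \<bar>defect l v - U l * H v\<bar> \<le> \<epsilon> * U l) (at_right 0)"
  shows "\<exists>m>0. ((\<lambda>l. (1 - Lam l / Lam 0) / U l) \<longlongrightarrow> m) (at_right 0)"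
proof -
  define g where "g = eig 0"
  have g: "loglip a g" "\<And>v. v \<in> fields \<Longrightarrow> transfer 0 g v = Lam 0 * g v" "Lam 0 > 0"
    using eig[of 0] by (auto simp: g_def)
  have gpos: "g v > 0" if "v \<in> fields" for v using loglip_pos[OF g(1) that] .
  define gB where "gB = exp (a * (2 * R)) * g (\<lambda>_. 0)"
  define gb where "gb = exp (- (a * (2 * R))) * g (\<lambda>_. 0)"
  have gB: "g v \<le> gB" "gb \<le> g v" if "v \<in> fields" for v
    using loglip_bdd[OF g(1) that] loglip_lower[OF g(1) that] by (auto simp: gB_def gb_def)
  have gb: "gb > 0" "gB > 0" using gpos[OF zero_fields] by (auto simp: gb_def gB_def)
  obtain \<theta> where \<theta>: "0 < \<theta>" "\<theta> < 1"
    and contr: "\<And>g q f. loglip a g \<Longrightarrow> q \<ge> 0 \<Longrightarrow> lip q f \<Longrightarrow> lip (q * \<theta>) (avg 0 g f)"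
    using avg_contraction[of 0] by auto
  obtain q where q: "q > 0" "lip q H" using loglip_lip[OF H] by blast
  define Hk where "Hk k = (avg 0 g ^^ k) H" for k
  define h1 where "h1 = exp (- (b * (2 * R))) * H (\<lambda>_. 0)"
  define h2 where "h2 = exp (b * (2 * R)) * H (\<lambda>_. 0)"
  have h: "h1 > 0" "h2 > 0" using loglip_pos[OF H(1) zero_fields] by (auto simp: h1_def h2_def)
  have HkS: "Hk (Suc k) = avg 0 g (Hk k)" for k by (simp add: Hk_def)
  have Hb: "h1 \<le> Hk k v \<and> Hk k v \<le> h2" if "v \<in> fields" for k v
    using that
  proof (induction k arbitrary: v)
    case 0
    then show ?case using loglip_lower[OF H(1) 0] loglip_bdd[OF H(1) 0] by (simp add: Hk_def h1_def h2_def)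
  next
    case (Suc k)
    then show ?case using avg_between[OF order_refl g(1) Suc.prems, of h1 "Hk k" h2] by (simp add: HkS)
  qed
  have Hlip: "lip (q * \<theta> ^ k) (Hk k)" for k
  proof (induction k)
    case 0 then show ?case using q by (simp add: Hk_def)
  next
    case (Suc k) then show ?case using contr[OF g(1) _ Suc] q \<theta> by (simp add: HkS mult_ac)
  qed
  have "\<exists>m. \<forall>k. \<forall>v\<in>fields. \<bar>Hk k v - m\<bar> \<le> 2 * q / (1 - \<theta>) * \<theta> ^ k"
    using q by (intro iterate_limit[OF \<theta> _ Hlip]) (use avg_dev[OF order_refl g(1) _ Hlip] q \<theta> in \<open>auto simp: HkS\<close>)
  \<comment> \<open>The iterates of \<open>H\<close> under the Markov operator equilibrate:
    \<open>m\<close> is the equilibrium mean of \<open>H\<close>.\<close>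
  then obtain m where m: "\<And>k v. v \<in> fields \<Longrightarrow> \<bar>Hk k v - m\<bar> \<le> 2 * q / (1 - \<theta>) * \<theta> ^ k" by blast
  have \<theta>0: "(\<lambda>k. 2 * q / (1 - \<theta>) * \<theta> ^ k) \<longlonglongrightarrow> 0"
    using \<theta> by (intro tendsto_mult_right_zero LIMSEQ_realpow_zero) auto
  have "(\<lambda>k. Hk k (\<lambda>_. 0)) \<longlonglongrightarrow> m"
  proof (rule LIM_zero_cancel, rule Lim_null_comparison[OF _ \<theta>0])
    show "\<forall>\<^sub>F k in sequentially. norm (Hk k (\<lambda>_. 0) - m) \<le> 2 * q / (1 - \<theta>) * \<theta> ^ k" using m[OF zero_fields] by simp
  qed
  then have mpos: "m > 0" using LIMSEQ_le_const[of _ m h1] Hb[OF zero_fields] h by force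
  have "((\<lambda>l. (1 - Lam l / Lam 0) / U l) \<longlongrightarrow> m) (at_right 0)"
  proof (rule tendstoI)
    fix e :: real assume e: "e > 0"
    \<comment> \<open>The bound \<open>m / 2\<close> keeps \<open>m - \<mu>\<close> positive; each
      of the error sources below gets a third of \<open>\<mu>\<close>.\<close>
    define \<mu> where "\<mu> = min (e / 2) (m / 2)"
    have \<mu>: "\<mu> > 0" "\<mu> < e" "\<mu> < m" "\<mu> / 3 > 0" using e mpos by (auto simp: \<mu>_def min_def)
    have "eventually (\<lambda>k. 2 * q / (1 - \<theta>) * \<theta> ^ k < \<mu> / 3) sequentially" using \<theta>0 by (rule order_tendstoD) (use \<mu> in simp)
    then obtain n where n: "2 * q / (1 - \<theta>) * \<theta> ^ n < \<mu> / 3" by (auto simp: eventually_sequentially)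
    have Hn: "\<bar>Hk n v - m\<bar> \<le> \<mu> / 3" if "v \<in> fields" for v using m[OF that, of n] n by linarith
    define B where "B = real n * h2"
    define X where "X v = (\<Sum>k<n. Hk k v)" for v
    have B: "B \<ge> 0" using h by (simp add: B_def)
    have X: "0 \<le> X v" "X v \<le> B" if "v \<in> fields" for v
    proof -
      show "0 \<le> X v" unfolding X_def using Hb[OF that] h by (intro sum_nonneg) (meson less_imp_le order_trans)
      show "X v \<le> B" unfolding X_def B_def using sum_bounded_above[of "{..<n}" "\<lambda>k. Hk k v" h2] Hb[OF that] by simp
    qed
    have gX: "\<bar>g u * X u\<bar> \<le> gB * B" "\<bar>g u\<bar> \<le> gB" if "u \<in> fields" for u
      using X[OF that] gB[OF that] gpos[OF that] by (auto simp: abs_mult intro!: mult_mono)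
    have AX: "transfer 0 (\<lambda>u. g u * X u) v = Lam 0 * g v * (X v + Hk n v - H v)" if v: "v \<in> fields" for v
    proof -
      have "transfer 0 (\<lambda>u. g u * X u) v = transfer 0 (\<lambda>u. \<Sum>k<n. g u * Hk k u) v"
        by (simp add: X_def sum_distrib_left)
      also have "\<dots> = (\<Sum>k<n. transfer 0 (\<lambda>u. g u * Hk k u) v)"
      proof (rule transfer_sum[OF order_refl v])
        fix k u assume u: "u \<in> fields"
        show "\<bar>g u * Hk k u\<bar> \<le> gB * h2" using Hb[OF u, of k] h gB[OF u] gpos[OF u] by (auto simp: abs_mult intro!: mult_mono)
      qed
      also have "\<dots> = (\<Sum>k<n. Lam 0 * g v * Hk (Suc k) v)"
        using g(2)[OF v] g(3) gpos[OF v] by (simp add: HkS avg_def)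
      also have "\<dots> = Lam 0 * g v * (\<Sum>k<n. Hk (Suc k) v)" by (simp add: sum_distrib_left)
      also have "(\<Sum>k<n. Hk (Suc k) v) = X v + Hk n v - H v"
        using sum_lessThan_telescope[of "\<lambda>k. Hk k v" n] by (simp add: X_def sum_subtractf Hk_def[of 0] algebra_simps)
      finally show ?thesis .
    qed
    have Usmall: "eventually (\<lambda>l. U l * c < d) (at_right 0)" if "d > 0" for d c :: real
      using tendsto_mult_right[OF U(2), of c] order_tendstoD(2)[of "\<lambda>l. U l * c" 0 _ d] that by simp
    \<comment> \<open>The four smallness conditions on \<open>U l\<close> serve, in order: to bound
      the correction \<open>\<Delta>\<close> by \<open>\<mu> / 3\<close>, to absorb the product of
      the two first-order terms, to keep the test function above 1/2, and to keep the lower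
      candidate for the eigenvalue positive.\<close>
    have "eventually (\<lambda>l. dist ((1 - Lam l / Lam 0) / U l) m \<le> \<mu>) (at_right 0)"
      using eventually_at_right_less[of "0::real"] U(1) D[OF \<mu>(4)]
        Usmall[OF \<mu>(4), of "B * (h2 + \<mu> / 3)"] Usmall[OF \<mu>(4), of "(m + \<mu>) * B"]
        Usmall[OF half_gt_zero[OF zero_less_one], of B] Usmall[OF zero_less_one, of "m + \<mu>"]
    proof eventually_elim
      case (elim l)
      then have l: "l > 0" "U l > 0" and D': "\<And>v. v \<in> fields \<Longrightarrow> \<bar>defect l v - U l * H v\<bar> \<le> \<mu> / 3 * U l"
        and s: "U l * (B * (h2 + \<mu> / 3)) < \<mu> / 3" "U l * ((m + \<mu>) * B) < \<mu> / 3" "U l * B < 1 / 2" "U l * (m + \<mu>) < 1"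
        using \<mu> by auto
      define \<psi> where "\<psi> v = 1 - U l * X v" for v
      have UX: "0 \<le> U l * X v" "U l * X v \<le> U l * B" if "v \<in> fields" for v
        using X[OF that] l by (auto intro!: mult_left_mono)
      have \<psi>: "\<psi> v \<le> 1" "1 - U l * B \<le> \<psi> v" "1 / 2 \<le> \<psi> v" if "v \<in> fields" for v
        using UX[OF that] s(3) by (auto simp: \<psi>_def)
      define E where "E v = transfer l (\<lambda>u. g u * \<psi> u) v / (Lam 0 * g v)" for v
      have E: "\<psi> v - U l * Hk n v - \<mu> / 3 * U l \<le> E v" "E v \<le> \<psi> v - U l * Hk n v + 2 * \<mu> / 3 * U l" if v: "v \<in> fields" for v
      proof -
        have Lg: "Lam 0 * g v > 0" using g(3) gpos[OF v] by simp
        have l0: "0 \<le> l" using l by simp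
        have UgX: "\<bar>U l * (g u * X u)\<bar> \<le> U l * (gB * B)" if "u \<in> fields" for u
          using gX(1)[OF that] l by (simp add: abs_mult)
        have "transfer l (\<lambda>u. g u * \<psi> u) v = transfer l (\<lambda>u. g u - U l * (g u * X u)) v"
          by (simp add: \<psi>_def algebra_simps)
        also have "\<dots> = transfer l g v - transfer l (\<lambda>u. U l * (g u * X u)) v"
          by (rule transfer_diff[OF v l0 gX(2) UgX])
        also have "transfer l (\<lambda>u. U l * (g u * X u)) v = U l * transfer l (\<lambda>u. g u * X u) v"
          by (rule transfer_cmult[OF v l0 gX(1)])
        finally have e1: "transfer l (\<lambda>u. g u * \<psi> u) v = transfer l g v - U l * transfer l (\<lambda>u. g u * X u) v" .
        \<comment> \<open>Change of the correction term between the parameters 0 and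
          \<open>l\<close>. It enters multiplied by \<open>U l\<close>, so it only has to be small,
          not of order \<open>U l\<close>.\<close>
        define \<Delta> where "\<Delta> = (transfer 0 (\<lambda>u. g u * X u) v - transfer l (\<lambda>u. g u * X u) v) / (Lam 0 * g v)"
        have d0: "\<Delta> \<ge> 0"
        proof -
          have "0 \<le> g u * X u" if "u \<in> fields" for u using gpos[OF that] X[OF that] by simp
          then have "transfer l (\<lambda>u. g u * X u) v \<le> transfer 0 (\<lambda>u. g u * X u) v"
            using gX(1) by (intro transfer_le_0[OF l0 v, of _ "gB * B"]) (auto simp: abs_le_iff)
          then show ?thesis using Lg by (simp add: \<Delta>_def)
        qed
        have BgX: "\<bar>B * g u\<bar> \<le> B * gB" if "u \<in> fields" for u
          using gX(2)[OF that] B by (simp add: abs_mult mult_left_mono)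
        \<comment> \<open>\<open>B * g - g * X\<close> is nonnegative and so also loses mass when
          \<open>l\<close> grows; hence \<open>g * X\<close> loses at most \<open>B\<close> times
          what \<open>g\<close> loses.\<close>
        have d1: "\<Delta> \<le> B * defect l v"
        proof -
          have "transfer l (\<lambda>u. B * g u - g u * X u) v \<le> transfer 0 (\<lambda>u. B * g u - g u * X u) v"
          proof (rule transfer_le_0[OF l0 v])
            fix u assume u: "u \<in> fields"
            show "0 \<le> B * g u - g u * X u" using X[OF u] gpos[OF u] by (simp add: mult.commute[of B])
            show "B * g u - g u * X u \<le> B * gB" using X[OF u] gpos[OF u] gB[OF u] B mult_left_mono[of "g u" gB B] mult_nonneg_nonneg[of "g u" "X u"] by linarith
          qed
          then have "B * transfer l g v - transfer l (\<lambda>u. g u * X u) v \<le> B * transfer 0 g v - transfer 0 (\<lambda>u. g u * X u) v"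
            using transfer_diff[OF v l0, of "\<lambda>u. B * g u" _ "\<lambda>u. g u * X u", OF BgX gX(1)]
              transfer_diff[OF v order_refl, of "\<lambda>u. B * g u" _ "\<lambda>u. g u * X u", OF BgX gX(1)]
              transfer_cmult[OF v l0, of g gB B] transfer_cmult[OF v order_refl, of g gB B] gX(2) by simp
          then have "transfer 0 (\<lambda>u. g u * X u) v - transfer l (\<lambda>u. g u * X u) v \<le> B * (Lam 0 * g v - transfer l g v)"
            using g(2)[OF v] by (simp add: algebra_simps)
          then have "\<Delta> \<le> B * (Lam 0 * g v - transfer l g v) / (Lam 0 * g v)"
            unfolding \<Delta>_def using Lg by (intro divide_right_mono) auto
          also have "\<dots> = B * defect l v" using g(3) gpos[OF v] by (simp add: defect_def g_def[symmetric] diff_divide_distrib right_diff_distrib)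
          finally show ?thesis .
        qed
        have "transfer l (\<lambda>u. g u * X u) v / (Lam 0 * g v) = X v + Hk n v - H v - \<Delta>"
        proof -
          have "transfer 0 (\<lambda>u. g u * X u) v / (Lam 0 * g v) = X v + Hk n v - H v"
            unfolding AX[OF v] using g(3) gpos[OF v] by simp
          then show ?thesis by (simp add: \<Delta>_def diff_divide_distrib)
        qed
        then have e2: "E v = (1 - defect l v) - U l * (X v + Hk n v - H v - \<Delta>)"
          unfolding E_def e1 by (simp add: diff_divide_distrib defect_def g_def[symmetric]) (metis times_divide_eq_right)
        have "defect l v \<le> U l * (h2 + \<mu> / 3)"
        proof -
          have "U l * H v \<le> U l * h2" using Hb[OF v, of 0] l by (intro mult_left_mono) (auto simp: Hk_def)
          moreover have "defect l v \<le> U l * H v + \<mu> / 3 * U l" using D'[OF v] by linarith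
          ultimately show ?thesis by (simp add: algebra_simps)
        qed
        then have "B * defect l v \<le> B * (U l * (h2 + \<mu> / 3))" using B by (intro mult_left_mono)
        moreover have "B * (U l * (h2 + \<mu> / 3)) = U l * (B * (h2 + \<mu> / 3))" by (rule mult.left_commute)
        ultimately have "\<Delta> \<le> \<mu> / 3" using d1 s(1) by linarith
        then have "U l * \<Delta> \<le> U l * (\<mu> / 3)" "0 \<le> U l * \<Delta>" using l d0 by (auto intro!: mult_left_mono)
        moreover have "E v = \<psi> v - U l * Hk n v - (defect l v - U l * H v) + U l * \<Delta>"
          unfolding e2 \<psi>_def by (simp add: algebra_simps)
        ultimately show "\<psi> v - U l * Hk n v - \<mu> / 3 * U l \<le> E v" "E v \<le> \<psi> v - U l * Hk n v + 2 * \<mu> / 3 * U l"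
          using D'[OF v] unfolding abs_le_iff by (simp_all add: mult_ac)
      qed
      have UH: "U l * (m - \<mu> / 3) \<le> U l * Hk n v" "U l * Hk n v \<le> U l * (m + \<mu> / 3)" if "v \<in> fields" for v
      proof -
        have "m - \<mu> / 3 \<le> Hk n v" "Hk n v \<le> m + \<mu> / 3" using Hn[OF that] by linarith+
        then show "U l * (m - \<mu> / 3) \<le> U l * Hk n v" "U l * Hk n v \<le> U l * (m + \<mu> / 3)"
          using l by (simp_all add: mult_left_mono)
      qed
      have up: "E v \<le> (1 - U l * (m - \<mu>)) * \<psi> v" if v: "v \<in> fields" for v
      proof -
        have "U l * (m - \<mu>) * \<psi> v \<le> U l * (m - \<mu>)" using \<psi>(1)[OF v] l \<mu> by (intro mult_left_le) auto
        then show ?thesis using E(2)[OF v] UH(1)[OF v] by (simp add: algebra_simps)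
      qed
      \<comment> \<open>Passing from an additive to a multiplicative bound costs the second-order
        term \<open>U l * (m + \<mu>) * (U l * B)\<close>, which the second smallness condition puts
        below \<open>U l * (\<mu> / 3)\<close>.\<close>
      have lo: "(1 - U l * (m + \<mu>)) * \<psi> v \<le> E v" if v: "v \<in> fields" for v
      proof -
        have "U l * (m + \<mu>) * (1 - U l * B) \<le> U l * (m + \<mu>) * \<psi> v" using \<psi>(2)[OF v] l \<mu> mpos by (intro mult_left_mono) auto
        moreover have "U l * (U l * ((m + \<mu>) * B)) \<le> U l * (\<mu> / 3)" using s(2) l by (intro mult_left_mono) auto
        ultimately have "U l * (m + 2 * \<mu> / 3) \<le> U l * (m + \<mu>) * \<psi> v" by (simp add: algebra_simps)
        then show ?thesis using E(1)[OF v] UH(2)[OF v] by (simp add: algebra_simps)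
      qed
      have l0: "0 \<le> l" using l by simp
      note el = eig[OF l0]
      have g\<psi>: "gb * (1 / 2) \<le> g v * \<psi> v" "g v * \<psi> v \<le> gB" "0 < g v * \<psi> v" if "v \<in> fields" for v
        using \<psi>[OF that] gB[OF that] gpos[OF that] gb mult_mono[of gb "g v" "1 / 2" "\<psi> v"] mult_mono[of "g v" gB "\<psi> v" 1] by auto
      have ElB: "transfer l (\<lambda>u. g u * \<psi> u) v = Lam 0 * E v * g v" if "v \<in> fields" for v
        using gpos[OF that] g(3) by (simp add: E_def)
      have eB: "exp (- (a * (2 * R))) * eig l (\<lambda>_. 0) \<le> eig l v" "eig l v \<le> exp (a * (2 * R)) * eig l (\<lambda>_. 0)" "eig l v > 0" if "v \<in> fields" for v
        using loglip_lower[OF el(2) that] loglip_bdd[OF el(2) that] loglip_pos[OF el(2) that] by auto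
      have "Lam l \<le> Lam 0 * (1 - U l * (m - \<mu>))"
      proof (rule collatz_wielandt[OF l0 el(1), of "eig l" _ "\<lambda>u. g u * \<psi> u" _ "gb * (1 / 2)" gB])
        fix v assume v: "v \<in> fields"
        show "Lam l * eig l v \<le> transfer l (eig l) v" using el(3)[OF v] by simp
        have "transfer l (\<lambda>u. g u * \<psi> u) v \<le> Lam 0 * ((1 - U l * (m - \<mu>)) * \<psi> v) * g v"
          unfolding ElB[OF v] using up[OF v] g(3) gpos[OF v] by (intro mult_right_mono mult_left_mono) auto
        then show "transfer l (\<lambda>u. g u * \<psi> u) v \<le> Lam 0 * (1 - U l * (m - \<mu>)) * (g v * \<psi> v)" by (simp add: mult_ac)
      qed (use eB g\<psi> gb in auto)
      moreover have "Lam 0 * (1 - U l * (m + \<mu>)) \<le> Lam l"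
      proof (rule collatz_wielandt[OF l0, of _ "\<lambda>u. g u * \<psi> u" gB "eig l" _ "exp (- (a * (2 * R))) * eig l (\<lambda>_. 0)" "exp (a * (2 * R)) * eig l (\<lambda>_. 0)"])
        show "0 < Lam 0 * (1 - U l * (m + \<mu>))" using g(3) s(4) by simp
        show "0 < exp (- (a * (2 * R))) * eig l (\<lambda>_. 0)" using eB(3)[OF zero_fields] by simp
        fix v assume v: "v \<in> fields"
        have "Lam 0 * ((1 - U l * (m + \<mu>)) * \<psi> v) * g v \<le> transfer l (\<lambda>u. g u * \<psi> u) v"
          unfolding ElB[OF v] using lo[OF v] g(3) gpos[OF v] by (intro mult_right_mono mult_left_mono) auto
        then show "Lam 0 * (1 - U l * (m + \<mu>)) * (g v * \<psi> v) \<le> transfer l (\<lambda>u. g u * \<psi> u) v" by (simp add: mult_ac)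
        show "transfer l (eig l) v \<le> Lam l * eig l v" using el(3)[OF v] by simp
      qed (use eB g\<psi> in auto)
      ultimately have "1 - Lam l / Lam 0 \<le> U l * (m + \<mu>)" "U l * (m - \<mu>) \<le> 1 - Lam l / Lam 0"
        using g(3) by (auto simp: field_simps)
      then have "(1 - Lam l / Lam 0) / U l \<le> m + \<mu>" "m - \<mu> \<le> (1 - Lam l / Lam 0) / U l"
        using l by (auto simp: pos_divide_le_eq pos_le_divide_eq mult.commute)
      then show ?case by (simp add: dist_real_def abs_le_iff)
    qed
    then show "eventually (\<lambda>l. dist ((1 - Lam l / Lam 0) / U l) m < e) (at_right 0)"
      by eventually_elim (use \<mu> in linarith)
  qed
  then show ?thesis using mpos by blast
qed

text \<open>With \<open>y = 1 - Lam l / Lam 0\<close> the gap is \<open>- ln (1 - y)\<close>, and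
  \<open>y\<close> tends to 0 because it is of order \<open>U l\<close>.\<close>

corollary gap_perturbation:
  assumes H: "loglip b H" "b > 0"
    and U: "eventually (\<lambda>l. U l > 0) (at_right 0)" "(U \<longlongrightarrow> 0) (at_right 0)"
    and D: "\<And>\<epsilon>. \<epsilon> > 0 \<Longrightarrow> eventually (\<lambda>l. \<forall>v\<in>fields. \<bar>defect l v - U l * H v\<bar> \<le> \<epsilon> * U l) (at_right 0)"
  shows "\<exists>m>0. ((\<lambda>l. gap l / U l) \<longlongrightarrow> m) (at_right 0)"
proof -
  obtain m where m: "m > 0" "((\<lambda>l. (1 - Lam l / Lam 0) / U l) \<longlongrightarrow> m) (at_right 0)"
    using perturbation[OF assms] by blast
  define y where "y l = 1 - Lam l / Lam 0" for l
  have "((\<lambda>l. y l / U l * U l) \<longlongrightarrow> m * 0) (at_right 0)" unfolding y_def by (intro tendsto_mult m U)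
  moreover have "eventually (\<lambda>l. y l / U l * U l = y l) (at_right 0)" using U(1) by eventually_elim simp
  ultimately have y0: "(y \<longlongrightarrow> 0) (at_right 0)" by (simp add: tendsto_cong)
  have "((\<lambda>l. gap l / U l) \<longlongrightarrow> m) (at_right 0)"
  proof (rule tendsto_sandwich)
    show "((\<lambda>l. y l / U l) \<longlongrightarrow> m) (at_right 0)" using m by (simp add: y_def)
    have "((\<lambda>l. (y l / U l) / (1 - y l)) \<longlongrightarrow> m / (1 - 0)) (at_right 0)"
      unfolding y_def[symmetric] by (intro tendsto_divide tendsto_diff tendsto_const y0) (use m in \<open>auto simp: y_def\<close>)
    then show "((\<lambda>l. (y l / U l) / (1 - y l)) \<longlongrightarrow> m) (at_right 0)" by simp
    have y1: "eventually (\<lambda>l. y l < 1 \<and> 0 \<le> y l \<and> gap l = - ln (1 - y l)) (at_right 0)"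
      using order_tendstoD(2)[OF y0, of 1, simplified] eventually_at_right_less[of "0::real"]
    proof eventually_elim
      case (elim l)
      have "Lam l \<le> exp (- l) * Lam 0" using Lam_decay[of 0 l] elim by simp
      also have "\<dots> \<le> 1 * Lam 0" using elim eig(1)[of 0] by (intro mult_right_mono) auto
      finally have "Lam l \<le> Lam 0" by simp
      then show ?case using elim eig(1)[of 0] eig(1)[of l] by (simp add: y_def gap_def ln_div)
    qed
    show "eventually (\<lambda>l. y l / U l \<le> gap l / U l) (at_right 0)"
      using y1 U(1)
    proof eventually_elim
      case (elim l)
      then show ?case using ln_one_minus_bounds(1)[of "y l"] by (intro divide_right_mono) auto
    qed
    show "eventually (\<lambda>l. gap l / U l \<le> (y l / U l) / (1 - y l)) (at_right 0)"
      using y1 U(1)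
    proof eventually_elim
      case (elim l)
      then have "gap l / U l \<le> (y l / (1 - y l)) / U l" using ln_one_minus_bounds(2)[of "y l"] by (intro divide_right_mono) auto
      then show ?case by (simp add: mult_ac)
    qed
  qed
  then show ?thesis using m(1) by blast
qed

end

section \<open>Slow variation and Laplace tails\<close>

text \<open>Pick \<open>y\<close> for which both increments \<open>f (x n + y) - f (x n)\<close> and \<open>f (x n + y) - f (x n + u n)\<close>
  are small: each fails only on a set of small measure.\<close>

lemma increment_tendsto_0:
  fixes f :: "real \<Rightarrow> real"
  assumes f: "f \<in> borel_measurable borel"
    and inc: "\<And>y. ((\<lambda>x. f (x + y) - f x) \<longlongrightarrow> 0) at_top"
    and x: "filterlim x at_top sequentially" and u: "\<And>n. 0 \<le> u n" "\<And>n. u n \<le> 1"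
  shows "(\<lambda>n. f (x n + u n) - f (x n)) \<longlonglongrightarrow> 0"
proof (rule tendstoI)
  fix e :: real assume e: "e > 0"
  \<comment> \<open>Shifts in [0, 2] whose increments are small from index \<open>n\<close> on. By
    pointwise convergence these sets exhaust [0, 2], so their measure eventually exceeds
    3/2.\<close>
  define V where "V z n = {y \<in> {0..2}. \<forall>m\<ge>n. \<bar>f (z m + y) - f (z m)\<bar> < e / 2}" for z :: "nat \<Rightarrow> real" and n
  have Vb: "V z n \<in> sets borel" for z n
  proof -
    have m: "{y \<in> space borel. \<bar>f (z m + y) - f (z m)\<bar> < e / 2} \<in> sets borel" for m
      using f by measurable
    have "V z n = {0..2} \<inter> (\<Inter>m\<in>{n..}. {y \<in> space borel. \<bar>f (z m + y) - f (z m)\<bar> < e / 2})" by (auto simp: V_def)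
    also have "\<dots> \<in> sets borel" by (intro sets.Int sets.countable_INT' image_subsetI m) auto
    finally show ?thesis .
  qed
  have Vm: "V z n \<in> lmeasurable" for z n
  proof (rule bounded_set_imp_lmeasurable)
    show "bounded (V z n)" by (rule bounded_subset[of "{0..2}"]) (auto simp: V_def)
    show "V z n \<in> sets lebesgue" using Vb[of z n] by (intro sets_completionI_sets) simp
  qed
  have lim: "eventually (\<lambda>n. measure lebesgue (V z n) > 3 / 2) sequentially" if z: "filterlim z at_top sequentially" for z
  proof -
    have "(\<Union>n. V z n) = {0..2}"
    proof (intro equalityI subsetI)
      fix y :: real assume y: "y \<in> {0..2}"
      have "(\<lambda>n. f (z n + y) - f (z n)) \<longlonglongrightarrow> 0" using filterlim_compose[OF inc z] .
      then have "eventually (\<lambda>n. \<bar>f (z n + y) - f (z n)\<bar> < e / 2) sequentially" using tendstoD[of _ 0 _ "e / 2"] e by fastforce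
      then show "y \<in> (\<Union>n. V z n)" using y by (auto simp: V_def eventually_sequentially)
    qed (auto simp: V_def)
    moreover have "(\<lambda>n. measure lebesgue (V z n)) \<longlonglongrightarrow> measure lebesgue (\<Union>n. V z n)"
      by (rule Lim_measure_incseq) (use Vm calculation in \<open>auto simp: V_def incseq_def dest: fmeasurableD\<close>)
    ultimately show ?thesis by (intro order_tendstoD(1)[of _ 2]) auto
  qed
  have x': "filterlim (\<lambda>n. x n + u n) at_top sequentially"
    by (rule filterlim_at_top_mono[OF x]) (use u in auto)
  show "eventually (\<lambda>n. dist (f (x n + u n) - f (x n)) 0 < e) sequentially"
    using lim[OF x] lim[OF x']
  proof eventually_elim
    case (elim n)
    let ?V = "V x n" and ?W = "(+) (u n) ` V (\<lambda>n. x n + u n) n"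
    \<comment> \<open>Both sets lie in [0, 3] because \<open>u n \<le> 1\<close>, and each has
      measure above 3/2, so they must meet. A common point compares both base points with the same
      third point.\<close>
    have "\<not> disjnt ?V ?W"
    proof
      assume "disjnt ?V ?W"
      then have "measure lebesgue (?V \<union> ?W) = measure lebesgue ?V + measure lebesgue ?W"
        using measure_Un3[of ?V lebesgue ?W] Vm measurable_translation[OF Vm] by (simp add: disjnt_def Diff_triv inf_commute)
      moreover have "measure lebesgue (?V \<union> ?W) \<le> measure lebesgue {0..3::real}"
      proof (rule measure_mono_fmeasurable)
        show "?V \<union> ?W \<subseteq> {0..3}" using u[of n] by (auto simp: V_def)
        show "?V \<union> ?W \<in> sets lebesgue" using Vm measurable_translation[OF Vm] by (intro sets.Un fmeasurableD)
      qed simp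
      moreover have "measure lebesgue ?W = measure lebesgue (V (\<lambda>n. x n + u n) n)" by (rule measure_translation)
      moreover have "measure lebesgue {0..3::real} = 3" by simp
      ultimately show False using elim by linarith
    qed
    then obtain y where "u n + y \<in> V x n" "y \<in> V (\<lambda>n. x n + u n) n" by (auto simp: disjnt_def)
    then have "\<bar>f (x n + u n + y) - f (x n)\<bar> < e / 2" "\<bar>f (x n + u n + y) - f (x n + u n)\<bar> < e / 2"
      by (auto simp: V_def add.assoc)
    then have "\<bar>f (x n + u n) - f (x n)\<bar> < e" by linarith
    then show ?case by (simp add: dist_real_def)
  qed
qed

text \<open>On the logarithmic scale the step from n to n + 1 is a translation that varies with n,
  so convergence for each fixed dilation does not apply directly. \<open>increment_tendsto_0\<close>
  supplies the uniformity, and the measurability of \<open>L\<close> enters there.\<close>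

lemma slowly_varying_Suc:
  assumes L: "slowly_varying L"
  shows "(\<lambda>n. L (real (Suc n)) / L (real n)) \<longlonglongrightarrow> 1"
proof -
  have pos: "L x > 0" if "x > 0" for x using L that by (auto simp: slowly_varying_def)
  define f where "f x = ln (L (exp x))" for x
  define k where "k x = indicator {0<..} x *\<^sub>R L x" for x :: real
  have [measurable]: "k \<in> borel_measurable borel"
    using L unfolding slowly_varying_def set_borel_measurable_def k_def[abs_def] by blast
  have "(\<lambda>x. ln (k (exp x))) \<in> borel_measurable borel" by measurable
  then have fm: "f \<in> borel_measurable borel" by (simp add: f_def[abs_def] k_def)
  have inc: "((\<lambda>x. f (x + y) - f x) \<longlongrightarrow> 0) at_top" for y
  proof -
    have "((\<lambda>x. L (exp y * x) / L x) \<longlongrightarrow> 1) at_top" using L by (auto simp: slowly_varying_def)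
    then have "((\<lambda>x. L (exp y * exp x) / L (exp x)) \<longlongrightarrow> 1) at_top" by (rule filterlim_compose[OF _ exp_at_top])
    then have "((\<lambda>x. ln (L (exp y * exp x) / L (exp x))) \<longlongrightarrow> ln 1) at_top" by (intro tendsto_ln) auto
    moreover have "ln (L (exp y * exp x) / L (exp x)) = f (x + y) - f x" for x
      using pos[of "exp x"] pos[of "exp y * exp x"] by (simp add: f_def ln_div exp_add mult.commute)
    ultimately show ?thesis by simp
  qed
  define u where "u n = ln (real (Suc (Suc n)) / real (Suc n))" for n
  have "(\<lambda>n. f (ln (real (Suc n)) + u n) - f (ln (real (Suc n)))) \<longlonglongrightarrow> 0"
  proof (rule increment_tendsto_0[OF fm inc])
    show "filterlim (\<lambda>n. ln (real (Suc n))) at_top sequentially"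
      by (intro filterlim_compose[OF ln_at_top] filterlim_compose[OF filterlim_real_sequentially] filterlim_Suc)
    show "0 \<le> u n" for n by (simp add: u_def)
    have "u n \<le> real (Suc (Suc n)) / real (Suc n) - 1" for n unfolding u_def by (rule ln_le_minus_one) simp
    also have "\<dots> n \<le> 1" for n by (simp add: field_simps)
    finally show "u n \<le> 1" for n .
  qed
  moreover have "f (ln (real (Suc n)) + u n) - f (ln (real (Suc n))) = ln (L (real (Suc (Suc n))) / L (real (Suc n)))" for n
    using pos[of "real (Suc n)"] pos[of "real (Suc (Suc n))"] by (simp add: f_def u_def exp_add ln_div)
  ultimately have "(\<lambda>n. ln (L (real (Suc (Suc n))) / L (real (Suc n)))) \<longlonglongrightarrow> 0" by simp
  then have "(\<lambda>n. exp (ln (L (real (Suc (Suc n))) / L (real (Suc n))))) \<longlonglongrightarrow> exp 0" by (rule tendsto_exp)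
  moreover have "exp (ln (L (real (Suc (Suc n))) / L (real (Suc n)))) = L (real (Suc (Suc n))) / L (real (Suc n))" for n
    using pos[of "real (Suc n)"] pos[of "real (Suc (Suc n))"] by (intro exp_ln) simp
  ultimately show ?thesis by (subst filterlim_sequentially_Suc[symmetric]) simp
qed

lemma filterlim_at_right_mult: "c > 0 \<Longrightarrow> filterlim (\<lambda>x::real. c * x) (at_right 0) (at_right 0)"
  unfolding filterlim_at
  by (auto intro!: tendsto_eq_intros simp: eventually_at_right_less eventually_at_filter)

text \<open>Regular variation along the integers, in two forms: the ratio of successive masses and
  the ratio under a fixed integer dilation.\<close>

locale regvar_mass =
  fixes K :: "nat \<Rightarrow> real" and \<alpha> :: real
  assumes K_pos: "\<And>n. K (Suc n) > 0" and K_summable: "summable (\<lambda>n. K (Suc n))"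
    and K_Suc: "(\<lambda>n. K (Suc n) / K n) \<longlonglongrightarrow> 1"
    and K_mult: "\<And>m. m \<ge> 1 \<Longrightarrow> (\<lambda>n. K (n * m) / K n) \<longlonglongrightarrow> real m powr - (1 + \<alpha>)"
begin

lemma K_pos': "n \<ge> 1 \<Longrightarrow> K n > 0" using K_pos[of "n - 1"] by simp

text \<open>Once successive ratios exceed \<open>exp (- e)\<close>, the lower bound propagates by
  induction; the minimum over the initial segment supplies the constant.\<close>

lemma subexponential:
  assumes e: "e > 0"
  shows "\<exists>c>0. \<forall>n. c * exp (- e * real (Suc n)) \<le> K (Suc n)"
proof -
  have "eventually (\<lambda>n. exp (- e) < K (Suc n) / K n) sequentially" using e by (intro order_tendstoD(1)[OF K_Suc]) simp
  then obtain M0 where M0: "\<And>n. n \<ge> M0 \<Longrightarrow> exp (- e) < K (Suc n) / K n" by (auto simp: eventually_sequentially)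
  define M where "M = Suc M0"
  have M: "exp (- e) * K n \<le> K (Suc n)" if "n \<ge> M" for n
    using M0[of n] that K_pos'[of n] by (simp add: M_def field_simps)
  define c where "c = Min ((\<lambda>n. K n) ` {1..M})"
  have c: "c > 0" using K_pos' by (auto simp: c_def M_def)
  have "c * exp (- e * real n) \<le> K n" if "n \<ge> 1" for n
    using that
  proof (induction n rule: dec_induct)
    case base
    have "c \<le> K 1" unfolding c_def by (intro Min_le) (auto simp: M_def)
    then show ?case using c e by (auto intro: order_trans[OF mult_left_le])
  next
    case (step n)
    show ?case
    proof (cases "n \<ge> M")
      case True
      have "c * exp (- e * real (Suc n)) = exp (- e) * (c * exp (- e * real n))"
        by (simp add: exp_add[symmetric] algebra_simps)
      also have "\<dots> \<le> exp (- e) * K n" using step.IH by simp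
      finally show ?thesis using M[OF True] by simp
    next
      case False
      then have "c \<le> K (Suc n)" unfolding c_def by (intro Min_le) auto
      then show ?thesis using c e by (auto intro: order_trans[OF mult_left_le])
    qed
  qed
  then have "c * exp (- e * real (Suc n)) \<le> K (Suc n)" for n by (metis le_add1 plus_1_eq_Suc)
  then show ?thesis using c by blast
qed

section \<open>The Laplace tail \<open>U\<close> of the jump law and its regular variation\<close>

definition wU :: "real \<Rightarrow> nat \<Rightarrow> real" where "wU l n = K n * (1 - exp (- l * real n))"
definition U :: "real \<Rightarrow> real" where "U l = (\<Sum>n. wU l n)"

lemma wU_0 [simp]: "wU l 0 = 0" by (simp add: wU_def)
lemma wU_nonneg: "l \<ge> 0 \<Longrightarrow> wU l n \<ge> 0"
  by (cases n) (auto simp: wU_def intro!: mult_nonneg_nonneg less_imp_le[OF K_pos])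
lemma wU_summable: assumes "l \<ge> 0" shows "summable (wU l)"
proof (subst summable_Suc_iff[symmetric], rule summable_comparison_test'[OF K_summable])
  show "norm (wU l (Suc n)) \<le> K (Suc n)" for n
    using assms K_pos[of n] by (auto simp: wU_def abs_mult intro!: mult_left_le less_imp_le)
qed
lemma wU_sums: "l \<ge> 0 \<Longrightarrow> wU l sums U l" unfolding U_def using wU_summable by (rule summable_sums)

lemma wU_le: assumes "l \<ge> 0" shows "wU l n \<le> l * (real n * K n)"
proof (cases n)
  case (Suc k)
  have "1 - exp (- l * real n) \<le> l * real n" using exp_ge_add_one_self[of "- l * real n"] by simp
  then show ?thesis using K_pos[of k] Suc mult_left_mono[of "1 - exp (- l * real n)" "l * real n" "K n"] by (simp add: wU_def mult_ac)
qed simp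

lemma U_pos: assumes "l > 0" shows "U l > 0"
  unfolding U_def
proof (rule suminf_pos2[OF wU_summable])
  show "0 < wU l 1" using assms K_pos[of 0] by (simp add: wU_def)
qed (use assms wU_nonneg in auto)

lemma wU_mono: assumes "l \<le> l'" shows "wU l n \<le> wU l' n"
proof (cases n)
  case (Suc k)
  have "l * real n \<le> l' * real n" using assms by (intro mult_right_mono) auto
  then show ?thesis using K_pos[of k] Suc by (auto simp: wU_def intro!: mult_left_mono)
qed simp

lemma U_mono: assumes "0 \<le> l" "l \<le> l'" shows "U l \<le> U l'"
  unfolding U_def using assms by (intro suminf_le wU_summable wU_mono) auto

lemma U_tendsto_0: "(U \<longlongrightarrow> 0) (at_right 0)"
proof -
  have "eventually (\<lambda>(n, l). norm (wU l n) \<le> K n) (at_top \<times>\<^sub>F at_right 0)"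
    unfolding eventually_prod_filter
  proof (intro exI[of _ "\<lambda>n::nat. n \<ge> 1"] exI[of _ "\<lambda>l::real. l > 0"] conjI allI impI)
    fix n :: nat and l :: real assume "1 \<le> n" "0 < l"
    then show "case (n, l) of (n, l) \<Rightarrow> norm (wU l n) \<le> K n"
      using K_pos'[of n] by (auto simp: wU_def abs_mult intro!: mult_left_le)
  qed (simp_all add: eventually_at_right_less eventually_ge_at_top)
  moreover have "((\<lambda>l. wU l n) \<longlongrightarrow> 0) (at_right 0)" for n
  proof -
    have "((\<lambda>l. K n * (1 - exp (- l * real n))) \<longlongrightarrow> K n * (1 - exp (- 0 * real n))) (at_right 0)" by (intro tendsto_intros)
    then show ?thesis by (simp add: wU_def)
  qed
  moreover have "summable K" using K_summable by (subst summable_Suc_iff[symmetric])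
  ultimately show ?thesis using tannerys_theorem[of "\<lambda>n l. wU l n" "\<lambda>_. 0" "at_right 0" K] by (simp add: U_def[abs_def])
qed

text \<open>Each truncated sum divided by \<open>l\<close> tends to the truncated first moment, and
  these moments are unbounded.\<close>

lemma linear_o_U:
  assumes ns: "\<not> summable (\<lambda>n. real n * K n)"
  shows "filterlim (\<lambda>l. U l / l) at_top (at_right 0)"
  unfolding filterlim_at_top
proof
  fix B :: real
  have nn: "0 \<le> real n * K n" for n using K_pos'[of n] by (cases n) (auto intro: less_imp_le)
  obtain M where M: "B + 1 < (\<Sum>n<M. real n * K n)"
  proof (rule ccontr)
    assume neg: "\<not> thesis"
    have "(\<Sum>n<M. real n * K n) \<le> B + 1" for M by (rule leI) (use neg that in blast)
    then have "summable (\<lambda>n. real n * K n)"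
      using nn by (intro bounded_imp_summable[of _ "B + 1"]) (metis lessThan_Suc_atMost)+
    then show False using ns by blast
  qed
  have lim: "((\<lambda>l. \<Sum>n<M. wU l n / l) \<longlongrightarrow> (\<Sum>n<M. real n * K n)) (at_right 0)"
  proof (rule tendsto_sum)
    fix n
    have "((\<lambda>l. K n * (1 - exp (- l * real n))) has_real_derivative K n * real n) (at 0)"
      by (auto intro!: derivative_eq_intros)
    then have "((\<lambda>l. wU l n / l) \<longlongrightarrow> real n * K n) (at 0)"
      by (simp add: DERIV_def wU_def mult.commute)
    then show "((\<lambda>l. wU l n / l) \<longlongrightarrow> real n * K n) (at_right 0)" by (rule filterlim_mono) (auto simp: at_le)
  qed
  have "eventually (\<lambda>l. B < (\<Sum>n<M. wU l n / l)) (at_right 0)" by (rule order_tendstoD(1)[OF lim]) (use M in linarith)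
  then show "eventually (\<lambda>l. B \<le> U l / l) (at_right 0)"
    using eventually_at_right_less[of "0::real"]
  proof eventually_elim
    case (elim l)
    have "(\<Sum>n<M. wU l n) \<le> U l" unfolding U_def using elim wU_nonneg by (intro sum_le_suminf wU_summable) auto
    then have "(\<Sum>n<M. wU l n) / l \<le> U l / l" using elim by (intro divide_right_mono) auto
    then show ?case using elim by (simp add: sum_divide_distrib)
  qed
qed

text \<open>Starting from the dilation \<open>K (j * m) / K j\<close>, the other members of the
  block are reached by at most m - 1 successive ratios, each tending to 1; since \<open>m\<close> is
  fixed, the estimate is uniform over the block.\<close>

lemma K_block:
  assumes m: "m \<ge> 1" and e: "e > 0"
  shows "eventually (\<lambda>j. \<forall>n\<in>{j * m..<j * m + m}. \<bar>K n - real m powr - (1 + \<alpha>) * K j\<bar> \<le> e * real m powr - (1 + \<alpha>) * K j) sequentially"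
proof -
  define M where "M = real m powr - (1 + \<alpha>)"
  have M: "M > 0" using m by (simp add: M_def)
  have jm: "filterlim (\<lambda>j. j * m + i) sequentially sequentially" for i
  proof (rule filterlim_at_top_mono[OF filterlim_ident])
    show "eventually (\<lambda>j. j \<le> j * m + i) sequentially" using m by (auto intro!: always_eventually trans_le_add1)
  qed
  have lim: "(\<lambda>j. K (j * m + i) / K j) \<longlonglongrightarrow> M" for i
  proof (induction i)
    case 0 then show ?case using K_mult[OF m] by (simp add: M_def)
  next
    case (Suc i)
    have "(\<lambda>j. K (Suc (j * m + i)) / K (j * m + i) * (K (j * m + i) / K j)) \<longlonglongrightarrow> 1 * M"
      by (intro tendsto_mult Suc filterlim_compose[OF K_Suc jm])
    moreover have "eventually (\<lambda>j. K (Suc (j * m + i)) / K (j * m + i) * (K (j * m + i) / K j) = K (j * m + Suc i) / K j) sequentially"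
      using eventually_ge_at_top[of 1]
    proof eventually_elim
      case (elim j)
      then have "K (j * m + i) > 0" using m by (intro K_pos') (simp add: trans_le_add1)
      then show ?case by simp
    qed
    ultimately show ?case using Lim_transform_eventually by fastforce
  qed
  have "eventually (\<lambda>j. \<forall>i\<in>{..<m}. dist (K (j * m + i) / K j) M < e * M) sequentially"
    using e M by (intro eventually_ball_finite ballI tendstoD[OF lim]) auto
  then show ?thesis using eventually_ge_at_top[of 1]
  proof eventually_elim
    case (elim j)
    show ?case
    proof
      fix n assume n: "n \<in> {j * m..<j * m + m}"
      have Kj: "K j > 0" using K_pos' elim by simp
      have "\<bar>K n / K j - M\<bar> \<le> e * M" using elim(1) n by (auto simp: dist_real_def dest!: bspec[of _ _ "n - j * m"])
      then have "\<bar>(K n / K j - M) * K j\<bar> \<le> e * M * K j" using Kj by (simp add: abs_mult mult_right_mono)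
      then show "\<bar>K n - real m powr - (1 + \<alpha>) * K j\<bar> \<le> e * real m powr - (1 + \<alpha>) * K j"
        using Kj by (simp add: M_def algebra_simps)
    qed
  qed
qed

text \<open>Doubling the index multiplies a block of \<open>n * K n\<close> by \<open>2 powr (1 - \<alpha>) > 1\<close>, so a finite tail sum would
  exceed itself.\<close>

lemma nK_not_summable:
  assumes \<alpha>: "\<alpha> < 1"
  shows "\<not> summable (\<lambda>n. real n * K n)"
proof
  define a where "a n = real n * K n" for n
  assume "summable (\<lambda>n. real n * K n)"
  then have sa: "summable a" by (simp add: a_def[abs_def])
  have a0: "a n \<ge> 0" "n \<ge> 1 \<Longrightarrow> a n > 0" for n using K_pos'[of n] by (cases n; auto simp: a_def intro: less_imp_le)+
  define M where "M = 2 powr - (1 + \<alpha>)"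
  have M: "M > 1 / 4"
  proof -
    have "2 powr - 2 < M" unfolding M_def using \<alpha> by (intro powr_less_mono) auto
    then show ?thesis by (simp add: powr_minus powr_numeral)
  qed
  \<comment> \<open>The terms at 2j and 2j + 1 are each about \<open>2 * j * M * K j\<close>,
    together \<open>4 * M\<close> times \<open>a j\<close>. A relative loss \<open>e\<close> would
    bring this factor down to 1; half of that loss leaves \<open>\<kappa> > 1\<close>.\<close>
  define e where "e = 1 - 1 / (4 * M)"
  have e: "e > 0" "4 * M * (1 - e) = 1" using M by (auto simp: e_def field_simps)
  define e' where "e' = e / 2"
  define \<kappa> where "\<kappa> = 4 * M * (1 - e')"
  have e': "e' > 0" "\<kappa> > 1" 
  proof -
    have "\<kappa> = 4 * M * (1 - e) + 2 * (M * e)" by (simp add: \<kappa>_def e'_def algebra_simps)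
    moreover have "M * e > 0" using M e by simp
    ultimately show "\<kappa> > 1" using e by linarith
    show "e' > 0" using e by (simp add: e'_def)
  qed
  obtain N where N: "\<And>j n. j \<ge> N \<Longrightarrow> n \<in> {j * 2..<j * 2 + 2} \<Longrightarrow> \<bar>K n - M * K j\<bar> \<le> e' * M * K j"
    using K_block[of 2 e'] e' unfolding eventually_sequentially M_def by (metis of_nat_numeral one_le_numeral)
  define N1 where "N1 = Suc N"
  have blk: "\<kappa> * a j \<le> a (2 * j) + a (2 * j + 1)" if "j \<ge> N1" for j
  proof -
    have j: "j \<ge> N" "K j > 0" using that K_pos' by (auto simp: N1_def)
    have "(1 - e') * M * K j \<le> K (2 * j)" "(1 - e') * M * K j \<le> K (2 * j + 1)"
      using N[OF j(1), of "2 * j"] N[OF j(1), of "2 * j + 1"] by (auto simp: abs_le_iff algebra_simps)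
    then have "real (2 * j) * ((1 - e') * M * K j) \<le> a (2 * j)" "real (2 * j) * ((1 - e') * M * K j) \<le> real (2 * j) * K (2 * j + 1)"
      unfolding a_def by (auto intro!: mult_left_mono)
    moreover have "real (2 * j) * K (2 * j + 1) \<le> a (2 * j + 1)"
      unfolding a_def using K_pos[of "2 * j"] by (intro mult_right_mono) auto
    moreover have "\<kappa> * a j = real (2 * j) * ((1 - e') * M * K j) + real (2 * j) * ((1 - e') * M * K j)"
      by (simp add: \<kappa>_def a_def algebra_simps)
    ultimately show ?thesis by linarith
  qed
  define T where "T n = (\<Sum>j. a (j + n))" for n
  have sT: "summable (\<lambda>j. a (j + n))" for n using sa by (simp add: summable_iff_shift)
  have "(\<lambda>j. \<Sum>i\<in>{j * 2..<j * 2 + 2}. a (i + 2 * N1)) sums T (2 * N1)"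
    unfolding T_def by (rule sums_group[OF summable_sums[OF sT]]) simp
  moreover have "(\<Sum>i\<in>{j * 2..<j * 2 + 2}. a (i + 2 * N1)) = a (2 * (j + N1)) + a (2 * (j + N1) + 1)" for j
    by (simp add: numeral_2_eq_2 algebra_simps)
  ultimately have 1: "(\<lambda>j. a (2 * (j + N1)) + a (2 * (j + N1) + 1)) sums T (2 * N1)" by simp
  have "\<kappa> * T N1 \<le> T (2 * N1)"
    unfolding T_def[of N1] suminf_mult[OF sT, symmetric]
    by (rule sums_le[OF _ summable_sums[OF summable_mult[OF sT]] 1]) (rule blk, simp)
  moreover have "T (2 * N1) \<le> T N1"
    using suminf_split_initial_segment[OF sT[of N1], of N1] a0(1) by (simp add: T_def sum_nonneg mult_2 add.assoc)
  moreover have "T N1 > 0" unfolding T_def using a0 by (intro suminf_pos sT) (simp add: N1_def)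
  ultimately show False using e'(2) mult_less_cancel_right1[of "T N1" \<kappa>] by linarith
qed

text \<open>The increment is at most \<open>exp (- l * x) * (l * z)\<close>, and
  \<open>l * x \<le> exp (l * x) - 1\<close> turns \<open>l * z \<le> l * x / j\<close> into a
  relative error 1/j that does not depend on \<open>l\<close>.\<close>

lemma one_minus_exp_block:
  fixes l x z :: real
  assumes "l \<ge> 0" "j \<ge> 1" "0 \<le> z" "z \<le> x / real j" "x \<ge> 0"
  shows "1 - exp (- l * (x + z)) \<le> (1 + 1 / real j) * (1 - exp (- l * x))"
proof -
  have "1 - exp (- l * z) \<le> l * z" using exp_ge_add_one_self[of "- l * z"] by simp
  also have "\<dots> \<le> l * x / real j" using assms mult_left_mono[of z "x / real j" l] by simp
  also have "\<dots> \<le> (exp (l * x) - 1) / real j" 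
  proof (rule divide_right_mono)
    show "l * x \<le> exp (l * x) - 1" using exp_ge_add_one_self[of "l * x"] by linarith
  qed simp
  finally have "exp (- l * x) * (1 - exp (- l * z)) \<le> exp (- l * x) * ((exp (l * x) - 1) / real j)" by (intro mult_left_mono) auto
  also have "\<dots> = (1 - exp (- l * x)) / real j" by (simp add: exp_minus field_simps)
  finally have "exp (- l * x) * (1 - exp (- l * z)) \<le> (1 - exp (- l * x)) / real j" .
  moreover have "exp (- l * (x + z)) = exp (- l * x) * exp (- l * z)" by (simp add: exp_add[symmetric] algebra_simps)
  moreover have "(1 + 1 / real j) * (1 - exp (- l * x)) = (1 - exp (- l * x)) + (1 - exp (- l * x)) / real j"
    by (simp add: distrib_right)
  ultimately show ?thesis by (simp add: right_diff_distrib)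
qed

text \<open>Group the sum \<open>U l\<close> into blocks \<open>n = j * m + i\<close> with \<open>i < m\<close>: each block is asymptotically
  \<open>m powr - \<alpha>\<close> times the \<open>j\<close>-th term of \<open>U (m * l)\<close>.\<close>

lemma U_block:
  assumes m: "m \<ge> 1" and e: "0 < e" "e \<le> 1"
  shows "\<exists>c. \<forall>l>0. \<bar>U l - real m powr - \<alpha> * U (real m * l)\<bar> \<le> c * l + 3 * e * (real m powr - \<alpha> * U (real m * l))"
proof -
  define M where "M = real m powr - (1 + \<alpha>)"
  have M: "M > 0" "real m * M = real m powr - \<alpha>"
    using m powr_mult_base[of "real m" "- (1 + \<alpha>)"] by (auto simp: M_def)
  obtain N0 where N0: "\<And>j n. j \<ge> N0 \<Longrightarrow> n \<in> {j * m..<j * m + m} \<Longrightarrow> \<bar>K n - M * K j\<bar> \<le> e * M * K j"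
    using K_block[OF m e(1)] unfolding eventually_sequentially M_def by blast
  obtain N1 :: nat where N1: "1 / e < real N1" using reals_Archimedean2 by blast
  \<comment> \<open>\<open>N0\<close> controls the ratios of \<open>K\<close>; \<open>N1\<close>
    brings the variation 1/j of the exponential factor within a block below
    \<open>e\<close>.\<close>
  define N where "N = max N0 (Suc N1)"
  define G where "G l j = (\<Sum>n\<in>{j * m..<j * m + m}. wU l n)" for l j
  define V where "V l j = real m powr - \<alpha> * wU (real m * l) j" for l j
  have G: "G l sums U l" if "l > 0" for l unfolding G_def using that m by (intro sums_group wU_sums) auto
  have V: "V l sums (real m powr - \<alpha> * U (real m * l))" if "l > 0" for l unfolding V_def using that by (intro sums_mult wU_sums) auto
  have V0: "V l j \<ge> 0" if "l > 0" for l j unfolding V_def using wU_nonneg[of "real m * l" j] that by simp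
  have G0: "G l j \<ge> 0" if "l > 0" for l j unfolding G_def using wU_nonneg[of l] that by (intro sum_nonneg) auto
  have blk: "\<bar>G l j - V l j\<bar> \<le> 3 * e * V l j" if j: "j \<ge> N" and l: "l > 0" for l j
  proof -
    have j': "j \<ge> N0" "j \<ge> 1" "1 / real j \<le> e" "K j > 0"
    proof -
      show "j \<ge> N0" "j \<ge> 1" using j by (auto simp: N_def)
      have "1 / e \<le> real j" using N1 j by (auto simp: N_def)
      then show "1 / real j \<le> e" using e \<open>j \<ge> 1\<close> by (simp add: field_simps)
      show "K j > 0" using \<open>j \<ge> 1\<close> by (rule K_pos')
    qed
    define y where "y = 1 - exp (- l * real (j * m))"
    have y: "y \<ge> 0" using l by (simp add: y_def)
    have Vy: "V l j = real m * (M * K j * y)"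
      by (simp add: V_def wU_def y_def M(2)[symmetric] mult_ac)
    have "wU l n \<le> (1 + 3 * e) * (M * K j * y) \<and> (1 - 3 * e) * (M * K j * y) \<le> wU l n" if n: "n \<in> {j * m..<j * m + m}" for n
    proof -
      have Kn: "(1 - e) * (M * K j) \<le> K n" "K n \<le> (1 + e) * (M * K j)"
        using N0[OF j'(1) n] by (auto simp: abs_le_iff algebra_simps)
      have "1 \<le> j * m" using j' m by simp
      moreover have "j * m \<le> n" using n by simp
      ultimately have n1: "n \<ge> 1" by (rule order_trans)
      have "real (j * m) \<le> real n" using n by (simp only: of_nat_le_iff) simp
      then have yn: "y \<le> 1 - exp (- l * real n)" using l by (simp add: y_def del: of_nat_mult)
      have "1 - exp (- l * (real (j * m) + (real n - real (j * m)))) \<le> (1 + 1 / real j) * (1 - exp (- l * real (j * m)))"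
      proof (rule one_minus_exp_block)
        have "real n \<le> real (j * m + m)" using n by (simp only: of_nat_le_iff) simp
        then show "real n - real (j * m) \<le> real (j * m) / real j" using j' by simp
        have "real (j * m) \<le> real n" using n by (subst of_nat_le_iff) auto
        then show "0 \<le> real n - real (j * m)" by simp
      qed (use l j' in auto)
      then have "1 - exp (- l * real n) \<le> (1 + 1 / real j) * y" by (simp add: y_def)
      also have "\<dots> \<le> (1 + e) * y" using j' y by (intro mult_right_mono) auto
      finally have ny: "1 - exp (- l * real n) \<le> (1 + e) * y" .
      have MK: "M * K j \<ge> 0" using M j' by simp
      \<comment> \<open>One factor 1 + e comes from \<open>K\<close>, the other from the
        exponential; their product is at most 1 + 3e because \<open>e \<le> 1\<close>.\<close>
      have "wU l n \<le> (1 + e) * (M * K j) * ((1 + e) * y)"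
        unfolding wU_def using Kn ny K_pos'[OF n1] yn y e MK l by (intro mult_mono) auto
      also have "\<dots> = (1 + 2 * e + e * e) * (M * K j * y)" by (simp add: algebra_simps)
      also have "\<dots> \<le> (1 + 3 * e) * (M * K j * y)" using e MK y mult_left_le[of e e] by (intro mult_right_mono) auto
      finally have 1: "wU l n \<le> (1 + 3 * e) * (M * K j * y)" .
      have "(1 - 3 * e) * (M * K j * y) \<le> (1 - e) * (M * K j * y)" using e MK y by (intro mult_right_mono) auto
      also have "\<dots> = (1 - e) * (M * K j) * y" by simp
      also have "\<dots> \<le> wU l n" unfolding wU_def using Kn yn y e MK K_pos'[OF n1] by (intro mult_mono) auto
      finally show ?thesis using 1 by blast
    qed
    then have "(\<Sum>n\<in>{j * m..<j * m + m}. (1 - 3 * e) * (M * K j * y)) \<le> G l j" "G l j \<le> (\<Sum>n\<in>{j * m..<j * m + m}. (1 + 3 * e) * (M * K j * y))"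
      unfolding G_def by (auto intro!: sum_mono simp del: sum_constant)
    then show ?thesis unfolding Vy by (simp add: abs_le_iff algebra_simps)
  qed
  \<comment> \<open>The first \<open>N\<close> blocks are estimated by \<open>wU_le\<close> and
    contribute only a term linear in \<open>l\<close>, which \<open>linear_o_U\<close> later makes
    negligible.\<close>
  define c where "c = (\<Sum>j<N. (\<Sum>n\<in>{j * m..<j * m + m}. real n * K n) + real m powr - \<alpha> * (real m * (real j * K j)))"
  have "\<bar>U l - real m powr - \<alpha> * U (real m * l)\<bar> \<le> c * l + 3 * e * (real m powr - \<alpha> * U (real m * l))" if l: "l > 0" for l
  proof -
    have sGV: "summable (\<lambda>j. G l j - V l j)" "summable (V l)" using G[OF l] V[OF l] by (auto simp: sums_iff intro: summable_diff)
    have "U l - real m powr - \<alpha> * U (real m * l) = (\<Sum>j. G l j - V l j)" using sums_diff[OF G[OF l] V[OF l]] by (simp add: sums_iff)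
    also have "\<dots> = (\<Sum>j. G l (j + N) - V l (j + N)) + (\<Sum>j<N. G l j - V l j)"
      by (rule suminf_split_initial_segment[OF sGV(1)])
    finally have 1: "U l - real m powr - \<alpha> * U (real m * l) = (\<Sum>j. G l (j + N) - V l (j + N)) + (\<Sum>j<N. G l j - V l j)" .
    have "norm (\<Sum>j. G l (j + N) - V l (j + N)) \<le> (\<Sum>j. 3 * e * V l (j + N))"
      using sGV(2) blk l by (intro norm_suminf_le summable_mult) (auto simp: summable_iff_shift)
    also have "\<dots> = 3 * e * (\<Sum>j. V l (j + N))" using sGV(2) by (intro suminf_mult) (simp add: summable_iff_shift)
    also have "\<dots> \<le> 3 * e * (real m powr - \<alpha> * U (real m * l))"
    proof -
      have "(\<Sum>j. V l (j + N)) \<le> suminf (V l)"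
        using suminf_split_initial_segment[OF sGV(2), of N] V0[OF l] by (simp add: sum_nonneg)
      then show ?thesis using V[OF l] e by (intro mult_left_mono) (auto simp: sums_iff)
    qed
    finally have 2: "\<bar>\<Sum>j. G l (j + N) - V l (j + N)\<bar> \<le> 3 * e * (real m powr - \<alpha> * U (real m * l))" by simp
    have "\<bar>\<Sum>j<N. G l j - V l j\<bar> \<le> (\<Sum>j<N. \<bar>G l j - V l j\<bar>)" by (rule sum_abs)
    also have "\<dots> \<le> (\<Sum>j<N. ((\<Sum>n\<in>{j * m..<j * m + m}. real n * K n) + real m powr - \<alpha> * (real m * (real j * K j))) * l)"
    proof (rule sum_mono)
      fix j
      have "G l j \<le> (\<Sum>n\<in>{j * m..<j * m + m}. l * (real n * K n))" unfolding G_def using l by (intro sum_mono wU_le) auto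
      moreover have "V l j \<le> real m powr - \<alpha> * (real m * l * (real j * K j))" unfolding V_def using l by (intro mult_left_mono wU_le) auto
      moreover have "\<bar>G l j - V l j\<bar> \<le> G l j + V l j" using G0[OF l, of j] V0[OF l, of j] by linarith
      ultimately show "\<bar>G l j - V l j\<bar> \<le> ((\<Sum>n\<in>{j * m..<j * m + m}. real n * K n) + real m powr - \<alpha> * (real m * (real j * K j))) * l"
        by (simp add: sum_distrib_left[symmetric] algebra_simps)
    qed
    also have "\<dots> = c * l" by (simp add: c_def sum_distrib_right)
    finally show ?thesis using 1 2 by linarith
  qed
  then show ?thesis by blast
qed

lemma U_nat_ratio:
  assumes ns: "\<not> summable (\<lambda>n. real n * K n)" and m: "m \<ge> 1"
  shows "((\<lambda>l. U (real m * l) / U l) \<longlongrightarrow> real m powr \<alpha>) (at_right 0)"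
proof -
  define q where "q = real m powr - \<alpha>"
  have q: "q > 0" "inverse q = real m powr \<alpha>" using m by (auto simp: q_def powr_minus)
  have lU: "((\<lambda>l. l / U l) \<longlongrightarrow> 0) (at_right 0)"
    using tendsto_inverse_0_at_top[OF linear_o_U[OF ns]] by (simp add: field_simps)
  have "((\<lambda>l. q * U (real m * l) / U l) \<longlongrightarrow> 1) (at_right 0)"
  proof (rule tendstoI)
    fix d :: real assume d: "d > 0"
    \<comment> \<open>The bound 1/6 gives \<open>3 * e * t \<le> t / 2\<close> and hence
      \<open>t \<le> 3\<close>; then d/24 makes this term at most 3d/8, which together with
      \<open>s < d / 4\<close> stays below \<open>d\<close>.\<close>
    define e where "e = min (1 / 6) (d / 24)"
    have e: "0 < e" "e \<le> 1" "e \<le> 1 / 6" "e \<le> d / 24" using d by (auto simp: e_def)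
    obtain c where c: "\<And>l. l > 0 \<Longrightarrow> \<bar>U l - q * U (real m * l)\<bar> \<le> c * l + 3 * e * (q * U (real m * l))"
      using U_block[OF m e(1,2)] unfolding q_def by blast
    have "((\<lambda>l. c * (l / U l)) \<longlongrightarrow> 0) (at_right 0)" by (rule tendsto_mult_right_zero[OF lU])
    then have "eventually (\<lambda>l. dist (c * (l / U l)) 0 < min (1 / 2) (d / 4)) (at_right 0)" using d by (intro tendstoD) auto
    then show "eventually (\<lambda>l. dist (q * U (real m * l) / U l) 1 < d) (at_right 0)"
      using eventually_at_right_less[of "0::real"]
    proof eventually_elim
      case (elim l)
      define t where "t = q * U (real m * l) / U l"
      define s where "s = c * (l / U l)"
      have Up: "U l > 0" using U_pos elim by simp
      have "\<bar>U l - q * U (real m * l)\<bar> / U l \<le> (c * l + 3 * e * (q * U (real m * l))) / U l"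
        using c[of l] elim Up by (intro divide_right_mono) auto
      also have "\<bar>U l - q * U (real m * l)\<bar> / U l = \<bar>1 - t\<bar>"
      proof -
        have "1 - t = (U l - q * U (real m * l)) / U l" using Up by (simp add: t_def diff_divide_distrib)
        then show ?thesis using Up by (simp add: abs_divide)
      qed
      also have "(c * l + 3 * e * (q * U (real m * l))) / U l = s + 3 * e * t" by (simp add: s_def t_def add_divide_distrib)
      finally have ts: "\<bar>1 - t\<bar> \<le> s + 3 * e * t" .
      have s: "s < 1 / 2" "s < d / 4" using elim by (simp_all only: s_def dist_real_def min_less_iff_conj abs_less_iff diff_zero)
      have "t \<ge> 0" unfolding t_def using q Up U_pos[of "real m * l"] elim m by simp
      then have "3 * e * t \<le> t / 2" using e mult_right_mono[of e "1 / 6" t] by simp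
      then have "t \<le> 3" using ts s by (auto simp: abs_le_iff)
      then have "3 * e * t \<le> 3 * (d / 24) * 3" using e \<open>t \<ge> 0\<close> by (intro mult_mono) auto
      then have "\<bar>1 - t\<bar> < d" using ts s d by linarith
      then show ?case by (simp add: t_def[symmetric] dist_real_def abs_minus_commute)
    qed
  qed
  then have "((\<lambda>l. inverse q * (q * U (real m * l) / U l)) \<longlongrightarrow> inverse q * 1) (at_right 0)" by (rule tendsto_mult_left)
  moreover have "inverse q * (q * U (real m * l) / U l) = U (real m * l) / U l" for l
    using q(1) by (simp add: mult.assoc[symmetric] del: times_divide_eq_right add: times_divide_eq_right[symmetric])
  ultimately show ?thesis unfolding q(2)[symmetric] by (simp only: mult_1_right)
qed

text \<open>A rational dilation is a quotient of two integer dilations after rescaling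
  \<open>l\<close> by the denominator. Real ones are squeezed between rationals, since
  \<open>U\<close> is monotone and the limit is continuous in \<open>c\<close>.\<close>

theorem U_ratio:
  assumes ns: "\<not> summable (\<lambda>n. real n * K n)" and c: "c > 0" and \<alpha>: "\<alpha> > 0"
  shows "((\<lambda>l. U (c * l) / U l) \<longlongrightarrow> c powr \<alpha>) (at_right 0)"
proof -
  have rat: "((\<lambda>l. U (q * l) / U l) \<longlongrightarrow> q powr \<alpha>) (at_right 0)" if q: "q \<in> \<rat>" "q > 0" for q
  proof -
    obtain k n :: nat where kn: "n \<noteq> 0" "\<bar>q\<bar> = real k / real n" using Rats_abs_nat_div_natE[OF q(1)] by metis
    then have k: "q = real k / real n" "k \<ge> 1" "n \<ge> 1" using q(2) by (auto intro: gr0I simp: Suc_le_eq)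
    have "((\<lambda>l. (U (real k * l) / U l) / (U (real n * l) / U l)) \<longlongrightarrow> real k powr \<alpha> / real n powr \<alpha>) (at_right 0)"
      using k by (intro tendsto_divide U_nat_ratio ns) auto
    then have "((\<lambda>l. (U (real k * (1 / real n * l)) / U (1 / real n * l)) / (U (real n * (1 / real n * l)) / U (1 / real n * l))) \<longlongrightarrow> real k powr \<alpha> / real n powr \<alpha>) (at_right 0)"
      by (rule filterlim_compose[OF _ filterlim_at_right_mult]) (use k in auto)
    moreover have "eventually (\<lambda>l. (U (real k * (1 / real n * l)) / U (1 / real n * l)) / (U (real n * (1 / real n * l)) / U (1 / real n * l)) = U (q * l) / U l) (at_right 0)"
      using eventually_at_right_less[of "0::real"]
    proof eventually_elim
      case (elim l)
      have "U (1 / real n * l) > 0" using elim k by (intro U_pos) auto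
      then show ?case using k by simp
    qed
    ultimately show ?thesis using k Lim_transform_eventually by (fastforce simp: powr_divide)
  qed
  have cont: "isCont (\<lambda>x. x powr \<alpha>) c" using c by (intro continuous_intros) auto
  show ?thesis
  proof (rule order_tendstoI)
    fix y assume y: "y < c powr \<alpha>"
    have "((\<lambda>x. x powr \<alpha>) \<longlongrightarrow> c powr \<alpha>) (at_left c)" using cont unfolding isCont_def filterlim_at_split by blast
    then have "eventually (\<lambda>x. y < x powr \<alpha>) (at_left c)" using y by (rule order_tendstoD)
    then obtain b where b: "b < c" "\<And>x. b < x \<Longrightarrow> x < c \<Longrightarrow> y < x powr \<alpha>" by (auto simp: eventually_at_left[OF c])
    obtain q where q: "q \<in> \<rat>" "max b 0 < q" "q < c" using Rats_dense_in_real[of "max b 0" c] b c by auto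
    have q': "q > 0" "y < q powr \<alpha>" using q b(2)[of q] by simp_all
    have "eventually (\<lambda>l. y < U (q * l) / U l) (at_right 0)" by (rule order_tendstoD(1)[OF rat[OF q(1) q'(1)] q'(2)])
    then show "eventually (\<lambda>l. y < U (c * l) / U l) (at_right 0)"
      using eventually_at_right_less[of "0::real"]
    proof eventually_elim
      case (elim l)
      have "U (q * l) / U l \<le> U (c * l) / U l" using elim q U_pos[of l] by (intro divide_right_mono U_mono) auto
      then show ?case using elim by linarith
    qed
  next
    fix y assume y: "c powr \<alpha> < y"
    have "((\<lambda>x. x powr \<alpha>) \<longlongrightarrow> c powr \<alpha>) (at_right c)" using cont unfolding isCont_def filterlim_at_split by blast
    then have "eventually (\<lambda>x. x powr \<alpha> < y) (at_right c)" using y by (rule order_tendstoD)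
    then obtain b where b: "c < b" "\<And>x. c < x \<Longrightarrow> x < b \<Longrightarrow> x powr \<alpha> < y" by (auto simp: eventually_at_right[of c "c + 1"])
    obtain q where q: "q \<in> \<rat>" "c < q" "q < b" using Rats_dense_in_real[of c b] b by auto
    have q': "q > 0" "q powr \<alpha> < y" using q c b(2)[of q] by simp_all
    have "eventually (\<lambda>l. U (q * l) / U l < y) (at_right 0)" by (rule order_tendstoD(2)[OF rat[OF q(1) q'(1)] q'(2)])
    then show "eventually (\<lambda>l. U (c * l) / U l < y) (at_right 0)"
      using eventually_at_right_less[of "0::real"]
    proof eventually_elim
      case (elim l)
      have "U (c * l) / U l \<le> U (q * l) / U l" using elim q c U_pos[of l] by (intro divide_right_mono U_mono) auto
      then show ?case using elim by linarith
    qed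
  qed
qed

end

section \<open>Regular variation of the free energy\<close>

context pinning
begin

lemma defect_sums:
  assumes l: "l \<ge> 0" and v: "v \<in> fields"
  shows "(\<lambda>n. wt 0 v n * (1 - exp (- l * real (Suc n))) * eig 0 (next_field n v)) sums (defect l v * (Lam 0 * eig 0 v))"
proof -
  note e = eig[OF order_refl]
  have "(\<lambda>n. wt 0 v n * eig 0 (next_field n v) - wt l v n * eig 0 (next_field n v)) sums (transfer 0 (eig 0) v - transfer l (eig 0) v)"
    unfolding transfer_def using l by (intro sums_diff summable_sums transfer_summable_loglip[OF _ e(2) v]) auto
  moreover have "transfer 0 (eig 0) v - transfer l (eig 0) v = defect l v * (Lam 0 * eig 0 v)"
    using e(1) loglip_pos[OF e(2) v] e(3)[OF v] by (simp add: defect_def left_diff_distrib)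
  moreover have "wt l v n = wt 0 v n * exp (- l * real (Suc n))" for n
    by (simp add: wt_def exp_diff exp_minus divide_inverse)
  ultimately show ?thesis by (simp add: algebra_simps)
qed

text \<open>After a long jump the weight factor \<open>exp (v (Suc n))\<close> is close to 1 and the
  eigenfunction is close to its value at \<open>\<eta>\<close>; this is the numerator of
  \<open>H\<close>, while the denominator normalises at the starting field.\<close>

lemma gap_infinite_mean:
  assumes "regvar_mass K \<alpha>" and ns: "\<not> summable (\<lambda>n. real n * K n)"
  shows "\<exists>m>0. ((\<lambda>l. gap l / regvar_mass.U K l) \<longlongrightarrow> m) (at_right 0)"
proof -
  interpret regvar_mass K \<alpha> by fact
  define g where "g = eig 0"
  have g: "loglip a g" "Lam 0 > 0" using eig[of 0] by (auto simp: g_def)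
  have gpos: "g v > 0" if "v \<in> fields" for v using loglip_pos[OF g(1) that] .
  define H where "H v = g \<eta> / (Lam 0 * g v)" for v
  show ?thesis
  proof (rule gap_perturbation[of a H])
    show "loglip a H"
      unfolding loglip_def
    proof (intro conjI ballI allI impI)
      show "H v > 0" if "v \<in> fields" for v using gpos[OF that] gpos[OF eta_fields] g(2) by (simp add: H_def)
      fix u v e assume *: "u \<in> fields" "v \<in> fields" "0 \<le> (e::real)" "near e u v"
      have "g v \<le> exp (a * e) * g u" using loglipD[OF g(1) *(2,1,3) near_sym[OF *(4)]] .
      then have "g \<eta> * g v \<le> g \<eta> * (exp (a * e) * g u)"
        using gpos[OF eta_fields] by (intro mult_left_mono) auto
      then show "H u \<le> exp (a * e) * H v"
        using gpos[OF *(1)] gpos[OF *(2)] g(2) by (simp add: H_def divide_simps mult_ac)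
    qed
    show "a > 0" by (rule a_pos)
    show "eventually (\<lambda>l. U l > 0) (at_right 0)"
      using eventually_at_right_less[of "0::real"] by eventually_elim (rule U_pos)
    show "(U \<longlongrightarrow> 0) (at_right 0)" by (rule U_tendsto_0)
    \<comment> \<open>\<open>R * x\<close> is the error exponent of \<open>exp (v (Suc n))\<close>
      and \<open>a * (R * x)\<close> that of \<open>g\<close>, with
      \<open>x = r ^ Suc n\<close>.\<close>
    define M where "M = (1 + a) * R"
    have M: "M > 0" using a_pos R_pos by (simp add: M_def)
    define c where "c = M * exp M * g \<eta>"
    have c: "c > 0" using M gpos[OF eta_fields] by (simp add: c_def)
    have dev: "\<bar>exp (v (Suc n)) * g (next_field n v) - g \<eta>\<bar> \<le> c * r ^ Suc n" if v: "v \<in> fields" for v n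
    proof -
      define x where "x = r ^ Suc n"
      have x: "0 \<le> x" "x \<le> 1" unfolding x_def using r rpow_le(1)[of "Suc n"] by auto
      have Rx: "R * x \<ge> 0" using R_pos x by simp
      have near: "near (R * x) (next_field n v) \<eta>" using near_next_field_eta[OF v] by (simp add: x_def)
      have g1: "g (next_field n v) \<le> exp (a * (R * x)) * g \<eta>" using loglipD[OF g(1) _ _ Rx near] v by simp
      have g2: "g \<eta> \<le> exp (a * (R * x)) * g (next_field n v)" using loglipD[OF g(1) _ _ Rx near_sym[OF near]] v by simp
      have v1: "v (Suc n) \<le> R * x" "- (R * x) \<le> v (Suc n)" using fields_bound[OF v, of "Suc n"] by (auto simp: x_def abs_le_iff)
      have Mx: "exp (R * x) * exp (a * (R * x)) = exp (M * x)" by (simp add: M_def exp_add[symmetric] algebra_simps)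
      have "exp (v (Suc n)) * g (next_field n v) \<le> exp (R * x) * (exp (a * (R * x)) * g \<eta>)"
        using v1 g1 gpos[OF next_field_fields[OF v], of n] by (intro mult_mono) auto
      also have "\<dots> = exp (M * x) * g \<eta>" using Mx by (simp add: mult.assoc[symmetric])
      finally have up: "exp (v (Suc n)) * g (next_field n v) \<le> exp (M * x) * g \<eta>" .
      have "exp (- (R * x)) * (exp (- (a * (R * x))) * g \<eta>) \<le> exp (v (Suc n)) * g (next_field n v)"
      proof (rule mult_mono)
        show "exp (- (R * x)) \<le> exp (v (Suc n))" using v1 by simp
        show "exp (- (a * (R * x))) * g \<eta> \<le> g (next_field n v)" using g2 by (simp add: exp_minus field_simps)
      qed (use gpos[OF eta_fields] in auto)
      moreover have "exp (- (R * x)) * (exp (- (a * (R * x))) * g \<eta>) = exp (- (M * x)) * g \<eta>"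
        using Mx by (simp add: exp_minus field_simps)
      ultimately have lo: "exp (- (M * x)) * g \<eta> \<le> exp (v (Suc n)) * g (next_field n v)" by simp
      have "1 - exp (- (M * x)) \<le> M * x" using exp_ge_add_one_self[of "- (M * x)"] by simp
      then have "(1 - exp (- (M * x))) * exp (M * x) \<le> M * x * exp (M * x)" by (intro mult_right_mono) auto
      also have "\<dots> \<le> M * x * exp M" using M x by (intro mult_left_mono) (auto simp: mult_left_le)
      finally have e1: "exp (M * x) - 1 \<le> M * x * exp M" by (simp add: left_diff_distrib exp_minus)
      have "1 - exp (- (M * x)) \<le> M * x * 1" using exp_ge_add_one_self[of "- (M * x)"] by simp
      also have "\<dots> \<le> M * x * exp M" using M x by (intro mult_left_mono) auto
      finally have e2: "1 - exp (- (M * x)) \<le> M * x * exp M" .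
      have "(exp (M * x) - 1) * g \<eta> \<le> c * x" "(1 - exp (- (M * x))) * g \<eta> \<le> c * x"
        using mult_right_mono[OF e1, of "g \<eta>"] mult_right_mono[OF e2, of "g \<eta>"] gpos[OF eta_fields] by (auto simp: c_def mult_ac)
      then show ?thesis using up lo unfolding x_def[symmetric] abs_le_iff by (simp add: algebra_simps)
    qed
    have geo: "summable (\<lambda>n. real (Suc n) * r ^ n)" using geometric_deriv_sums[of r] r by (simp add: sums_iff)
    then have geo': "summable (\<lambda>n. real (Suc n) * r ^ Suc n)" using summable_mult2[OF geo, of r] by (simp add: mult_ac)
    define S where "S = (\<Sum>n. real (Suc n) * r ^ Suc n)"
    define gb where "gb = exp (- (a * (2 * R))) * g (\<lambda>_. 0)"
    have gb: "gb > 0" "gb \<le> g v" if "v \<in> fields" for v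
      using loglip_lower[OF g(1) that] gpos[OF zero_fields] by (auto simp: gb_def)
    define C1 where "C1 = c * S / (Lam 0 * gb)"
    \<comment> \<open>The deviation \<open>c * r ^ Suc n\<close> produces the convergent series of
      \<open>n * r ^ n\<close>, so the error is linear in \<open>l\<close> even though
      \<open>K\<close> has infinite mean; relative to \<open>U l\<close> it vanishes.\<close>
    have bound: "\<bar>defect l v - U l * H v\<bar> \<le> C1 * l" if l: "l > 0" and v: "v \<in> fields" for l v
    proof -
      have l0: "l \<ge> 0" using l by simp
      have Lg: "Lam 0 * g v > 0" using g(2) gpos[OF v] by simp
      have "(\<lambda>n. wU l (Suc n)) sums U l" using wU_sums[OF l0] sums_Suc_iff[of "wU l" "U l"] by simp
      then have s1: "(\<lambda>n. wU l (Suc n) * g \<eta>) sums (U l * g \<eta>)" by (rule sums_mult2)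
      have s2: "(\<lambda>n. wU l (Suc n) * (exp (v (Suc n)) * g (next_field n v))) sums (defect l v * (Lam 0 * g v))"
        using defect_sums[OF l0 v] by (simp add: wU_def wt_def g_def mult_ac)
      have s3: "(\<lambda>n. wU l (Suc n) * (exp (v (Suc n)) * g (next_field n v) - g \<eta>)) sums (defect l v * (Lam 0 * g v) - U l * g \<eta>)"
        using sums_diff[OF s2 s1] by (simp add: right_diff_distrib)
      have "norm (defect l v * (Lam 0 * g v) - U l * g \<eta>) \<le> (\<Sum>n. l * c * (real (Suc n) * r ^ Suc n))"
        unfolding sums_unique[OF s3]
      proof (rule norm_suminf_le)
        fix n
        have "wU l (Suc n) \<le> l * (real (Suc n) * K (Suc n))" by (rule wU_le[OF l0])
        also have "\<dots> \<le> l * (real (Suc n) * 1)" using K_le_1 l0 by (intro mult_left_mono) auto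
        finally have "wU l (Suc n) \<le> l * real (Suc n)" by simp
        then have "\<bar>wU l (Suc n)\<bar> * \<bar>exp (v (Suc n)) * g (next_field n v) - g \<eta>\<bar> \<le> (l * real (Suc n)) * (c * r ^ Suc n)"
          using dev[OF v] wU_nonneg[OF l0] l0 by (intro mult_mono) auto
        then show "norm (wU l (Suc n) * (exp (v (Suc n)) * g (next_field n v) - g \<eta>)) \<le> l * c * (real (Suc n) * r ^ Suc n)"
          by (simp add: abs_mult mult_ac)
      qed (intro summable_mult geo')
      also have "\<dots> = l * c * S" unfolding S_def by (intro suminf_mult geo')
      finally have 1: "\<bar>defect l v * (Lam 0 * g v) - U l * g \<eta>\<bar> \<le> l * c * S" by simp
      have "defect l v - U l * H v = (defect l v * (Lam 0 * g v) - U l * g \<eta>) / (Lam 0 * g v)"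
        using g(2) gpos[OF v] by (simp add: H_def diff_divide_distrib)
      then have "\<bar>defect l v - U l * H v\<bar> = \<bar>defect l v * (Lam 0 * g v) - U l * g \<eta>\<bar> / (Lam 0 * g v)"
        using Lg by (simp add: abs_divide)
      also have "\<dots> \<le> (l * c * S) / (Lam 0 * gb)"
        using 1 gb[OF v] g(2) by (intro frac_le) auto
      finally show ?thesis by (simp add: C1_def mult_ac)
    qed
    fix \<epsilon> :: real assume \<epsilon>: "\<epsilon> > 0"
    have "eventually (\<lambda>l. (\<bar>C1\<bar> + 1) / \<epsilon> \<le> U l / l) (at_right 0)"
      using linear_o_U[OF ns] by (simp add: filterlim_at_top)
    then show "eventually (\<lambda>l. \<forall>v\<in>fields. \<bar>defect l v - U l * H v\<bar> \<le> \<epsilon> * U l) (at_right 0)"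
      using eventually_at_right_less[of "0::real"]
    proof eventually_elim
      case (elim l)
      have "C1 * l \<le> (\<bar>C1\<bar> + 1) * l" using elim by (intro mult_right_mono) auto
      also have "\<dots> \<le> \<epsilon> * U l" using elim \<epsilon> by (simp add: field_simps)
      finally show ?case using bound[OF elim(2)] by force
    qed
  qed
qed

text \<open>Here \<open>H v\<close> is the mean jump length from the field \<open>v\<close> under
  the law normalised by the eigenfunction. The quotients \<open>(1 - exp (- l * n)) / l\<close> tend
  to n and are dominated by n, so the finite mean permits passing to the limit under the
  sum.\<close>

lemma gap_finite_mean:
  assumes sm: "summable (\<lambda>n. real n * K n)"
  shows "\<exists>m>0. ((\<lambda>l. gap l / l) \<longlongrightarrow> m) (at_right 0)"
proof -
  define g where "g = eig 0"
  have g: "loglip a g" "Lam 0 > 0" using eig[of 0] by (auto simp: g_def)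
  have gpos: "g v > 0" if "v \<in> fields" for v using loglip_pos[OF g(1) that] .
  have sm': "summable (\<lambda>n. real (Suc n) * K (Suc n))" using sm by (subst summable_Suc_iff)
  define gB where "gB = exp (a * (2 * R)) * g (\<lambda>_. 0)"
  define gb where "gb = exp (- (a * (2 * R))) * g (\<lambda>_. 0)"
  have gb: "gb > 0" "gb \<le> g v" "g v \<le> gB" "gB > 0" if "v \<in> fields" for v
    using loglip_lower[OF g(1) that] loglip_bdd[OF g(1) that] gpos[OF zero_fields] by (auto simp: gb_def gB_def)
  define h where "h v n = wt 0 v n * g (next_field n v) * real (Suc n)" for v n
  have hw: "0 < wt 0 v n * g (next_field n v)" "wt 0 v n * g (next_field n v) \<le> exp R * gB * K (Suc n)" if v: "v \<in> fields" for v n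
  proof -
    show "0 < wt 0 v n * g (next_field n v)" using wt_pos gpos[OF next_field_fields[OF v]] by simp
    have "wt 0 v n * g (next_field n v) \<le> (exp R * K (Suc n)) * gB"
      using wt_le[OF v order_refl, of n] gb(3)[OF next_field_fields[OF v], of n] gpos[OF next_field_fields[OF v], of n] K_nonneg[of n]
      by (intro mult_mono) auto
    then show "wt 0 v n * g (next_field n v) \<le> exp R * gB * K (Suc n)" by (simp add: mult_ac)
  qed
  have sh: "summable (h v)" if v: "v \<in> fields" for v
  proof (rule summable_comparison_test'[OF summable_mult[OF sm', of "exp R * gB"]])
    show "norm (h v n) \<le> exp R * gB * (real (Suc n) * K (Suc n))" for n
      using mult_right_mono[OF hw(2)[OF v], of "real (Suc n)" n] hw(1)[OF v, of n] by (simp add: h_def mult_ac)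
  qed
  have hpos: "suminf (h v) > 0" if "v \<in> fields" for v
    using sh[OF that] hw(1)[OF that] by (intro suminf_pos) (auto simp: h_def)
  define H where "H v = suminf (h v) / (Lam 0 * g v)" for v
  show ?thesis
  proof (rule gap_perturbation[of "2 * a" H "\<lambda>l. l"])
    \<comment> \<open>One \<open>a\<close> comes from the series in the numerator, the other from
      the eigenfunction in the denominator.\<close>
    show "loglip (2 * a) H"
      unfolding loglip_def
    proof (intro conjI ballI allI impI)
      show "H v > 0" if "v \<in> fields" for v using gpos[OF that] hpos[OF that] g(2) by (simp add: H_def)
      fix u v e assume *: "u \<in> fields" "v \<in> fields" "0 \<le> (e::real)" "near e u v"
      have "suminf (h u) \<le> (\<Sum>n. exp (a * e) * h v n)"
      proof (rule suminf_le)
        show "h u n \<le> exp (a * e) * h v n" for n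
          using mult_right_mono[OF wt_loglip[OF *(4,3) g(1) *(1,2)], of "real (Suc n)"] by (simp add: h_def mult.assoc)
      qed (use sh * in \<open>auto intro: summable_mult\<close>)
      also have "\<dots> = exp (a * e) * suminf (h v)" using sh[OF *(2)] by (rule suminf_mult)
      finally have 1: "suminf (h u) \<le> exp (a * e) * suminf (h v)" .
      have 2: "g v \<le> exp (a * e) * g u" using loglipD[OF g(1) *(2,1,3) near_sym[OF *(4)]] .
      have "suminf (h u) * (Lam 0 * g v) \<le> (exp (a * e) * suminf (h v)) * (Lam 0 * (exp (a * e) * g u))"
        using 1 2 g(2) hpos[OF *(2)] gpos[OF *(2)] by (intro mult_mono mult_left_mono) auto
      also have "\<dots> = exp (2 * a * e) * suminf (h v) * (Lam 0 * g u)"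
        using exp_add[of "a * e" "a * e"] by (simp add: algebra_simps)
      finally show "H u \<le> exp (2 * a * e) * H v"
        using gpos[OF *(1)] gpos[OF *(2)] g(2) by (simp add: H_def divide_simps mult_ac)
    qed
    show "2 * a > 0" using a_pos by simp
    show "eventually (\<lambda>l::real. l > 0) (at_right 0)" by (rule eventually_at_right_less)
    show "((\<lambda>l::real. l) \<longlongrightarrow> 0) (at_right 0)" by (rule tendsto_ident_at)
    \<comment> \<open>Shortfall of the difference quotient weighted by \<open>K\<close>. It does not
      involve the field, which makes the resulting bound uniform.\<close>
    define q where "q l n = K (Suc n) * (real (Suc n) - (1 - exp (- l * real (Suc n))) / l)" for l n
    have q: "0 \<le> q l n" "q l n \<le> real (Suc n) * K (Suc n)" if "l > 0" for l n
    proof -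
      have "1 - exp (- l * real (Suc n)) \<le> real (Suc n) * l" using exp_ge_add_one_self[of "- l * real (Suc n)"] by (simp add: mult.commute)
      then have "(1 - exp (- l * real (Suc n))) / l \<le> real (Suc n)" using that by (simp add: pos_divide_le_eq)
      moreover have "0 \<le> (1 - exp (- l * real (Suc n))) / l" using that by simp
      ultimately have "0 \<le> real (Suc n) - (1 - exp (- l * real (Suc n))) / l" "real (Suc n) - (1 - exp (- l * real (Suc n))) / l \<le> real (Suc n)" by linarith+
      then show "0 \<le> q l n" "q l n \<le> real (Suc n) * K (Suc n)"
        unfolding q_def mult.commute[of "real (Suc n)" "K (Suc n)"] using K_nonneg[of n] by (auto intro: mult_left_mono mult_nonneg_nonneg)
    qed
    have qlim: "((\<lambda>l. \<Sum>n. q l n) \<longlongrightarrow> 0) (at_right 0)"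
    proof (rule tannery_at_right[OF sm'])
      show "\<bar>q l n\<bar> \<le> real (Suc n) * K (Suc n)" if "l > 0" for l n using q[OF that, of n] by simp
      fix n
      have "((\<lambda>l. 1 - exp (- l * real (Suc n))) has_real_derivative real (Suc n)) (at 0)"
        by (auto intro!: derivative_eq_intros)
      then have "((\<lambda>l. (1 - exp (- l * real (Suc n))) / l) \<longlongrightarrow> real (Suc n)) (at 0)" by (simp add: DERIV_def)
      then have "((\<lambda>l. (1 - exp (- l * real (Suc n))) / l) \<longlongrightarrow> real (Suc n)) (at_right 0)" by (simp only: filterlim_at_split)
      then have "((\<lambda>l. q l n) \<longlongrightarrow> K (Suc n) * (real (Suc n) - real (Suc n))) (at_right 0)"
        unfolding q_def by (intro tendsto_intros)
      then show "((\<lambda>l. q l n) \<longlongrightarrow> 0) (at_right 0)" by simp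
    qed
    define C1 where "C1 = exp R * gB / (Lam 0 * gb)"
    have C1: "C1 > 0" using gb[OF zero_fields] g(2) by (simp add: C1_def)
    have bound: "\<bar>defect l v - l * H v\<bar> \<le> C1 * (\<Sum>n. q l n) * l" if l: "l > 0" and v: "v \<in> fields" for l v
    proof -
      have l0: "l \<ge> 0" using l by simp
      have Lg: "Lam 0 * g v > 0" using g(2) gpos[OF v] by simp
      have sq: "summable (q l)" by (rule summable_comparison_test'[OF sm', of 0]) (use q[OF l] in auto)
      have s1: "(\<lambda>n. l * h v n) sums (l * suminf (h v))" by (intro sums_mult summable_sums sh v)
      have s2: "(\<lambda>n. wt 0 v n * (1 - exp (- l * real (Suc n))) * g (next_field n v)) sums (defect l v * (Lam 0 * g v))"
        using defect_sums[OF l0 v] by (simp add: g_def)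
      have s3: "(\<lambda>n. wt 0 v n * (1 - exp (- l * real (Suc n))) * g (next_field n v) - l * h v n) sums (defect l v * (Lam 0 * g v) - l * suminf (h v))"
        by (rule sums_diff[OF s2 s1])
      have "norm (defect l v * (Lam 0 * g v) - l * suminf (h v)) \<le> (\<Sum>n. exp R * gB * l * q l n)"
        unfolding sums_unique[OF s3]
      proof (rule norm_suminf_le)
        fix n
        define y where "y = l * real (Suc n) - (1 - exp (- l * real (Suc n)))"
        have y: "y \<ge> 0" unfolding y_def using exp_ge_add_one_self[of "- l * real (Suc n)"] by simp
        have yq: "K (Suc n) * y = l * q l n" using l by (simp add: y_def q_def field_simps)
        have "wt 0 v n * (1 - exp (- l * real (Suc n))) * g (next_field n v) - l * h v n = - (wt 0 v n * g (next_field n v) * y)"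
          by (simp add: h_def y_def algebra_simps)
        then have "norm (wt 0 v n * (1 - exp (- l * real (Suc n))) * g (next_field n v) - l * h v n) = wt 0 v n * g (next_field n v) * y"
          using mult_nonneg_nonneg[OF less_imp_le[OF hw(1)[OF v, of n]] y] by simp
        also have "\<dots> \<le> exp R * gB * K (Suc n) * y" using hw(2)[OF v] y by (rule mult_right_mono)
        also have "\<dots> = exp R * gB * l * q l n" using yq by (simp add: mult.assoc)
        finally show "norm (wt 0 v n * (1 - exp (- l * real (Suc n))) * g (next_field n v) - l * h v n) \<le> exp R * gB * l * q l n" .
      qed (intro summable_mult sq)
      also have "\<dots> = exp R * gB * l * suminf (q l)" by (rule suminf_mult[OF sq])
      finally have 1: "\<bar>defect l v * (Lam 0 * g v) - l * suminf (h v)\<bar> \<le> exp R * gB * l * suminf (q l)" by simp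
      have "defect l v - l * H v = (defect l v * (Lam 0 * g v) - l * suminf (h v)) / (Lam 0 * g v)"
        using g(2) gpos[OF v] by (simp add: H_def diff_divide_distrib)
      then have "\<bar>defect l v - l * H v\<bar> = \<bar>defect l v * (Lam 0 * g v) - l * suminf (h v)\<bar> / (Lam 0 * g v)"
        using Lg by (simp add: abs_divide)
      also have "\<dots> \<le> (exp R * gB * l * suminf (q l)) / (Lam 0 * gb)"
        using 1 gb[OF v] g(2) by (intro frac_le) auto
      finally show ?thesis by (simp add: C1_def mult_ac)
    qed
    fix \<epsilon> :: real assume \<epsilon>: "\<epsilon> > 0"
    have "eventually (\<lambda>l. (\<Sum>n. q l n) < \<epsilon> / C1) (at_right 0)" by (rule order_tendstoD(2)[OF qlim]) (use \<epsilon> C1 in simp)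
    then show "eventually (\<lambda>l. \<forall>v\<in>fields. \<bar>defect l v - l * H v\<bar> \<le> \<epsilon> * l) (at_right 0)"
      using eventually_at_right_less[of "0::real"]
    proof eventually_elim
      case (elim l)
      have "C1 * (\<Sum>n. q l n) \<le> \<epsilon>" using elim C1 by (simp add: field_simps)
      then have "C1 * (\<Sum>n. q l n) * l \<le> \<epsilon> * l" using elim by (intro mult_right_mono) auto
      then show ?case using bound[OF elim(2)] by force
    qed
  qed
qed

section \<open>Inverting the asymptotics of \<open>gap\<close> at 0\<close>

lemma rate_pos:
  assumes "(gap \<longlongrightarrow> 0) (at_right 0)" "\<delta> > 0"
  shows "rate \<delta> > 0"
proof -
  have "eventually (\<lambda>l. gap l < \<delta> \<and> 0 < l) (at_right 0)"
    using order_tendstoD(2)[OF assms] eventually_at_right_less[of "0::real"] by (rule eventually_conj)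
  then obtain l where "gap l < \<delta>" "0 < l" using eventually_happens'[OF trivial_limit_at_right_real] by blast
  then show ?thesis using gap_above[of \<delta> l] by linarith
qed

lemma rate_filterlim:
  assumes "(gap \<longlongrightarrow> 0) (at_right 0)"
  shows "filterlim rate (at_right 0) (at_right 0)"
  unfolding filterlim_at
proof
  show "(rate \<longlongrightarrow> 0) (at_right 0)"
  proof (rule tendsto_sandwich[OF _ _ tendsto_const tendsto_ident_at])
    show "eventually (\<lambda>\<delta>. 0 \<le> rate \<delta>) (at_right 0)" by (simp add: rate_nonneg)
    show "eventually (\<lambda>\<delta>. rate \<delta> \<le> \<delta>) (at_right 0)"
      using eventually_at_right_less[of "0::real"] by eventually_elim (rule rate_le_self, simp)
  qed
  show "eventually (\<lambda>\<delta>. rate \<delta> \<in> {0<..} \<and> rate \<delta> \<noteq> 0) (at_right 0)"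
    using eventually_at_right_less[of "0::real"] by eventually_elim (use rate_pos[OF assms] in force)
qed

text \<open>For \<open>w\<close> slightly above \<open>c powr (1 / \<alpha>)\<close>,
  \<open>gap\<close> grows by more than the factor \<open>c\<close> from
  \<open>s * rate \<delta>\<close> to \<open>w * (s * rate \<delta>) = y * rate \<delta>\<close>. As
  \<open>s > 1\<close>, the first point lies strictly above \<open>rate \<delta>\<close>, where
  \<open>gap\<close> is at least \<open>\<delta>\<close>.\<close>

lemma rate_ratio_upper:
  assumes g0: "(gap \<longlongrightarrow> 0) (at_right 0)" and \<alpha>: "\<alpha> > 0"
    and ratio: "\<And>c. c > 0 \<Longrightarrow> ((\<lambda>l. gap (c * l) / gap l) \<longlongrightarrow> c powr \<alpha>) (at_right 0)"
    and c: "c > 0" and y: "c powr (1 / \<alpha>) < y"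
  shows "eventually (\<lambda>\<delta>. rate (c * \<delta>) \<le> y * rate \<delta>) (at_right 0)"
proof -
  define z where "z = c powr (1 / \<alpha>)"
  have z: "z > 0" "z < y" "z powr \<alpha> = c" using c y \<alpha> by (auto simp: z_def powr_powr)
  obtain w where w: "z < w" "w < y" using dense z(2) by blast
  define s where "s = y / w"
  have s: "s > 1" "y / s = w" "s > 0" using w z by (auto simp: s_def)
  have "c < w powr \<alpha>" using z w \<alpha> powr_less_mono2[of \<alpha> z w] by simp
  then have "eventually (\<lambda>l. c < gap (w * l) / gap l) (at_right 0)"
    using order_tendstoD(1)[OF ratio[of w]] w z by simp
  moreover have "filterlim (\<lambda>\<delta>. s * rate \<delta>) (at_right 0) (at_right 0)"
    using filterlim_compose[OF filterlim_at_right_mult[OF s(3)] rate_filterlim[OF g0]] .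
  ultimately have "eventually (\<lambda>\<delta>. c < gap (w * (s * rate \<delta>)) / gap (s * rate \<delta>)) (at_right 0)"
    by (rule eventually_compose_filterlim)
  then show ?thesis using eventually_at_right_less[of "0::real"]
  proof eventually_elim
    case (elim \<delta>)
    have rp: "rate \<delta> > 0" using rate_pos[OF g0] elim by simp
    then have "rate \<delta> < s * rate \<delta>" using s by simp
    then have 1: "\<delta> \<le> gap (s * rate \<delta>)" by (rule gap_above)
    then have "c * \<delta> \<le> c * gap (s * rate \<delta>)" using c by simp
    also have "\<dots> \<le> gap (w * (s * rate \<delta>))" using elim 1 by (simp add: field_simps)
    also have "w * (s * rate \<delta>) = y * rate \<delta>" using w z by (simp add: s_def)
    finally show ?case using rp w z by (intro rate_le) auto
  qed
qed

theorem rate_ratio: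
  assumes g0: "(gap \<longlongrightarrow> 0) (at_right 0)" and \<alpha>: "\<alpha> > 0"
    and ratio: "\<And>c. c > 0 \<Longrightarrow> ((\<lambda>l. gap (c * l) / gap l) \<longlongrightarrow> c powr \<alpha>) (at_right 0)"
    and c: "c > 0"
  shows "((\<lambda>\<delta>. rate (c * \<delta>) / rate \<delta>) \<longlongrightarrow> c powr (1 / \<alpha>)) (at_right 0)"
proof (rule order_tendstoI)
  fix y assume "c powr (1 / \<alpha>) < y"
  then obtain z where z: "c powr (1 / \<alpha>) < z" "z < y" using dense by blast
  have upper: "eventually (\<lambda>\<delta>. rate (c * \<delta>) \<le> z * rate \<delta>) (at_right 0)"
    using ratio by (rule rate_ratio_upper[OF g0 \<alpha> _ c z(1)])
  show "eventually (\<lambda>\<delta>. rate (c * \<delta>) / rate \<delta> < y) (at_right 0)"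
    using upper eventually_at_right_less[of "0::real"]
  proof eventually_elim
    case (elim \<delta>)
    then have "rate (c * \<delta>) / rate \<delta> \<le> z" using rate_pos[OF g0, of \<delta>] by (simp add: pos_divide_le_eq)
    then show ?case using z by simp
  qed
next
  fix y assume y: "y < c powr (1 / \<alpha>)"
  define x where "x = max y (c powr (1 / \<alpha>) / 2)"
  have x: "0 < x" "y \<le> x" "x < c powr (1 / \<alpha>)" using y c by (auto simp: x_def less_max_iff_disj)
  obtain z where z: "x < z" "z < c powr (1 / \<alpha>)" using dense x(3) by blast
  \<comment> \<open>The lower bound is the upper bound for the dilation \<open>1 / c\<close>, read
    at \<open>c * \<delta>\<close>.\<close>
  have "(1 / c) powr (1 / \<alpha>) < 1 / z" using z x c by (simp add: powr_divide frac_less2)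
  then have "eventually (\<lambda>\<delta>. rate (1 / c * \<delta>) \<le> 1 / z * rate \<delta>) (at_right 0)"
    using c by (intro rate_ratio_upper[OF g0 \<alpha> ratio]) auto
  then have "eventually (\<lambda>\<delta>. rate (1 / c * (c * \<delta>)) \<le> 1 / z * rate (c * \<delta>)) (at_right 0)"
    by (rule eventually_compose_filterlim[OF _ filterlim_at_right_mult[OF c]])
  then show "eventually (\<lambda>\<delta>. y < rate (c * \<delta>) / rate \<delta>) (at_right 0)"
    using eventually_at_right_less[of "0::real"]
  proof eventually_elim
    case (elim \<delta>)
    then have "z * rate \<delta> \<le> rate (c * \<delta>)" using c x z by (simp add: field_simps)
    then have "z \<le> rate (c * \<delta>) / rate \<delta>" using rate_pos[OF g0, of \<delta>] elim by (simp add: pos_le_divide_eq)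
    then show ?case using x z by simp
  qed
qed

lemma rate_linear:
  assumes m: "m > 0" and lim: "((\<lambda>l. gap l / l) \<longlongrightarrow> m) (at_right 0)"
  shows "((\<lambda>\<delta>. rate \<delta> / \<delta>) \<longlongrightarrow> 1 / m) (at_right 0)"
proof (rule order_tendstoI)
  fix y assume y: "1 / m < y"
  then obtain z where z: "1 / m < z" "z < y" using dense by blast
  have zp: "z > 0" using z m by (meson less_trans zero_less_divide_1_iff)
  have "1 / z < m" using z zp m by (simp add: field_simps)
  then have "eventually (\<lambda>l. 1 / z < gap l / l) (at_right 0)" by (rule order_tendstoD(1)[OF lim])
  then have "eventually (\<lambda>\<delta>. 1 / z < gap (z * \<delta>) / (z * \<delta>)) (at_right 0)"
    by (rule eventually_compose_filterlim[OF _ filterlim_at_right_mult[OF zp]])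
  then show "eventually (\<lambda>\<delta>. rate \<delta> / \<delta> < y) (at_right 0)"
    using eventually_at_right_less[of "0::real"]
  proof eventually_elim
    case (elim \<delta>)
    then have "\<delta> \<le> gap (z * \<delta>)" using zp by (simp add: field_simps)
    then have "rate \<delta> \<le> z * \<delta>" using zp elim by (intro rate_le) auto
    then have "rate \<delta> / \<delta> \<le> z" using elim by (simp add: pos_divide_le_eq)
    then show ?case using z by simp
  qed
next
  fix y assume y: "y < 1 / m"
  define x where "x = max y (1 / m / 2)"
  have x: "0 < x" "y \<le> x" "x < 1 / m" using y m by (auto simp: x_def field_simps less_max_iff_disj)
  obtain z where z: "x < z" "z < 1 / m" using dense x(3) by blast
  have zp: "z > 0" using x z by simp
  have "m < 1 / z" using z zp m by (simp add: field_simps)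
  then have "eventually (\<lambda>l. gap l / l < 1 / z) (at_right 0)" by (rule order_tendstoD(2)[OF lim])
  then have "eventually (\<lambda>\<delta>. gap (z * \<delta>) / (z * \<delta>) < 1 / z) (at_right 0)"
    by (rule eventually_compose_filterlim[OF _ filterlim_at_right_mult[OF zp]])
  then show "eventually (\<lambda>\<delta>. y < rate \<delta> / \<delta>) (at_right 0)"
    using eventually_at_right_less[of "0::real"]
  proof eventually_elim
    case (elim \<delta>)
    then have "gap (z * \<delta>) < \<delta>" using zp by (simp add: field_simps)
    then have "z * \<delta> \<le> rate \<delta>" using gap_above[of \<delta> "z * \<delta>"] by linarith
    then have "z \<le> rate \<delta> / \<delta>" using elim by (simp add: pos_le_divide_eq)
    then show ?case using x z by simp
  qed
qed

lemma rate_sublinear: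
  assumes lim: "filterlim (\<lambda>l. gap l / l) at_top (at_right 0)"
  shows "((\<lambda>\<delta>. rate \<delta> / \<delta>) \<longlongrightarrow> 0) (at_right 0)"
proof (rule order_tendstoI)
  fix y :: real assume y: "0 < y"
  have "eventually (\<lambda>l. 2 / y \<le> gap l / l) (at_right 0)" using lim by (simp add: filterlim_at_top)
  then have "eventually (\<lambda>\<delta>. 2 / y \<le> gap (y / 2 * \<delta>) / (y / 2 * \<delta>)) (at_right 0)"
    by (rule eventually_compose_filterlim[OF _ filterlim_at_right_mult]) (use y in simp)
  then show "eventually (\<lambda>\<delta>. rate \<delta> / \<delta> < y) (at_right 0)"
    using eventually_at_right_less[of "0::real"]
  proof eventually_elim
    case (elim \<delta>)
    then have "\<delta> \<le> gap (y / 2 * \<delta>)" using y by (simp add: field_simps)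
    then have "rate \<delta> \<le> y / 2 * \<delta>" using y elim by (intro rate_le) auto
    then have "rate \<delta> / \<delta> \<le> y / 2" using elim by (simp add: pos_divide_le_eq)
    then show ?case using y by linarith
  qed
next
  fix y :: real assume y: "y < 0"
  show "eventually (\<lambda>\<delta>. y < rate \<delta> / \<delta>) (at_right 0)"
    using eventually_at_right_less[of "0::real"]
  proof eventually_elim
    case (elim \<delta>)
    have "0 \<le> rate \<delta> / \<delta>" using elim rate_nonneg[of \<delta>] by simp
    then show ?case using y by simp
  qed
qed

lemma gap_tendsto_0:
  assumes "eventually (\<lambda>l. U l > 0) (at_right 0)" "(U \<longlongrightarrow> 0) (at_right 0)" "((\<lambda>l. gap l / U l) \<longlongrightarrow> m) (at_right 0)"
  shows "(gap \<longlongrightarrow> 0) (at_right 0)"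
proof -
  have "((\<lambda>l. gap l / U l * U l) \<longlongrightarrow> m * 0) (at_right 0)" by (intro tendsto_mult assms)
  moreover have "eventually (\<lambda>l. gap l / U l * U l = gap l) (at_right 0)" using assms(1) by eventually_elim simp
  ultimately show ?thesis using Lim_transform_eventually by fastforce
qed

theorem rate_regularly_varying:
  assumes rv: "regvar_mass K \<alpha>" and ns: "\<not> summable (\<lambda>n. real n * K n)" and \<alpha>: "\<alpha> > 0"
  shows "(gap \<longlongrightarrow> 0) (at_right 0)" "filterlim (\<lambda>l. gap l / l) at_top (at_right 0)"
    "\<And>c. c > 0 \<Longrightarrow> ((\<lambda>\<delta>. rate (c * \<delta>) / rate \<delta>) \<longlongrightarrow> c powr (1 / \<alpha>)) (at_right 0)"
proof -
  interpret regvar_mass K \<alpha> by fact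
  obtain m where m: "m > 0" "((\<lambda>l. gap l / U l) \<longlongrightarrow> m) (at_right 0)" using gap_infinite_mean[OF rv ns] by blast
  have Up: "eventually (\<lambda>l. U l > 0) (at_right 0)"
    using eventually_at_right_less[of "0::real"] by eventually_elim (rule U_pos)
  show g0: "(gap \<longlongrightarrow> 0) (at_right 0)" using gap_tendsto_0[OF Up U_tendsto_0 m(2)] .
  have 1: "filterlim (\<lambda>l. gap l / U l * (U l / l)) at_top (at_right 0)"
    by (rule filterlim_tendsto_pos_mult_at_top[OF m(2,1) linear_o_U[OF ns]])
  have "eventually (\<lambda>l. gap l / U l * (U l / l) = gap l / l) (at_right 0)" using Up by eventually_elim simp
  from iffD1[OF filterlim_cong[OF refl refl this] 1] show "filterlim (\<lambda>l. gap l / l) at_top (at_right 0)" .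
  have ratio: "((\<lambda>l. gap (c * l) / gap l) \<longlongrightarrow> c powr \<alpha>) (at_right 0)" if c: "c > 0" for c
  proof -
    have A: "((\<lambda>l. gap (c * l) / U (c * l)) \<longlongrightarrow> m) (at_right 0)" by (rule filterlim_compose[OF m(2) filterlim_at_right_mult[OF c]])
    have "((\<lambda>l. gap (c * l) / U (c * l) * (U (c * l) / U l) / (gap l / U l)) \<longlongrightarrow> m * c powr \<alpha> / m) (at_right 0)"
      by (rule tendsto_divide[OF tendsto_mult[OF A U_ratio[OF ns c \<alpha>]] m(2)]) (use m(1) in simp)
    then have B: "((\<lambda>l. gap (c * l) / U (c * l) * (U (c * l) / U l) / (gap l / U l)) \<longlongrightarrow> c powr \<alpha>) (at_right 0)"
      using m(1) by simp
    have "eventually (\<lambda>l. gap (c * l) / U (c * l) * (U (c * l) / U l) / (gap l / U l) = gap (c * l) / gap l) (at_right 0)"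
      using eventually_at_right_less[of "0::real"]
    proof eventually_elim
      case (elim l)
      have "U l > 0" "U (c * l) > 0" using elim c by (auto intro!: U_pos)
      then show ?case by simp
    qed
    with B show ?thesis by (rule Lim_transform_eventually)
  qed
  show "((\<lambda>\<delta>. rate (c * \<delta>) / rate \<delta>) \<longlongrightarrow> c powr (1 / \<alpha>)) (at_right 0)" if "c > 0" for c
    by (rule rate_ratio[OF g0 \<alpha> ratio that])
qed

lemma slowly_varying_rate:
  assumes g0: "(gap \<longlongrightarrow> 0) (at_right 0)" and p: "p > 0"
    and ratio: "\<And>c. c > 0 \<Longrightarrow> ((\<lambda>\<delta>. rate (c * \<delta>) / rate \<delta>) \<longlongrightarrow> c powr p) (at_right 0)"
  shows "slowly_varying (\<lambda>x. rate (1 / x) * x powr p)"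
  unfolding slowly_varying_def
proof (intro conjI allI impI)
  \<comment> \<open>A generalised inverse is monotone, hence measurable.\<close>
  have [measurable]: "rate \<in> borel_measurable borel" by (intro borel_measurable_mono monoI rate_mono)
  show "set_borel_measurable borel {0<..} (\<lambda>x. rate (1 / x) * x powr p)"
    unfolding set_borel_measurable_def by measurable
  show "0 < rate (1 / x) * x powr p" if "x > 0" for x using rate_pos[OF g0, of "1 / x"] that by simp
  fix c :: real assume c: "c > 0"
  have "filterlim (\<lambda>x::real. 1 / x) (at_right 0) at_top"
    using filterlim_inverse_at_right_top by (simp add: divide_inverse)
  then have "((\<lambda>x. rate (1 / c * (1 / x)) / rate (1 / x)) \<longlongrightarrow> (1 / c) powr p) at_top"
    by (rule filterlim_compose[rotated]) (use ratio[of "1 / c"] c in simp)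
  then have "((\<lambda>x. rate (1 / c * (1 / x)) / rate (1 / x) * c powr p) \<longlongrightarrow> (1 / c) powr p * c powr p) at_top"
    by (rule tendsto_mult_right)
  moreover have "(1 / c) powr p * c powr p = 1" using c by (simp add: powr_divide)
  moreover have "eventually (\<lambda>x. rate (1 / c * (1 / x)) / rate (1 / x) * c powr p = rate (1 / (c * x)) * (c * x) powr p / (rate (1 / x) * x powr p)) at_top"
    using eventually_gt_at_top[of 0]
  proof eventually_elim
    case (elim x)
    then show ?case using c by (simp add: powr_mult)
  qed
  ultimately show "((\<lambda>x. rate (1 / (c * x)) * (c * x) powr p / (rate (1 / x) * x powr p)) \<longlongrightarrow> 1) at_top"
    using Lim_transform_eventually by fastforce
qed

end

section \<open>The annealed partition function as a sum over compositions\<close>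

lemma gaussian_law_facts:
  assumes "gaussian_law \<nu>"
  shows "integrable \<nu> (\<lambda>x. x)" "integrable \<nu> (\<lambda>x. x\<^sup>2)" "integrable \<nu> exp"
    "(\<integral>x. x \<partial>\<nu>) = 0 \<Longrightarrow> (\<integral>x. exp x \<partial>\<nu>) = exp ((\<integral>x. x\<^sup>2 \<partial>\<nu>) / 2)"
proof -
  consider (density) \<mu> \<sigma> where "\<sigma> > 0" "\<nu> = density lborel (\<lambda>x. ennreal (normal_density \<mu> \<sigma> x))"
    | (point) \<mu> where "\<nu> = return borel \<mu>"
    using assms by (auto simp: gaussian_law_def)
  then have *: "integrable \<nu> (\<lambda>x. x) \<and> integrable \<nu> (\<lambda>x. x\<^sup>2) \<and> integrable \<nu> exp \<and>
    ((\<integral>x. x \<partial>\<nu>) = 0 \<longrightarrow> (\<integral>x. exp x \<partial>\<nu>) = exp ((\<integral>x. x\<^sup>2 \<partial>\<nu>) / 2))"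
  proof cases
    case (density \<mu> \<sigma>)
    let ?d = "normal_density \<mu> \<sigma>"
    have i1: "integrable lborel (\<lambda>x. ?d x * x)" using integrable_normal_moment_nz_1[OF density(1)] .
    have "integrable lborel (\<lambda>x. ?d x * (x - \<mu>)\<^sup>2 + (2 * \<mu>) * (?d x * x) - \<mu>\<^sup>2 * ?d x)"
      using integrable_normal_moment[OF density(1), of \<mu> 2] i1 density(1)
      by (intro Bochner_Integration.integrable_diff Bochner_Integration.integrable_add integrable_mult_right integrable_normal_density) auto
    then have i2: "integrable lborel (\<lambda>x. ?d x * x\<^sup>2)" by (simp add: power2_eq_square algebra_simps)
    \<comment> \<open>Completing the square: tilting by \<open>exp\<close> moves the mean by the
      variance and leaves the exponential moment as a factor.\<close>
    have e: "?d x * exp x = exp (\<mu> + \<sigma>\<^sup>2 / 2) * normal_density (\<mu> + \<sigma>\<^sup>2) \<sigma> x" for x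
    proof -
      have "- (x - \<mu>)\<^sup>2 / (2 * \<sigma>\<^sup>2) + x = \<mu> + \<sigma>\<^sup>2 / 2 + - (x - (\<mu> + \<sigma>\<^sup>2))\<^sup>2 / (2 * \<sigma>\<^sup>2)"
      proof -
        define s where "s = \<sigma>\<^sup>2"
        have "s > 0" using density(1) by (simp add: s_def)
        then have "- (x - \<mu>)\<^sup>2 / (2 * s) + x = \<mu> + s / 2 + - (x - (\<mu> + s))\<^sup>2 / (2 * s)"
          by (simp add: field_simps power2_eq_square)
        then show ?thesis by (simp add: s_def)
      qed
      then show ?thesis unfolding normal_density_def by (simp add: exp_add[symmetric] mult.left_commute mult.assoc)
    qed
    have i3: "integrable lborel (\<lambda>x. ?d x * exp x)" unfolding e using density(1) by (intro integrable_mult_right integrable_normal_density)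
    have m0: "(\<integral>x. x \<partial>\<nu>) = \<mu>"
      unfolding density(2) by (subst integral_density) (use integral_normal_moment_nz_1[OF density(1)] in auto)
    have m3: "(\<integral>x. exp x \<partial>\<nu>) = exp (\<mu> + \<sigma>\<^sup>2 / 2)"
      unfolding density(2) by (subst integral_density) (use density(1) in \<open>auto simp: e\<close>)
    have m2: "(\<integral>x. x\<^sup>2 \<partial>\<nu>) = \<sigma>\<^sup>2" if "\<mu> = 0"
      unfolding density(2) by (subst integral_density) (use integral_normal_moment_even[OF density(1), of 0 1] that in \<open>auto simp: fact_numeral\<close>)
    show ?thesis
      unfolding m0 m3 using i1 i2 i3 m2 by (auto simp: density(2) integrable_density)
  next
    case (point \<mu>)
    have "integrable \<nu> f" "(\<integral>x. f x \<partial>\<nu>) = f \<mu>" if "f \<in> borel_measurable borel" for f :: "real \<Rightarrow> real"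
    proof -
      interpret prob_space "return borel \<mu>" by (rule prob_space_return) simp
      show "integrable \<nu> f" unfolding point using that
        by (intro integrable_const_bound[of _ "\<bar>f \<mu>\<bar>"]) (auto simp: AE_return)
      show "(\<integral>x. f x \<partial>\<nu>) = f \<mu>" unfolding point using that by (intro integral_return) auto
    qed
    note r = this
    have "integrable \<nu> (\<lambda>x. x)" "integrable \<nu> (\<lambda>x. x\<^sup>2)" "integrable \<nu> exp"
      by (rule r(1); measurable)+
    moreover have "(\<integral>x. x \<partial>\<nu>) = \<mu>" "(\<integral>x. exp x \<partial>\<nu>) = exp \<mu>" "(\<integral>x. x\<^sup>2 \<partial>\<nu>) = \<mu>\<^sup>2"
      by (rule r(2); measurable)+
    ultimately show ?thesis by simp
  qed
  show "integrable \<nu> (\<lambda>x. x)" using * by (elim conjE)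
  show "integrable \<nu> (\<lambda>x. x\<^sup>2)" using * by (elim conjE)
  show "integrable \<nu> exp" using * by (elim conjE)
  show "(\<integral>x. exp x \<partial>\<nu>) = exp ((\<integral>x. x\<^sup>2 \<partial>\<nu>) / 2)" if "(\<integral>x. x \<partial>\<nu>) = 0"
    using * that by (elim conjE mp)
qed

section \<open>Compositions, contact points and interaction energy\<close>

definition compositions :: "nat \<Rightarrow> nat list set" where
  "compositions n = {ts. sum_list ts = n \<and> 0 \<notin> set ts}"

fun points :: "nat list \<Rightarrow> nat list" where
  "points [] = []"
| "points (t # ts) = t # map ((+) t) (points ts)"

lemma finite_compositions: "finite (compositions n)"
proof (rule finite_subset[OF _ finite_lists_length_le[of "{..n}" n]])
  have "length ts \<le> sum_list ts" if "0 \<notin> set ts" for ts :: "nat list"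
    using that by (induction ts) auto
  then show "compositions n \<subseteq> {xs. set xs \<subseteq> {..n} \<and> length xs \<le> n}"
    by (auto simp: compositions_def member_le_sum_list)
qed simp

lemma compositions_0: "compositions 0 = {[]}"
  by (auto simp: compositions_def) (metis list.set_intros(1) neq_Nil_conv)

lemma compositions_Suc:
  "compositions (Suc n) = (\<Union>i\<le>n. (#) (Suc i) ` compositions (n - i))"
proof (intro equalityI subsetI)
  fix ts assume ts: "ts \<in> compositions (Suc n)"
  then obtain t us where tu: "ts = t # us" by (cases ts) (auto simp: compositions_def)
  then have "t \<noteq> 0" using ts by (auto simp: compositions_def)
  then obtain i where "t = Suc i" by (cases t) auto
  then have "us \<in> compositions (n - i)" "i \<le> n" using ts tu by (auto simp: compositions_def)
  then show "ts \<in> (\<Union>i\<le>n. (#) (Suc i) ` compositions (n - i))" using tu \<open>t = Suc i\<close> by blast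
qed (auto simp: compositions_def)

lemma sum_compositions_Suc:
  fixes f :: "nat list \<Rightarrow> real"
  shows "(\<Sum>ts\<in>compositions (Suc n). f ts) = (\<Sum>i\<le>n. \<Sum>ts\<in>compositions (n - i). f (Suc i # ts))"
proof -
  have "(\<Sum>ts\<in>compositions (Suc n). f ts) = (\<Sum>i\<le>n. \<Sum>ts\<in>(#) (Suc i) ` compositions (n - i). f ts)"
    unfolding compositions_Suc by (intro sum.UNION_disjoint) (auto simp: finite_compositions)
  also have "\<dots> = (\<Sum>i\<le>n. \<Sum>ts\<in>compositions (n - i). f (Suc i # ts))"
    by (intro sum.cong refl sum.reindex[THEN trans]) (auto simp: inj_on_def)
  finally show ?thesis .
qed

text \<open>The energy of the pair interaction \<open>\<eta>\<close> between the partial sums of \<open>ts\<close> in the external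
  field \<open>v\<close>; the field felt beyond the first point already contains the interaction with that point.\<close>

fun energy :: "(nat \<Rightarrow> real) \<Rightarrow> (nat \<Rightarrow> real) \<Rightarrow> nat list \<Rightarrow> real" where
  "energy \<eta> v [] = 0"
| "energy \<eta> v (t # ts) = v t + energy \<eta> (\<lambda>s. v (t + s) + \<eta> s) ts"

fun pair_sum :: "(nat \<Rightarrow> real) \<Rightarrow> nat list \<Rightarrow> real" where
  "pair_sum \<eta> [] = 0"
| "pair_sum \<eta> (p # ps) = (\<Sum>q\<leftarrow>ps. \<eta> (q - p)) + pair_sum \<eta> ps"

lemma pair_sum_shift: "pair_sum \<eta> (map ((+) t) ps) = pair_sum \<eta> ps"
  by (induction ps) (auto simp: comp_def)

text \<open>Each point adds \<open>\<eta>\<close> to the field seen from it, so every pair is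
  charged exactly once, at its right end. This is why the field carries the whole pair
  interaction.\<close>

lemma energy_eq: "energy \<eta> v ts = (\<Sum>p\<leftarrow>points ts. v p) + pair_sum \<eta> (points ts)"
  by (induction ts arbitrary: v) (auto simp: comp_def sum_list_addf pair_sum_shift)

lemma length_points [simp]: "length (points ts) = length ts" by (induction ts) auto

lemma points_sorted: "0 \<notin> set ts \<Longrightarrow> sorted_wrt (<) (points ts) \<and> (\<forall>p\<in>set (points ts). p > 0)"
  by (induction ts) (auto simp: sorted_wrt_map)

lemma set_points: "set (points ts) = (\<lambda>k. sum_list (take k ts)) ` {1..length ts}"
proof (induction ts)
  case (Cons t ts)
  have "{1..length (t # ts)} = insert 1 (Suc ` {1..length ts})"
    by (auto simp: image_Suc_atLeastAtMost)
  then have "(\<lambda>k. sum_list (take k (t # ts))) ` {1..length (t # ts)} = insert t ((\<lambda>k. t + sum_list (take k ts)) ` {1..length ts})"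
    by (simp only: image_insert image_image) simp
  then show ?case using Cons by (simp add: image_image)
qed simp

lemma (in pinning) Z_compositions:
  "Z h n v = (\<Sum>ts\<in>compositions n. prod_list (map K ts) * exp (h * real (length ts) + energy \<eta> v ts))"
proof (induction n arbitrary: v rule: less_induct)
  case (less n)
  show ?case
  proof (cases n)
    case 0 then show ?thesis by (simp add: compositions_0)
  next
    case (Suc m)
    have "Z h n v = (\<Sum>i\<le>m. exp h * K (Suc i) * exp (v (Suc i)) *
        (\<Sum>ts\<in>compositions (m - i). prod_list (map K ts) * exp (h * real (length ts) + energy \<eta> (next_field i v) ts)))"
      unfolding Suc Z_Suc by (intro sum.cong refl arg_cong2[where f = "(*)"] less) (auto simp: Suc)
    also have "\<dots> = (\<Sum>i\<le>m. \<Sum>ts\<in>compositions (m - i). prod_list (map K (Suc i # ts)) * exp (h * real (length (Suc i # ts)) + energy \<eta> v (Suc i # ts)))"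
      unfolding sum_distrib_left by (intro sum.cong refl) (simp add: next_field_def exp_add algebra_simps)
    finally show ?thesis unfolding Suc sum_compositions_Suc .
  qed
qed

section \<open>Integrating over the renewal process\<close>

locale pinning_disorder = P: prob_space P + Q: prob_space Q
  for P :: "'a measure" and T :: "nat \<Rightarrow> 'a \<Rightarrow> nat" and Q :: "'b measure" and \<omega> :: "nat \<Rightarrow> 'b \<Rightarrow> real" +
  assumes iid: "iid_interarrivals P T"
    and gaussian: "gaussian_sequence Q \<omega>"
    and stationary: "stationary_sequence Q \<omega>"
    and mean: "(\<integral>w. \<omega> 0 w \<partial>Q) = 0"
    and variance: "(\<integral>w. (\<omega> 0 w)\<^sup>2 \<partial>Q) = 1"
begin

definition trajectory :: "nat list \<Rightarrow> 'a set" where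
  "trajectory ts = {x \<in> space P. \<forall>i<length ts. T (Suc i) x = ts ! i}"

lemma indep: "P.indep_vars (\<lambda>_. count_space UNIV) T {1..}" using iid unfolding iid_interarrivals_def by blast
lemma T_measurable [measurable]: "i \<ge> 1 \<Longrightarrow> T i \<in> measurable P (count_space UNIV)"
  using indep unfolding P.indep_vars_def by auto
lemma T_pos: "i \<ge> 1 \<Longrightarrow> x \<in> space P \<Longrightarrow> T i x \<ge> 1" using iid unfolding iid_interarrivals_def by blast

lemma mass_eq: assumes "i \<ge> 1" shows "P.prob (T i -` {t} \<inter> space P) = interarrival_mass P T t"
proof -
  have "distr P (count_space UNIV) (T i) = distr P (count_space UNIV) (T 1)"
    using iid assms unfolding iid_interarrivals_def by blast
  then have "measure (distr P (count_space UNIV) (T i)) {t} = measure (distr P (count_space UNIV) (T 1)) {t}" by (rule arg_cong)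
  moreover have "{x \<in> space P. T 1 x = t} = T 1 -` {t} \<inter> space P" by auto
  ultimately show ?thesis
    using assms by (simp add: measure_distr interarrival_mass_def)
qed

lemma trajectory_eq: "trajectory ts = space P \<inter> (\<Inter>i\<in>{1..length ts}. T i -` {ts ! (i - 1)} \<inter> space P)"
proof -
  have "(\<forall>i<length ts. T (Suc i) x = ts ! i) \<longleftrightarrow> (\<forall>i\<in>{1..length ts}. T i x = ts ! (i - 1))" for x
  proof
    show "\<forall>i<length ts. T (Suc i) x = ts ! i" if *: "\<forall>i\<in>{1..length ts}. T i x = ts ! (i - 1)"
    proof (intro allI impI)
      fix i assume "i < length ts"
      then show "T (Suc i) x = ts ! i" using bspec[OF *, of "Suc i"] by simp
    qed
    show "\<forall>i\<in>{1..length ts}. T i x = ts ! (i - 1)" if *: "\<forall>i<length ts. T (Suc i) x = ts ! i"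
    proof
      fix i assume "i \<in> {1..length ts}"
      then show "T i x = ts ! (i - 1)" using spec[OF *, of "i - 1"] by (cases i) auto
    qed
  qed
  then show ?thesis by (auto simp: trajectory_def)
qed

lemma trajectory_sets [measurable]: "trajectory ts \<in> sets P"
proof (cases "length ts = 0")
  case False
  then have "(\<Inter>i\<in>{1..length ts}. T i -` {ts ! (i - 1)} \<inter> space P) \<in> sets P"
    by (intro sets.finite_INT measurable_sets[OF T_measurable]) (auto simp: Suc_le_eq)
  then show ?thesis unfolding trajectory_eq by (rule sets.Int[OF sets.top])
next
  case True
  then have "trajectory ts = space P" by (simp add: trajectory_def)
  then show ?thesis by simp
qed

lemma prob_trajectory: "P.prob (trajectory ts) = prod_list (map (interarrival_mass P T) ts)"
proof (cases "ts = []")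
  case True then show ?thesis by (simp add: trajectory_def P.prob_space)
next
  case False
  have "P.prob (trajectory ts) = P.prob (\<Inter>i\<in>{1..length ts}. T i -` {ts ! (i - 1)} \<inter> space P)"
    unfolding trajectory_eq using False by (intro arg_cong[where f = P.prob]) (cases ts; auto)
  also have "\<dots> = (\<Prod>i\<in>{1..length ts}. P.prob (T i -` {ts ! (i - 1)} \<inter> space P))"
    using False by (intro P.indep_varsD[OF indep]) (auto simp: Suc_le_eq)
  also have "\<dots> = (\<Prod>i\<in>{1..length ts}. interarrival_mass P T (ts ! (i - 1)))" by (intro prod.cong refl mass_eq) auto
  also have "\<dots> = (\<Prod>i<length ts. interarrival_mass P T (ts ! i))"
    by (rule prod.reindex_bij_witness[of _ Suc "\<lambda>i. i - 1"]) auto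
  also have "\<dots> = prod_list (map (interarrival_mass P T) ts)" by (simp add: prod.list_conv_set_nth atLeast0LessThan)
  finally show ?thesis .
qed

lemma trajectory_take:
  assumes "x \<in> trajectory ts" "k \<le> length ts"
  shows "sum_list (take k ts) = renewal_time T k x"
proof -
  have "sum_list (take k ts) = (\<Sum>i<k. ts ! i)" using assms(2) by (simp add: sum_list_sum_nth atLeast0LessThan)
  also have "\<dots> = (\<Sum>i<k. T (Suc i) x)" using assms by (intro sum.cong) (auto simp: trajectory_def)
  also have "\<dots> = renewal_time T k x" unfolding renewal_time_def
    by (rule sum.reindex_bij_witness[of _ "\<lambda>i. i - 1" Suc]) auto
  finally show ?thesis .
qed

lemma renewal_strict_mono: assumes "x \<in> space P" shows "strict_mono (\<lambda>k. renewal_time T k x)"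
proof (rule strict_monoI_Suc)
  show "renewal_time T k x < renewal_time T (Suc k) x" for k
    using T_pos[OF _ assms, of "Suc k"] by (simp add: renewal_time_def)
qed

lemma trajectory_renewal_set:
  assumes x: "x \<in> trajectory ts" and ts: "ts \<in> compositions n"
  shows "n \<in> renewal_set T x" "renewal_set T x \<inter> {1..n} = set (points ts)"
proof -
  have xs: "x \<in> space P" using x by (simp add: trajectory_def)
  note sm = strict_mono_less_eq[OF renewal_strict_mono[OF xs]]
  have n: "n = renewal_time T (length ts) x" using trajectory_take[OF x order_refl] ts by (simp add: compositions_def)
  then show "n \<in> renewal_set T x" by (auto simp: renewal_set_def)
  have "set (points ts) = (\<lambda>k. renewal_time T k x) ` {1..length ts}"
    unfolding set_points using trajectory_take[OF x] by (intro image_cong) auto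
  moreover have "renewal_time T k x \<in> {1..n} \<longleftrightarrow> k \<in> {1..length ts}" for k
  proof -
    have "renewal_time T k x \<le> n \<longleftrightarrow> k \<le> length ts" unfolding n using sm .
    moreover have "1 \<le> renewal_time T k x \<longleftrightarrow> 1 \<le> k"
      using strict_mono_less[OF renewal_strict_mono[OF xs], of 0 k] by (auto simp: renewal_time_def Suc_le_eq)
    ultimately show ?thesis by auto
  qed
  ultimately show "renewal_set T x \<inter> {1..n} = set (points ts)"
    unfolding renewal_set_def by (auto simp del: atLeastAtMost_iff)
qed

lemma trajectory_unique:
  assumes "x \<in> trajectory ts" "x \<in> trajectory us" "ts \<in> compositions n" "us \<in> compositions n"
  shows "ts = us"
proof -
  have xs: "x \<in> space P" using assms by (simp add: trajectory_def)
  have "renewal_time T (length ts) x = renewal_time T (length us) x"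
    using trajectory_take[OF assms(1) order_refl] trajectory_take[OF assms(2) order_refl] assms(3,4) by (simp add: compositions_def)
  then have "length ts = length us" using strict_mono_eq[OF renewal_strict_mono[OF xs]] by blast
  then show ?thesis using assms(1,2) by (auto simp: trajectory_def intro: nth_equalityI)
qed

lemma trajectory_exists:
  assumes x: "x \<in> space P" and n: "n \<in> renewal_set T x"
  shows "\<exists>ts\<in>compositions n. x \<in> trajectory ts"
proof -
  obtain k where k: "n = renewal_time T k x" using n by (auto simp: renewal_set_def)
  define ts where "ts = map (\<lambda>i. T (Suc i) x) [0..<k]"
  have p: "x \<in> trajectory ts" using x by (simp add: trajectory_def ts_def)
  have "sum_list ts = n" using trajectory_take[OF p order_refl] by (simp add: k ts_def)
  moreover have "0 \<notin> set ts"
  proof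
    assume "0 \<in> set ts"
    then obtain i where "T (Suc i) x = 0" by (auto simp: ts_def)
    then show False using T_pos[OF _ x, of "Suc i"] by simp
  qed
  ultimately show ?thesis using p by (auto simp: compositions_def)
qed

text \<open>If \<open>n\<close> is a renewal point, exactly one composition of \<open>n\<close> is
  followed (\<open>trajectory_exists\<close>, \<open>trajectory_unique\<close>); otherwise none
  is.\<close>

lemma boltzmann_trajectories:
  fixes c :: "nat \<Rightarrow> real"
  assumes x: "x \<in> space P"
  shows "exp (\<Sum>k=1..n. c k * renewal_ind T k x) * renewal_ind T n x
       = (\<Sum>ts\<in>compositions n. exp (\<Sum>p\<leftarrow>points ts. c p) * indicator (trajectory ts) x)"
proof (cases "n \<in> renewal_set T x")
  case True
  obtain ts where ts: "ts \<in> compositions n" "x \<in> trajectory ts" using trajectory_exists[OF x True] by blast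
  have "(\<Sum>us\<in>compositions n. exp (\<Sum>p\<leftarrow>points us. c p) * indicator (trajectory us) x)
      = (\<Sum>us\<in>{ts}. exp (\<Sum>p\<leftarrow>points us. c p) * indicator (trajectory us) x)"
  proof (rule sum.mono_neutral_right[OF finite_compositions])
    show "\<forall>us\<in>compositions n - {ts}. exp (\<Sum>p\<leftarrow>points us. c p) * indicator (trajectory us) x = 0"
    proof
      fix us assume us: "us \<in> compositions n - {ts}"
      then have "x \<notin> trajectory us" using trajectory_unique[OF ts(2) _ ts(1), of us] by blast
      then show "exp (\<Sum>p\<leftarrow>points us. c p) * indicator (trajectory us) x = 0" by simp
    qed
  qed (use ts in simp)
  also have "\<dots> = exp (\<Sum>p\<leftarrow>points ts. c p)" using ts by simp
  also have "(\<Sum>p\<leftarrow>points ts. c p) = (\<Sum>p\<in>set (points ts). c p)"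
    using points_sorted[of ts] ts(1) by (intro sum_list_distinct_conv_sum_set) (auto simp: compositions_def strict_sorted_iff)
  also have "\<dots> = (\<Sum>k=1..n. c k * renewal_ind T k x)"
    unfolding trajectory_renewal_set(2)[OF ts(2,1), symmetric]
    by (intro sum.mono_neutral_cong_left) (auto simp: renewal_ind_def)
  finally show ?thesis using True by (simp add: renewal_ind_def)
next
  case False
  then have "x \<notin> trajectory ts" if "ts \<in> compositions n" for ts using trajectory_renewal_set(1)[OF _ that] by blast
  then have "(\<Sum>ts\<in>compositions n. exp (\<Sum>p\<leftarrow>points ts. c p) * indicator (trajectory ts) x) = 0"
    by (intro sum.neutral) simp
  then show ?thesis using False by (simp add: renewal_ind_def)
qed

lemma integral_renewal:
  fixes c :: "nat \<Rightarrow> real"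
  shows "(\<integral>x. exp (\<Sum>k=1..n. c k * renewal_ind T k x) * renewal_ind T n x \<partial>P)
       = (\<Sum>ts\<in>compositions n. prod_list (map (interarrival_mass P T) ts) * exp (\<Sum>p\<leftarrow>points ts. c p))"
proof -
  have "(\<integral>x. exp (\<Sum>k=1..n. c k * renewal_ind T k x) * renewal_ind T n x \<partial>P)
      = (\<integral>x. (\<Sum>ts\<in>compositions n. exp (\<Sum>p\<leftarrow>points ts. c p) * indicator (trajectory ts) x) \<partial>P)"
    by (intro Bochner_Integration.integral_cong refl boltzmann_trajectories)
  also have "\<dots> = (\<Sum>ts\<in>compositions n. \<integral>x. exp (\<Sum>p\<leftarrow>points ts. c p) * indicator (trajectory ts) x \<partial>P)"
    by (intro Bochner_Integration.integral_sum) (auto intro!: integrable_mult_right integrable_real_indicator simp: P.emeasure_finite less_top[symmetric])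
  also have "\<dots> = (\<Sum>ts\<in>compositions n. exp (\<Sum>p\<leftarrow>points ts. c p) * P.prob (trajectory ts))"
    by (simp add: Int_absorb1 sets.sets_into_space)
  finally show ?thesis by (simp add: prob_trajectory mult.commute)
qed

section \<open>Integrating over the Gaussian disorder\<close>

lemma \<omega>_measurable [measurable]: "\<omega> n \<in> borel_measurable Q" using gaussian by (auto simp: gaussian_sequence_def)

lemma linear_facts:
  fixes m :: nat and a :: "nat \<Rightarrow> real"
  defines "S \<equiv> \<lambda>w. \<Sum>i<m. a i * \<omega> i w"
  shows "integrable Q S" "integrable Q (\<lambda>w. (S w)\<^sup>2)" "integrable Q (\<lambda>w. exp (S w))"
    "(\<integral>w. S w \<partial>Q) = 0 \<Longrightarrow> (\<integral>w. exp (S w) \<partial>Q) = exp ((\<integral>w. (S w)\<^sup>2 \<partial>Q) / 2)"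
proof -
  have [measurable]: "S \<in> borel_measurable Q" unfolding S_def by measurable
  have "gaussian_law (distr Q borel S)" using gaussian by (auto simp: gaussian_sequence_def S_def)
  note g = gaussian_law_facts[OF this]
  show "integrable Q S" "integrable Q (\<lambda>w. (S w)\<^sup>2)" "integrable Q (\<lambda>w. exp (S w))"
    using g(1-3) by (auto simp: integrable_distr_eq)
  show "(\<integral>w. exp (S w) \<partial>Q) = exp ((\<integral>w. (S w)\<^sup>2 \<partial>Q) / 2)" if "(\<integral>w. S w \<partial>Q) = 0"
    using g(4) that by (simp add: integral_distr)
qed

text \<open>\<open>gaussian_sequence\<close> speaks of linear combinations over initial segments;
  one coordinate is written as such a combination to inherit its moments from
  \<open>linear_facts\<close>.\<close>

lemma \<omega>_single: "(\<Sum>i<Suc n. (if i = n then 1 else 0) * \<omega> i w) = \<omega> n w"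
proof -
  have "(\<Sum>i<Suc n. (if i = n then 1 else 0) * \<omega> i w) = (\<Sum>i<Suc n. if i = n then \<omega> n w else 0)"
    by (rule sum.cong) simp_all
  also have "\<dots> = \<omega> n w" by (simp only: sum.delta finite_lessThan lessThan_iff lessI if_True)
  finally show ?thesis .
qed

lemma \<omega>_integrable [simp]: "integrable Q (\<omega> n)" "integrable Q (\<lambda>w. (\<omega> n w)\<^sup>2)"
  using linear_facts(1,2)[where m = "Suc n" and a = "\<lambda>i. if i = n then 1 else 0"] by (simp_all only: \<omega>_single)

lemma \<omega>_prod_integrable [simp]: "integrable Q (\<lambda>w. \<omega> i w * \<omega> j w)"
proof (rule Bochner_Integration.integrable_bound)
  show "integrable Q (\<lambda>w. (\<omega> i w)\<^sup>2 + (\<omega> j w)\<^sup>2)" by simp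
  show "AE w in Q. norm (\<omega> i w * \<omega> j w) \<le> norm ((\<omega> i w)\<^sup>2 + (\<omega> j w)\<^sup>2)"
  proof (rule AE_I2)
    fix w
    have "0 \<le> (\<bar>\<omega> i w\<bar> - \<bar>\<omega> j w\<bar>)\<^sup>2" by simp
    then have "2 * (\<bar>\<omega> i w\<bar> * \<bar>\<omega> j w\<bar>) \<le> (\<omega> i w)\<^sup>2 + (\<omega> j w)\<^sup>2" by (simp add: power2_diff)
    moreover have "0 \<le> \<bar>\<omega> i w\<bar> * \<bar>\<omega> j w\<bar>" by simp
    ultimately have "\<bar>\<omega> i w\<bar> * \<bar>\<omega> j w\<bar> \<le> (\<omega> i w)\<^sup>2 + (\<omega> j w)\<^sup>2" by linarith
    then show "norm (\<omega> i w * \<omega> j w) \<le> norm ((\<omega> i w)\<^sup>2 + (\<omega> j w)\<^sup>2)" by (simp add: abs_mult)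
  qed
qed measurable

lemma stationary_integral:
  fixes f :: "(nat \<Rightarrow> real) \<Rightarrow> real"
  assumes [measurable]: "f \<in> borel_measurable (\<Pi>\<^sub>M n\<in>UNIV. borel)"
  shows "(\<integral>w. f (\<lambda>n. \<omega> (n + m) w) \<partial>Q) = (\<integral>w. f (\<lambda>n. \<omega> n w) \<partial>Q)"
proof -
  have [measurable]: "(\<lambda>w n. \<omega> (n + k) w) \<in> measurable Q (\<Pi>\<^sub>M n\<in>UNIV. borel)" for k
    by (rule measurable_PiM_single') auto
  have [measurable]: "(\<lambda>w n. \<omega> n w) \<in> measurable Q (\<Pi>\<^sub>M n\<in>UNIV. borel)"
    by (rule measurable_PiM_single') auto
  have "(\<integral>w. f (\<lambda>n. \<omega> (n + m) w) \<partial>Q) = (\<integral>s. f s \<partial>distr Q (\<Pi>\<^sub>M n\<in>UNIV. borel) (\<lambda>w n. \<omega> (n + m) w))"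
    by (simp add: integral_distr)
  also have "\<dots> = (\<integral>s. f s \<partial>distr Q (\<Pi>\<^sub>M n\<in>UNIV. borel) (\<lambda>w n. \<omega> n w))"
    using stationary by (simp add: stationary_sequence_def)
  also have "\<dots> = (\<integral>w. f (\<lambda>n. \<omega> n w) \<partial>Q)" by (simp add: integral_distr)
  finally show ?thesis .
qed

lemma \<omega>_mean [simp]: "(\<integral>w. \<omega> m w \<partial>Q) = 0"
  using stationary_integral[of "\<lambda>s. s 0" m] mean by simp
lemma \<omega>_variance [simp]: "(\<integral>w. (\<omega> m w)\<^sup>2 \<partial>Q) = 1"
  using stationary_integral[of "\<lambda>s. (s 0)\<^sup>2" m] variance by simp
lemma \<omega>_covariance: assumes "p \<le> q" shows "(\<integral>w. \<omega> p w * \<omega> q w \<partial>Q) = covariance Q (\<omega> 0) (\<omega> (q - p))"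
  using stationary_integral[of "\<lambda>s. s 0 * s (q - p)" p] assms by (simp add: covariance_def)

text \<open>The claims are proved together because expanding the square requires the mixed moment of
  the first point with the rest. The minimum over \<open>insert i (set ps)\<close> says, also for
  the empty list, that no point lies to the left of \<open>i\<close>, so the differences of naturals
  are genuine.\<close>

lemma sum_list_second_moment:
  assumes "sorted_wrt (<) ps"
  shows "integrable Q (\<lambda>w. (\<Sum>p\<leftarrow>ps. \<omega> p w)\<^sup>2) \<and> (\<forall>i. integrable Q (\<lambda>w. \<omega> i w * (\<Sum>p\<leftarrow>ps. \<omega> p w))) \<and>
    (\<forall>i\<le>Min (insert i (set ps)). (\<integral>w. \<omega> i w * (\<Sum>p\<leftarrow>ps. \<omega> p w) \<partial>Q) = (\<Sum>p\<leftarrow>ps. covariance Q (\<omega> 0) (\<omega> (p - i)))) \<and>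
    (\<integral>w. (\<Sum>p\<leftarrow>ps. \<omega> p w)\<^sup>2 \<partial>Q) = real (length ps) + 2 * pair_sum (\<lambda>n. covariance Q (\<omega> 0) (\<omega> n)) ps"
  using assms
proof (induction ps)
  case (Cons p ps)
  note IH = Cons.IH[OF conjunct2[OF Cons.prems[simplified]]]
  have pp: "p < q" if "q \<in> set ps" for q using Cons.prems that by simp
  have i1: "integrable Q (\<lambda>w. \<omega> i w * (\<Sum>p\<leftarrow>p # ps. \<omega> p w))" for i using IH by (simp add: distrib_left)
  have "(\<Sum>p\<leftarrow>p # ps. \<omega> p w)\<^sup>2 = (\<omega> p w)\<^sup>2 + 2 * (\<omega> p w * (\<Sum>p\<leftarrow>ps. \<omega> p w)) + (\<Sum>p\<leftarrow>ps. \<omega> p w)\<^sup>2" for w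
    by (simp add: power2_sum)
  moreover have "p \<le> Min (insert p (set ps))" using pp by (simp add: less_imp_le)
  ultimately show ?case using IH i1 by (auto simp: distrib_left \<omega>_covariance)
qed simp

lemma exp_sum_list:
  assumes ps: "sorted_wrt (<) ps"
  shows "integrable Q (\<lambda>w. exp (\<Sum>p\<leftarrow>ps. \<beta> * \<omega> p w + h))"
    "(\<integral>w. exp (\<Sum>p\<leftarrow>ps. \<beta> * \<omega> p w + h) \<partial>Q)
     = exp ((h + \<beta>\<^sup>2 / 2) * real (length ps) + pair_sum (\<lambda>n. \<beta>\<^sup>2 * covariance Q (\<omega> 0) (\<omega> n)) ps)"
proof -
  define m where "m = Suc (Max (insert 0 (set ps)))"
  have psm: "set ps \<subseteq> {..<m}" by (auto simp: m_def less_Suc_eq_le)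
  have d: "distinct ps" using ps by (simp add: strict_sorted_iff)
  define a where "a i = (if i \<in> set ps then \<beta> else 0)" for i
  have S: "(\<Sum>i<m. a i * \<omega> i w) = \<beta> * (\<Sum>p\<leftarrow>ps. \<omega> p w)" for w
  proof -
    have "(\<Sum>i<m. a i * \<omega> i w) = (\<Sum>i\<in>set ps. \<beta> * \<omega> i w)"
      using psm by (intro sum.mono_neutral_cong_right) (auto simp: a_def)
    then show ?thesis using d by (simp add: sum_list_distinct_conv_sum_set sum_distrib_left)
  qed
  have e: "exp (\<Sum>p\<leftarrow>ps. \<beta> * \<omega> p w + h) = exp (h * real (length ps)) * exp (\<beta> * (\<Sum>p\<leftarrow>ps. \<omega> p w))" for w
    by (simp add: sum_list_addf sum_list_triv sum_list_const_mult exp_add mult.commute)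
  note lin = linear_facts[where m = m and a = a, unfolded S]
  show "integrable Q (\<lambda>w. exp (\<Sum>p\<leftarrow>ps. \<beta> * \<omega> p w + h))" unfolding e using lin(3) by (rule integrable_mult_right)
  have "(\<integral>w. \<beta> * (\<Sum>p\<leftarrow>ps. \<omega> p w) \<partial>Q) = (\<integral>w. (\<Sum>i<m. a i * \<omega> i w) \<partial>Q)" by (simp add: S)
  also have "\<dots> = (\<Sum>i<m. a i * (\<integral>w. \<omega> i w \<partial>Q))" by (subst Bochner_Integration.integral_sum) auto
  finally have z: "(\<integral>w. \<beta> * (\<Sum>p\<leftarrow>ps. \<omega> p w) \<partial>Q) = 0" by simp
  have ps2: "pair_sum (\<lambda>n. c * f n) qs = c * pair_sum f qs" for c f qs
    by (induction qs) (auto simp: sum_list_const_mult distrib_left)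
  have "(\<integral>w. exp (\<Sum>p\<leftarrow>ps. \<beta> * \<omega> p w + h) \<partial>Q) = exp (h * real (length ps)) * exp ((\<integral>w. (\<beta> * (\<Sum>p\<leftarrow>ps. \<omega> p w))\<^sup>2 \<partial>Q) / 2)"
    unfolding e using lin(4)[OF z] by simp
  also have "(\<integral>w. (\<beta> * (\<Sum>p\<leftarrow>ps. \<omega> p w))\<^sup>2 \<partial>Q) = \<beta>\<^sup>2 * (real (length ps) + 2 * pair_sum (\<lambda>n. covariance Q (\<omega> 0) (\<omega> n)) ps)"
    using sum_list_second_moment[OF ps] by (simp add: power_mult_distrib)
  finally show "(\<integral>w. exp (\<Sum>p\<leftarrow>ps. \<beta> * \<omega> p w + h) \<partial>Q)
     = exp ((h + \<beta>\<^sup>2 / 2) * real (length ps) + pair_sum (\<lambda>n. \<beta>\<^sup>2 * covariance Q (\<omega> 0) (\<omega> n)) ps)"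
    unfolding ps2 by (simp add: exp_add[symmetric] algebra_simps)
qed

text \<open>The sum in the exponent starts at k = 1, so the origin carries no disorder and exerts no
  field: the recursion starts from the zero field rather than from \<open>\<eta>\<close>. The
  variance of each charge shifts \<open>h\<close> by \<open>\<beta>\<^sup>2 / 2\<close>.\<close>

theorem annealed_partition_eq:
  assumes "pinning (interarrival_mass P T) (\<lambda>n. \<beta>\<^sup>2 * covariance Q (\<omega> 0) (\<omega> n)) r C"
  shows "annealed_partition P T Q \<omega> n \<beta> h
    = pinning.Z (interarrival_mass P T) (\<lambda>n. \<beta>\<^sup>2 * covariance Q (\<omega> 0) (\<omega> n)) (h + \<beta>\<^sup>2 / 2) n (\<lambda>_. 0)"
proof -
  interpret pinning "interarrival_mass P T" "\<lambda>n. \<beta>\<^sup>2 * covariance Q (\<omega> 0) (\<omega> n)" r C by fact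
  have srt: "sorted_wrt (<) (points ts)" if "ts \<in> compositions n" for ts
    using points_sorted[of ts] that by (auto simp: compositions_def)
  have "annealed_partition P T Q \<omega> n \<beta> h = (\<integral>w. (\<Sum>ts\<in>compositions n. prod_list (map (interarrival_mass P T) ts) * exp (\<Sum>p\<leftarrow>points ts. \<beta> * \<omega> p w + h)) \<partial>Q)"
    unfolding annealed_partition_def integral_renewal ..
  also have "\<dots> = (\<Sum>ts\<in>compositions n. prod_list (map (interarrival_mass P T) ts) * (\<integral>w. exp (\<Sum>p\<leftarrow>points ts. \<beta> * \<omega> p w + h) \<partial>Q))"
    using exp_sum_list(1)[OF srt] by (subst Bochner_Integration.integral_sum) auto
  also have "\<dots> = Z (h + \<beta>\<^sup>2 / 2) n (\<lambda>_. 0)"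
    unfolding Z_compositions energy_eq using exp_sum_list(2)[OF srt] by (intro sum.cong refl) simp
  finally show ?thesis .
qed

end

section \<open>From the hypotheses on \<open>L\<close> and \<open>K\<close> to the three
  cases\<close>

lemma regvar_mass_of_form:
  assumes L: "slowly_varying L"
    and K: "\<And>n. n \<ge> 1 \<Longrightarrow> K n = L (real n) * real n powr (- (1 + \<alpha>)) \<and> K n > 0"
    and K_sum: "summable (\<lambda>n. K (Suc n))"
  shows "regvar_mass K \<alpha>"
proof
  show "K (Suc n) > 0" for n using K[of "Suc n"] by simp
  show "summable (\<lambda>n. K (Suc n))" by fact
  define p where "p = - (1 + \<alpha>)"
  have K_eq: "K n = L (real n) * real n powr p" if "n \<ge> 1" for n using K[OF that] by (simp add: p_def)
  have Lpos: "L x > 0" if "x > 0" for x using L that by (simp add: slowly_varying_def)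
  have "(\<lambda>n. real (Suc n) / real n) \<longlonglongrightarrow> 1" by (rule LIMSEQ_Suc_n_over_n)
  then have "(\<lambda>n. (real (Suc n) / real n) powr p) \<longlonglongrightarrow> 1 powr p" by (intro tendsto_intros) auto
  from tendsto_mult[OF slowly_varying_Suc[OF L] this]
  have "(\<lambda>n. L (real (Suc n)) / L (real n) * (real (Suc n) / real n) powr p) \<longlonglongrightarrow> 1" by simp
  moreover have "eventually (\<lambda>n. L (real (Suc n)) / L (real n) * (real (Suc n) / real n) powr p = K (Suc n) / K n) sequentially"
    using eventually_ge_at_top[of 1]
  proof eventually_elim
    case (elim n)
    then show ?case using K_eq[of n] K_eq[of "Suc n"] by (simp add: powr_divide)
  qed
  ultimately show "(\<lambda>n. K (Suc n) / K n) \<longlonglongrightarrow> 1" by (rule Lim_transform_eventually)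
  fix m :: nat assume m: "m \<ge> 1"
  have "((\<lambda>x. L (real m * x) / L x) \<longlongrightarrow> 1) at_top" using L m by (auto simp: slowly_varying_def)
  then have "(\<lambda>n. L (real m * real n) / L (real n)) \<longlonglongrightarrow> 1" by (rule filterlim_compose[OF _ filterlim_real_sequentially])
  from tendsto_mult_right[OF this, of "real m powr p"]
  have "(\<lambda>n. L (real m * real n) / L (real n) * real m powr p) \<longlonglongrightarrow> real m powr p" by simp
  moreover have "eventually (\<lambda>n. L (real m * real n) / L (real n) * real m powr p = K (n * m) / K n) sequentially"
    using eventually_ge_at_top[of 1]
  proof eventually_elim
    case (elim n)
    then have "n * m \<ge> 1" using m by simp
    then show ?case using K_eq[of n] K_eq[of "n * m"] elim by (simp add: powr_mult mult.commute[of "real m" "real n"])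
  qed
  ultimately show "(\<lambda>n. K (n * m) / K n) \<longlonglongrightarrow> real m powr - (1 + \<alpha>)"
    unfolding p_def by (rule Lim_transform_eventually)
qed

context pinning_disorder
begin

text \<open>The free energy is \<open>rate (h + c)\<close>, and \<open>rate\<close> vanishes exactly
  on the nonpositive reals, by \<open>rate_nonpos\<close> and, since \<open>gap\<close> tends to 0,
  by \<open>rate_pos\<close>. The zero set is thus a closed half-line ending at the critical point
  \<open>- c\<close>.\<close>

lemma free_energy_eq_rate:
  fixes \<beta> r C :: real
  defines "\<eta> \<equiv> \<lambda>n. \<beta>\<^sup>2 * covariance Q (\<omega> 0) (\<omega> n)"
  assumes pin: "pinning (interarrival_mass P T) \<eta> r C"
    and sub: "\<And>\<epsilon>. \<epsilon> > 0 \<Longrightarrow> \<exists>c>0. \<forall>n. c * exp (- \<epsilon> * real (Suc n)) \<le> interarrival_mass P T (Suc n)"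
    and gap: "(pinning.gap (interarrival_mass P T) \<eta> r C \<longlongrightarrow> 0) (at_right 0)"
  shows "annealed_free_energy P T Q \<omega> \<beta> (annealed_critical_point P T Q \<omega> \<beta> + \<delta>)
    = pinning.rate (interarrival_mass P T) \<eta> r C \<delta>"
proof -
  interpret pinning "interarrival_mass P T" \<eta> r C by fact
  define c where "c = \<beta>\<^sup>2 / 2 + ln (Lam 0)"
  have F: "annealed_free_energy P T Q \<omega> \<beta> h = rate (h + c)" for h
  proof -
    have "(\<lambda>n. 1 / real n * ln (annealed_partition P T Q \<omega> n \<beta> h)) \<longlonglongrightarrow> rate (h + \<beta>\<^sup>2 / 2 + ln (Lam 0))"
      unfolding annealed_partition_eq[OF pin[unfolded \<eta>_def], folded \<eta>_def]
      by (rule Z_growth[OF sub zero_fields])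
    from limI[OF this] show ?thesis by (simp add: annealed_free_energy_def c_def add.assoc)
  qed
  have "{h. annealed_free_energy P T Q \<omega> \<beta> h = 0} = {..- c}"
  proof -
    have "rate x = 0 \<longleftrightarrow> x \<le> 0" for x
      using rate_nonpos[of x] rate_pos[OF gap, of x] by (cases "x \<le> 0") auto
    then have "annealed_free_energy P T Q \<omega> \<beta> h = 0 \<longleftrightarrow> h \<le> - c" for h
      unfolding F by (simp add: le_minus_iff add.commute) linarith
    then show ?thesis by (simp add: atMost_def)
  qed
  then have "annealed_critical_point P T Q \<omega> \<beta> = - c" by (simp add: annealed_critical_point_def)
  then show ?thesis by (simp add: F)
qed

end

theorem theorem2p2:
  fixes P :: "'a measure" and T :: "nat \<Rightarrow> 'a \<Rightarrow> nat"
    and Q :: "'b measure" and \<omega> :: "nat \<Rightarrow> 'b \<Rightarrow> real"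
    and K :: "nat \<Rightarrow> real" and L :: "real \<Rightarrow> real" and \<alpha> :: real
    and \<rho> :: "nat \<Rightarrow> real"
    and F :: "real \<Rightarrow> real \<Rightarrow> real" and h\<^sub>c :: "real \<Rightarrow> real"
  assumes renewal: "iid_interarrivals P T"
    and K_def: "K = interarrival_mass P T"
    and alpha: "\<alpha> \<ge> 0"
    and L: "slowly_varying L"
    and K_form: "\<forall>n\<ge>1. K n = L (real n) * real n powr (- (1 + \<alpha>)) \<and> K n > 0"
    and K_sum: "(\<lambda>n. K (Suc n)) sums 1"
    and Q: "prob_space Q"
    and gaussian: "gaussian_sequence Q \<omega>"
    and stationary: "stationary_sequence Q \<omega>"
    and mean: "(\<integral>w. \<omega> 0 w \<partial>Q) = 0"
    and variance: "(\<integral>w. (\<omega> 0 w)\<^sup>2 \<partial>Q) = 1"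
    and rho_def: "\<rho> = (\<lambda>n. covariance Q (\<omega> 0) (\<omega> n))"
    and F_def: "F = annealed_free_energy P T Q \<omega>"
    and hc_def: "h\<^sub>c = annealed_critical_point P T Q \<omega>"
    and decay: "\<exists>C>0. \<exists>r. 0 < r \<and> r < 1 \<and> (\<forall>n\<ge>1. \<bar>\<rho> n\<bar> \<le> C * r ^ n)"
  shows "\<forall>\<beta>>0.
      (0 < \<alpha> \<and> \<alpha> < 1 \<longrightarrow>
        (\<exists>c>0. \<exists>Lt. slowly_varying Lt \<and>
          (\<lambda>\<delta>. F \<beta> (h\<^sub>c \<beta> + \<delta>)) \<sim>[at_right 0] (\<lambda>\<delta>. c * Lt (1 / \<delta>) * \<delta> powr (1 / \<alpha>)))) \<and>
      (\<alpha> = 1 \<and> \<not> summable (\<lambda>n. L (real n) / real n) \<longrightarrow>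
        (\<exists>c>0. \<exists>Lt. slowly_varying Lt \<and>
          (\<lambda>\<delta>. F \<beta> (h\<^sub>c \<beta> + \<delta>)) \<sim>[at_right 0] (\<lambda>\<delta>. c * Lt (1 / \<delta>) * \<delta>) \<and>
          ((\<lambda>\<delta>. Lt (1 / \<delta>)) \<longlongrightarrow> 0) (at_right 0))) \<and>
      (summable (\<lambda>n. real n * K n) \<longrightarrow>
        (\<exists>c>0. (\<lambda>\<delta>. F \<beta> (h\<^sub>c \<beta> + \<delta>)) \<sim>[at_right 0] (\<lambda>\<delta>. c * \<delta>)))"
proof (intro allI impI)
  fix \<beta> :: real assume \<beta>: "\<beta> > 0"
  obtain C r where C: "C > 0" and r: "0 < r" "r < 1" and dec: "\<And>n. n \<ge> 1 \<Longrightarrow> \<bar>\<rho> n\<bar> \<le> C * r ^ n"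
    using decay by blast
  interpret pinning_disorder P T Q \<omega>
  proof (intro pinning_disorder.intro pinning_disorder_axioms.intro)
    show "prob_space P" using renewal unfolding iid_interarrivals_def by blast
  qed (fact renewal Q gaussian stationary mean variance)+
  have K_eq: "K n = L (real n) * real n powr (- (1 + \<alpha>))" "K n > 0" if "n \<ge> 1" for n using K_form that by auto
  define \<eta> where "\<eta> = (\<lambda>n. \<beta>\<^sup>2 * covariance Q (\<omega> 0) (\<omega> n))"
  have \<eta>: "\<eta> n = \<beta>\<^sup>2 * \<rho> n" for n by (simp add: \<eta>_def rho_def)
  \<comment> \<open>The decay hypothesis starts at n = 1; the maximum extends the bound to index 0,
    as the locale requires.\<close>
  define C' where "C' = \<beta>\<^sup>2 * max C \<bar>\<rho> 0\<bar>"
  have pin: "pinning K \<eta> r C'"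
  proof
    show "K (Suc n) > 0" for n using K_eq(2)[of "Suc n"] by simp
    show "C' > 0" using \<beta> C by (simp add: C'_def less_max_iff_disj)
    show "\<bar>\<eta> s\<bar> \<le> C' * r ^ s" for s
    proof -
      have "\<bar>\<rho> s\<bar> \<le> max C \<bar>\<rho> 0\<bar> * r ^ s"
      proof (cases "s = 0")
        case False
        then have "\<bar>\<rho> s\<bar> \<le> C * r ^ s" by (intro dec) simp
        also have "\<dots> \<le> max C \<bar>\<rho> 0\<bar> * r ^ s" using r by (intro mult_right_mono) auto
        finally show ?thesis .
      qed simp
      then have "\<beta>\<^sup>2 * \<bar>\<rho> s\<bar> \<le> \<beta>\<^sup>2 * (max C \<bar>\<rho> 0\<bar> * r ^ s)" by (intro mult_left_mono) auto
      then show ?thesis by (simp add: \<eta> C'_def abs_mult mult.assoc)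
    qed
  qed (use K_sum r in auto)
  interpret pinning K \<eta> r C' by fact
  have rv: "regvar_mass K \<alpha>" using K_sum K_eq by (intro regvar_mass_of_form[OF L]) (auto simp: sums_iff)
  have F_rate: "F \<beta> (h\<^sub>c \<beta> + \<delta>) = rate \<delta>" if "(gap \<longlongrightarrow> 0) (at_right 0)" for \<delta>
    using free_energy_eq_rate[OF pin[unfolded K_def \<eta>_def] regvar_mass.subexponential[OF rv, unfolded K_def] that[unfolded K_def \<eta>_def]]
    by (simp add: F_def hc_def K_def \<eta>_def)
  \<comment> \<open>The factor 1 is the constant \<open>c\<close> of the claim. The last conjunct
    says that \<open>rate \<delta> / \<delta>\<close> tends to 0; for \<open>\<alpha> = 1\<close> it
    becomes the decay of \<open>Lt (1 / \<delta>)\<close>.\<close>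
  have inf_mean: "\<exists>Lt. slowly_varying Lt \<and> (\<lambda>\<delta>. F \<beta> (h\<^sub>c \<beta> + \<delta>)) \<sim>[at_right 0] (\<lambda>\<delta>. 1 * Lt (1 / \<delta>) * \<delta> powr (1 / \<alpha>)) \<and>
      ((\<lambda>\<delta>. Lt (1 / \<delta>) * \<delta> powr (1 / \<alpha>) / \<delta>) \<longlongrightarrow> 0) (at_right 0)"
    if ns: "\<not> summable (\<lambda>n. real n * K n)" and \<alpha>: "\<alpha> > 0"
  proof -
    note reg = rate_regularly_varying[OF rv ns \<alpha>]
    \<comment> \<open>The slowly varying factor is read off the free energy itself, so the equivalence is an equality.\<close>
    define Lt where "Lt x = rate (1 / x) * x powr (1 / \<alpha>)" for x
    have sv: "slowly_varying Lt"
      unfolding Lt_def using \<alpha> by (intro slowly_varying_rate reg) auto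
    have ev: "eventually (\<lambda>\<delta>. rate \<delta> = Lt (1 / \<delta>) * \<delta> powr (1 / \<alpha>)) (at_right 0)"
      using eventually_at_right_less[of "0::real"] by eventually_elim (simp add: Lt_def powr_divide)
    then have "eventually (\<lambda>\<delta>. F \<beta> (h\<^sub>c \<beta> + \<delta>) = 1 * Lt (1 / \<delta>) * \<delta> powr (1 / \<alpha>)) (at_right 0)"
      by eventually_elim (simp add: F_rate[OF reg(1)])
    then have "(\<lambda>\<delta>. F \<beta> (h\<^sub>c \<beta> + \<delta>)) \<sim>[at_right 0] (\<lambda>\<delta>. 1 * Lt (1 / \<delta>) * \<delta> powr (1 / \<alpha>))" by (rule asymp_equiv_refl_ev)
    moreover have "eventually (\<lambda>\<delta>. rate \<delta> / \<delta> = Lt (1 / \<delta>) * \<delta> powr (1 / \<alpha>) / \<delta>) (at_right 0)"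
      using ev by eventually_elim simp
    then have "((\<lambda>\<delta>. Lt (1 / \<delta>) * \<delta> powr (1 / \<alpha>) / \<delta>) \<longlongrightarrow> 0) (at_right 0)"
      by (rule Lim_transform_eventually[OF rate_sublinear[OF reg(2)]])
    ultimately show ?thesis using sv by blast
  qed
  show "(0 < \<alpha> \<and> \<alpha> < 1 \<longrightarrow>
        (\<exists>c>0. \<exists>Lt. slowly_varying Lt \<and>
          (\<lambda>\<delta>. F \<beta> (h\<^sub>c \<beta> + \<delta>)) \<sim>[at_right 0] (\<lambda>\<delta>. c * Lt (1 / \<delta>) * \<delta> powr (1 / \<alpha>)))) \<and>
      (\<alpha> = 1 \<and> \<not> summable (\<lambda>n. L (real n) / real n) \<longrightarrow>
        (\<exists>c>0. \<exists>Lt. slowly_varying Lt \<and>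
          (\<lambda>\<delta>. F \<beta> (h\<^sub>c \<beta> + \<delta>)) \<sim>[at_right 0] (\<lambda>\<delta>. c * Lt (1 / \<delta>) * \<delta>) \<and>
          ((\<lambda>\<delta>. Lt (1 / \<delta>)) \<longlongrightarrow> 0) (at_right 0))) \<and>
      (summable (\<lambda>n. real n * K n) \<longrightarrow>
        (\<exists>c>0. (\<lambda>\<delta>. F \<beta> (h\<^sub>c \<beta> + \<delta>)) \<sim>[at_right 0] (\<lambda>\<delta>. c * \<delta>)))"
  proof (intro conjI impI)
    assume "0 < \<alpha> \<and> \<alpha> < 1"
    then show "\<exists>c>0. \<exists>Lt. slowly_varying Lt \<and>
          (\<lambda>\<delta>. F \<beta> (h\<^sub>c \<beta> + \<delta>)) \<sim>[at_right 0] (\<lambda>\<delta>. c * Lt (1 / \<delta>) * \<delta> powr (1 / \<alpha>))"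
      using inf_mean[OF regvar_mass.nK_not_summable[OF rv]] zero_less_one by blast
  next
    assume *: "\<alpha> = 1 \<and> \<not> summable (\<lambda>n. L (real n) / real n)"
    have "real n * K n = L (real n) / real n" for n
    proof (cases "n = 0")
      case False
      then have "K n = L (real n) * real n powr - 2" using K_eq(1)[of n] * by simp
      then show ?thesis using False by (simp add: powr_minus powr_numeral power2_eq_square field_simps)
    qed simp
    then have ns: "\<not> summable (\<lambda>n. real n * K n)" using * by simp
    obtain Lt where Lt: "slowly_varying Lt"
      "(\<lambda>\<delta>. F \<beta> (h\<^sub>c \<beta> + \<delta>)) \<sim>[at_right 0] (\<lambda>\<delta>. 1 * Lt (1 / \<delta>) * \<delta> powr (1 / \<alpha>))"
      "((\<lambda>\<delta>. Lt (1 / \<delta>) * \<delta> powr (1 / \<alpha>) / \<delta>) \<longlongrightarrow> 0) (at_right 0)"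
      using inf_mean[OF ns] * by auto
    have pw: "eventually (\<lambda>\<delta>. \<delta> powr (1 / \<alpha>) = \<delta>) (at_right 0)"
      using eventually_at_right_less[of "0::real"] by eventually_elim (simp add: *)
    have "eventually (\<lambda>\<delta>. 1 * Lt (1 / \<delta>) * \<delta> powr (1 / \<alpha>) = 1 * Lt (1 / \<delta>) * \<delta>) (at_right 0)"
      using pw by eventually_elim simp
    from asymp_equiv_trans[OF Lt(2) asymp_equiv_refl_ev[OF this]]
    have 2: "(\<lambda>\<delta>. F \<beta> (h\<^sub>c \<beta> + \<delta>)) \<sim>[at_right 0] (\<lambda>\<delta>. 1 * Lt (1 / \<delta>) * \<delta>)" .
    have "eventually (\<lambda>\<delta>. Lt (1 / \<delta>) * \<delta> powr (1 / \<alpha>) / \<delta> = Lt (1 / \<delta>)) (at_right 0)"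
      using pw eventually_at_right_less[of "0::real"] by eventually_elim simp
    from Lim_transform_eventually[OF Lt(3) this]
    have 3: "((\<lambda>\<delta>. Lt (1 / \<delta>)) \<longlongrightarrow> 0) (at_right 0)" .
    show "\<exists>c>0. \<exists>Lt. slowly_varying Lt \<and>
          (\<lambda>\<delta>. F \<beta> (h\<^sub>c \<beta> + \<delta>)) \<sim>[at_right 0] (\<lambda>\<delta>. c * Lt (1 / \<delta>) * \<delta>) \<and>
          ((\<lambda>\<delta>. Lt (1 / \<delta>)) \<longlongrightarrow> 0) (at_right 0)"
      using Lt(1) 2 3 zero_less_one by blast
  next
    assume sm: "summable (\<lambda>n. real n * K n)"
    obtain m where m: "m > 0" "((\<lambda>l. gap l / l) \<longlongrightarrow> m) (at_right 0)" using gap_finite_mean[OF sm] by blast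
    have gap0: "(gap \<longlongrightarrow> 0) (at_right 0)"
      by (rule gap_tendsto_0[OF _ _ m(2)]) (simp_all add: eventually_at_right_less tendsto_ident_at)
    have "((\<lambda>\<delta>. m * (rate \<delta> / \<delta>)) \<longlongrightarrow> m * (1 / m)) (at_right 0)" by (intro tendsto_mult_left rate_linear m)
    then have "((\<lambda>\<delta>. F \<beta> (h\<^sub>c \<beta> + \<delta>) / (1 / m * \<delta>)) \<longlongrightarrow> 1) (at_right 0)"
      using m(1) by (simp add: F_rate[OF gap0] mult.commute)
    then have "(\<lambda>\<delta>. F \<beta> (h\<^sub>c \<beta> + \<delta>)) \<sim>[at_right 0] (\<lambda>\<delta>. 1 / m * \<delta>)" by (rule asymp_equivI')
    then show "\<exists>c>0. (\<lambda>\<delta>. F \<beta> (h\<^sub>c \<beta> + \<delta>)) \<sim>[at_right 0] (\<lambda>\<delta>. c * \<delta>)"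
      using m(1) by (intro exI[of _ "1 / m"]) auto
  qed
qed

end
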